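(* Let $m>0$ and let $A=(A_1,A_2,A_3):\mathbb{R}^3\to\mathbb{R}^3$ be measurable and such that, for some constants $C>0$ and $\rho>1$, $|A_j(x)|\le C\langle x\rangle^{-\rho}$ for $j=1,2,3$. Suppose that $m$ (resp. $-m$) is an eigenvalue of $H_A$, and let $f$ be an $m$ mode (resp. a $-m$ mode) of $H_A$. Then there exists a zero mode $\varphi^+$ (resp. $\varphi^-$) of $T_A$ such that for any $\omega\in\mathbb{S}^2$ $$\lim_{r\to\infty} r^2 f(r\omega)=\begin{pmatrix} u^+(\omega) \\ 0 \end{pmatrix}\quad\Big(\text{resp. }\begin{pmatrix} 0 \\ u^-(\omega) \end{pmatrix}\Big),$$ where $$u^{\pm}(\omega)=\frac{i}{4\pi}\int_{\mathbb{R}^3}\big\{(\omega\cdot A(y))I_2+i\sigma\cdot(\omega\times A(y))\big\}\varphi^{\pm}(y)\,dy,$$ and the convergence is uniform with respect to $\omega\in\mathbb{S}^2$.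
   Context: $\langle x\rangle=\sqrt{1+|x|^2}$, $D=\frac1i\nabla_x$, and $\sigma=(\sigma_1,\sigma_2,\sigma_3)$ are the Pauli matrices $\sigma_1=\begin{pmatrix} 0&1 \\ 1&0 \end{pmatrix}$, $\sigma_2=\begin{pmatrix} 0&-i \\ i&0 \end{pmatrix}$, $\sigma_3=\begin{pmatrix} 1&0 \\ 0&-1 \end{pmatrix}$; $I_2$ is the $2\times2$ identity matrix. For a vector $v\in\mathbb{R}^3$, $\sigma\cdot v=\sum_j v_j\sigma_j$, and $\times$ is the cross product in $\mathbb{R}^3$. The Dirac matrices are $\alpha_j=\begin{pmatrix} \mathbf 0&\sigma_j \\ \sigma_j&\mathbf 0 \end{pmatrix}$ $(j=1,2,3)$ and $\beta=\begin{pmatrix} I_2&\mathbf 0 \\ \mathbf 0&-I_2 \end{pmatrix}$. The Weyl-Dirac operator $T_A=\sigma\cdot(D-A(x))$ is the self-adjoint operator in $[L^2(\mathbb{R}^3)]^2$ with domain $[H^1(\mathbb{R}^3)]^2$, and the magnetic Dirac operator $H_A=\alpha\cdot(D-A(x))+m\beta$ is the self-adjoint operator in $[L^2(\mathbb{R}^3)]^4$ with domain $[H^1(\mathbb{R}^3)]^4$ ($H^1$ is the Sobolev space of order 1). An $m$ mode (resp. $-m$ mode) of $H_A$ is an eigenfunction of $H_A$ corresponding to the eigenvalue $m$ (resp. $-m$). A zero mode of $T_A$ is an eigenfunction of $T_A$ corresponding to the eigenvalue $0$. Under the stated hypothesis on $A$, every eigenfunction of $H_A$ for the eigenvalue $\pm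 m$ is (has a representative which is) a continuous function of $x$; $f(r\omega)$ refers to this continuous representative. Vectors in $\mathbb{C}^4$ are written as pairs of vectors in $\mathbb{C}^2$. *)

theory Defs
  imports "HOL-Analysis.Analysis"
begin

text \<open>
  Elements of the Lebesgue and Sobolev spaces are represented by functions; two functions that
  agree almost everywhere represent the same element.
\<close>

definition L2 :: "(real^3 \<Rightarrow> complex) set" where
  "L2 = {u. u \<in> borel_measurable lebesgue \<and> integrable lebesgue (\<lambda>x. (cmod (u x))\<^sup>2)}"

primrec Ck :: "nat \<Rightarrow> (real^3 \<Rightarrow> real) \<Rightarrow> bool" where
  "Ck 0 h \<longleftrightarrow> continuous_on UNIV h"
| "Ck (Suc k) h \<longleftrightarrow> (\<forall>x. h differentiable (at x)) \<and>
      (\<forall>v. Ck k (\<lambda>x. frechet_derivative h (at x) v))"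

definition test_fun :: "(real^3 \<Rightarrow> real) \<Rightarrow> bool" where
  "test_fun h \<longleftrightarrow> (\<forall>k. Ck k h) \<and> compact (closure {x. h x \<noteq> 0})"

text \<open>Only used for \<open>u\<close> and \<open>v\<close> in \<open>L2\<close>, so that both integrals converge.\<close>

definition has_weak_partial :: "3 \<Rightarrow> (real^3 \<Rightarrow> complex) \<Rightarrow> (real^3 \<Rightarrow> complex) \<Rightarrow> bool" where
  "has_weak_partial j u v \<longleftrightarrow>
     (\<forall>h. test_fun h \<longrightarrow>
        (LINT x|lebesgue. frechet_derivative h (at x) (axis j 1) *\<^sub>R u x)
          = - (LINT x|lebesgue. h x *\<^sub>R v x))"

definition H1 :: "(real^3 \<Rightarrow> complex) set" where
  "H1 = {u \<in> L2. \<forall>j. \<exists>v \<in> L2. has_weak_partial j u v}"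

text \<open>The choice is immaterial: weak derivatives are unique up to null sets.\<close>

definition weak_partial :: "3 \<Rightarrow> (real^3 \<Rightarrow> complex) \<Rightarrow> (real^3 \<Rightarrow> complex)" where
  "weak_partial j u = (SOME v. v \<in> L2 \<and> has_weak_partial j u v)"

definition H1_vec :: "(real^3 \<Rightarrow> complex^'n) set" where
  "H1_vec = {u. \<forall>k. (\<lambda>x. u x $ k) \<in> H1}"

definition pauli :: "(complex^2^2)^3" where
  "pauli = vector [vector [vector [0, 1], vector [1, 0]],
                   vector [vector [0, -\<i>], vector [\<i>, 0]],
                   vector [vector [1, 0], vector [0, -1]]]"

definition block :: "complex^2^2 \<Rightarrow> complex^2^2 \<Rightarrow> complex^2^2 \<Rightarrow> complex^2^2 \<Rightarrow> complex^4^4" where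
  "block P Q R S =
     vector [vector [P$1$1, P$1$2, Q$1$1, Q$1$2],
             vector [P$2$1, P$2$2, Q$2$1, Q$2$2],
             vector [R$1$1, R$1$2, S$1$1, S$1$2],
             vector [R$2$1, R$2$2, S$2$1, S$2$2]]"

definition dirac_alpha :: "(complex^4^4)^3" where
  "dirac_alpha = (\<chi> j. block 0 (pauli $ j) (pauli $ j) 0)"

definition dirac_beta :: "complex^4^4" where
  "dirac_beta = block (mat 1) 0 0 (- mat 1)"

definition spinor_pair :: "complex^2 \<Rightarrow> complex^2 \<Rightarrow> complex^4" where
  "spinor_pair a b = vector [a$1, a$2, b$1, b$2]"

definition cscale_mat :: "complex \<Rightarrow> complex^'n^'m \<Rightarrow> complex^'n^'m" where
  "cscale_mat c M = (\<chi> i k. c * M $ i $ k)"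

definition sigma_dot :: "real^3 \<Rightarrow> complex^2^2" where
  "sigma_dot v = (\<Sum>j\<in>UNIV. cscale_mat (of_real (v $ j)) (pauli $ j))"

text \<open>The \<open>j\<close>-th component of \<open>D - A\<close>, acting on each spinor component.\<close>

definition mag_momentum ::
    "(real^3 \<Rightarrow> real^3) \<Rightarrow> 3 \<Rightarrow> (real^3 \<Rightarrow> complex^'n) \<Rightarrow> (real^3 \<Rightarrow> complex^'n)" where
  "mag_momentum A j u =
     (\<lambda>x. \<chi> k. (1 / \<i>) * weak_partial j (\<lambda>y. u y $ k) x - of_real (A x $ j) * u x $ k)"

definition weyl_dirac ::
    "(real^3 \<Rightarrow> real^3) \<Rightarrow> (real^3 \<Rightarrow> complex^2) \<Rightarrow> (real^3 \<Rightarrow> complex^2)" where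
  "weyl_dirac A u = (\<lambda>x. \<Sum>j\<in>UNIV. pauli $ j *v mag_momentum A j u x)"

definition dirac ::
    "real \<Rightarrow> (real^3 \<Rightarrow> real^3) \<Rightarrow> (real^3 \<Rightarrow> complex^4) \<Rightarrow> (real^3 \<Rightarrow> complex^4)" where
  "dirac m A u =
     (\<lambda>x. (\<Sum>j\<in>UNIV. dirac_alpha $ j *v mag_momentum A j u x)
           + complex_of_real m *s (dirac_beta *v u x))"

text \<open>
  Eigenfunctions, for the eigenvalue \<open>z\<close>, of an operator \<open>T\<close> with domain \<open>H1_vec\<close>. They are
  nonzero as elements of the Lebesgue space, so \<open>z\<close> is then an eigenvalue.
\<close>

definition eigenfunction ::
    "((real^3 \<Rightarrow> complex^'n) \<Rightarrow> (real^3 \<Rightarrow> complex^'n)) \<Rightarrow> complex \<Rightarrow> (real^3 \<Rightarrow> complex^'n) \<Rightarrow> bool"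
  where
  "eigenfunction T z u \<longleftrightarrow>
     u \<in> H1_vec \<and> \<not> (AE x in lebesgue. u x = 0) \<and> (AE x in lebesgue. T u x = z *s u x)"

abbreviation zero_mode :: "(real^3 \<Rightarrow> real^3) \<Rightarrow> (real^3 \<Rightarrow> complex^2) \<Rightarrow> bool" where
  "zero_mode A \<equiv> eigenfunction (weyl_dirac A) 0"

definition continuous_rep :: "(real^3 \<Rightarrow> complex^'n) \<Rightarrow> (real^3 \<Rightarrow> complex^'n) \<Rightarrow> bool" where
  "continuous_rep f g \<longleftrightarrow> continuous_on UNIV g \<and> (AE x in lebesgue. g x = f x)"

definition japanese_bracket :: "real^3 \<Rightarrow> real" where
  "japanese_bracket x = sqrt (1 + (norm x)\<^sup>2)"

definition profile_integrand ::
    "(real^3 \<Rightarrow> real^3) \<Rightarrow> (real^3 \<Rightarrow> complex^2) \<Rightarrow> real^3 \<Rightarrow> real^3 \<Rightarrow> complex^2" where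
  "profile_integrand A \<phi> \<omega> y =
     (cscale_mat (of_real (\<omega> \<bullet> A y)) (mat 1)
        + cscale_mat \<i> (sigma_dot (cross3 \<omega> (A y)))) *v \<phi> y"

definition profile ::
    "(real^3 \<Rightarrow> real^3) \<Rightarrow> (real^3 \<Rightarrow> complex^2) \<Rightarrow> real^3 \<Rightarrow> complex^2" where
  "profile A \<phi> \<omega> =
     (\<i> / (4 * complex_of_real pi)) *s (LINT y|lebesgue. profile_integrand A \<phi> \<omega> y)"

end

theory Submission
  imports Defs "HOL-Computational_Algebra.Polynomial"
begin

text \<open>
  Let \<open>f\<close> be an \<open>m\<close> mode and write \<open>f = (a, b)\<close> with two-component spinors \<open>a\<close> and \<open>b\<close>.
  Since the Dirac matrices \<open>\<alpha>\<close> swap the two halves, the eigenvalue equation reads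
  \<open>T b = 0\<close> and \<open>T a = 2 m b\<close>, where \<open>T\<close> is the Weyl-Dirac operator. As \<open>T\<close> is symmetric,
  \<open>2 m \<parallel>b\<parallel>\<^sup>2 = \<langle>T a, b\<rangle> = \<langle>a, T b\<rangle> = 0\<close>, so \<open>b\<close> vanishes and \<open>a\<close> is a zero mode. For the
  eigenvalue \<open>-m\<close> the halves exchange their roles. Everything else is a statement on zero modes.

  Let \<open>\<phi>\<close> be a zero mode and \<open>F = \<sigma>\<cdot>A \<phi>\<close>, so that \<open>\<sigma>\<cdot>D \<phi> = F\<close>. Inverting \<open>\<sigma>\<cdot>D\<close> gives
  \<open>\<phi>(x) = 1/(4\<pi>) \<integral> i\<sigma>\<cdot>(x - y) |x - y|\<^sup>-\<^sup>3 F(y) dy\<close> for almost every \<open>x\<close>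
  (\<open>spin_potential_representation\<close>). It is obtained by testing the weak equation with
  \<open>z (|z|\<^sup>2 + d\<^sup>2)\<^sup>-\<^sup>3\<^sup>/\<^sup>2\<close>, \<open>z = x - y\<close>, times a smooth cutoff: as the cutoff is removed the left-hand
  side becomes \<open>4\<pi>\<close> times the convolution of \<open>\<phi>\<close> with an approximate identity of width \<open>d\<close>, and one lets
  \<open>d\<close> tend to \<open>0\<close> after integrating \<open>x\<close> over a box.

  Consequently \<open>|\<phi>|\<close> is dominated by the potential of \<open>\<langle>y\<rangle>\<^sup>-\<^sup>\<rho> |\<phi>(y)|\<close> with kernel \<open>|x - y|\<^sup>-\<^sup>2\<close>.
  A comparison argument with the weight \<open>w(x) = \<langle>x\<rangle>\<^sup>-\<^sup>2\<close> turns this into \<open>|\<phi>| \<le> M w\<close> in one step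
  (\<open>riesz_subsolution_decay\<close>): the part of the kernel with \<open>y\<close> far out or close to \<open>x\<close>
  maps \<open>w\<close> below \<open>w/2\<close>, and so does its transpose, while the remaining part maps \<open>|\<phi>|\<close> below a
  multiple of \<open>w\<close>. The excess \<open>h\<close> of \<open>|\<phi>|\<close> over a large multiple of \<open>w\<close> then satisfies
  \<open>\<integral> h w \<le> 1/2 \<integral> h w < \<infinity>\<close>, whence \<open>h = 0\<close>.

  With this decay \<open>|F(y)| \<le> K \<langle>y\<rangle>\<^sup>-\<^sup>2\<^sup>-\<^sup>\<rho>\<close> is integrable and the potential is a continuous function.
  For \<open>x = r\<omega>\<close> the vector \<open>r\<^sup>2 (x - y) |x - y|\<^sup>-\<^sup>3\<close> tends to \<open>\<omega>\<close>, with an error that is integrable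
  against \<open>|F|\<close> and of size \<open>r\<^sup>-\<^sup>\<kappa>\<close> uniformly in \<open>\<omega>\<close> (\<open>spin_potential_asymptotics\<close>). The limit
  \<open>1/(4\<pi>) \<integral> i\<sigma>\<cdot>\<omega> \<sigma>\<cdot>A \<phi>\<close> is the asserted profile, because
  \<open>\<sigma>\<cdot>\<omega> \<sigma>\<cdot>A = \<omega>\<cdot>A + i\<sigma>\<cdot>(\<omega> \<times> A)\<close>.

  The decay also makes the symmetry of \<open>T\<close> elementary: with both functions written as potentials,
  \<open>\<langle>T a, b\<rangle> = \<langle>a, T b\<rangle>\<close> is Fubini's theorem and the antisymmetry of the kernel
  (\<open>weak_dirac_symmetric\<close>), with no approximation of Sobolev functions by test functions.
\<close>

section \<open>Radial integrals and the Japanese bracket\<close>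

lemma nn_integral_lborel_reflect:
  fixes f :: "'a::euclidean_space \<Rightarrow> ennreal" and x :: 'a
  assumes [measurable]: "f \<in> borel_measurable borel"
  shows "(\<integral>\<^sup>+y. f (x - y) \<partial>lborel) = (\<integral>\<^sup>+z. f z \<partial>lborel)"
proof -
  have "(\<integral>\<^sup>+z. f z \<partial>lborel)
      = (\<integral>\<^sup>+z. f z \<partial>(density (distr lborel borel (\<lambda>y. x + (-1) *\<^sub>R y)) (\<lambda>_. ennreal (\<bar>-1\<bar> ^ DIM('a)))))"
    by (rule arg_cong[where f = "\<lambda>M. integral\<^sup>N M f", OF lborel_affine]) simp
  also have "\<dots> = (\<integral>\<^sup>+y. f (x - y) \<partial>lborel)"
    by (simp add: nn_integral_density nn_integral_distr)
  finally show ?thesis by simp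
qed

text \<open>
  Polar coordinates for radial functions. Both measures give a half-line \<open>{..r}\<close> the volume of the
  ball of radius \<open>r\<close>, and half-lines determine a \<open>\<sigma>\<close>-finite measure.
\<close>

lemma distr_norm_lborel:
  "distr lborel borel (norm :: real^3 \<Rightarrow> real)
     = density lborel (\<lambda>r. ennreal (4 * pi * r\<^sup>2) * indicator {0..} r)" (is "?M = ?N")
proof (rule measure_eqI_generator_eq[where E = "range atMost" and \<Omega> = UNIV and A = "\<lambda>n. {..real n}"])
  show "Int_stable (range (atMost :: real \<Rightarrow> _))"
    by (auto simp: Int_stable_def)
  show "sets ?M = sigma_sets UNIV (range atMost)"
    by (simp add: borel_eq_atMost)
  show "sets ?N = sigma_sets UNIV (range atMost)"
    by (simp add: borel_eq_atMost)
  show "(\<Union>i. {..real i}) = UNIV"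
    using real_arch_simple by auto
  have vol: "emeasure ?M {..r} = (if r < 0 then 0 else ennreal (4 / 3 * pi * r ^ 3))" for r
  proof -
    have "emeasure ?M {..r} = emeasure lborel (norm -` {..r} \<inter> space (lborel :: (real^3) measure))"
      by (rule emeasure_distr) auto
    also have "norm -` {..r} \<inter> space (lborel :: (real^3) measure) = cball (0 :: real^3) r"
      by (auto simp: dist_norm)
    finally show ?thesis
      by (cases "r < 0") (simp_all add: emeasure_cball unit_ball_vol_3 ac_simps power3_eq_cube)
  qed
  have dens: "emeasure ?N {..r} = (if r < 0 then 0 else ennreal (4 / 3 * pi * r ^ 3))" for r
  proof (cases "r < 0")
    case True
    then have "indicator {0..} s * indicator {..r} s = (0::ennreal)" for s
      by (auto simp: indicator_def)
    then have "emeasure ?N {..r} = 0"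
      by (subst emeasure_density) (auto simp: nn_integral_0_iff_AE indicator_def)
    then show ?thesis
      using True by simp
  next
    case False
    have "emeasure ?N {..r} = (\<integral>\<^sup>+s. ennreal (4 * pi * s\<^sup>2) * indicator {0..r} s \<partial>lborel)"
      by (subst emeasure_density) (auto intro!: nn_integral_cong simp: indicator_def)
    also have "\<dots> = ennreal (4 / 3 * pi * r ^ 3 - 4 / 3 * pi * 0 ^ 3)"
      using False by (intro nn_integral_FTC_Icc) (auto intro!: derivative_eq_intros)
    finally show ?thesis
      using False by simp
  qed
  show "emeasure ?M X = emeasure ?N X" if "X \<in> range atMost" for X
    using that vol dens by auto
  show "emeasure ?M {..real i} \<noteq> \<infinity>" for i
    by (simp add: vol)
qed auto

lemma nn_integral_radial:
  assumes [measurable]: "f \<in> borel_measurable borel"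
  shows "(\<integral>\<^sup>+z. f (norm (z :: real^3)) \<partial>lborel)
       = (\<integral>\<^sup>+r. ennreal (4 * pi * r\<^sup>2) * indicator {0..} r * f r \<partial>lborel)"
proof -
  have "(\<integral>\<^sup>+z. f (norm (z :: real^3)) \<partial>lborel) = (\<integral>\<^sup>+r. f r \<partial>distr lborel borel (norm :: real^3 \<Rightarrow> real))"
    by (simp add: nn_integral_distr)
  then show ?thesis
    by (simp add: distr_norm_lborel nn_integral_density)
qed

text \<open>
  The size of the kernel of \<open>(\<sigma>\<cdot>D)\<^sup>-\<^sup>1\<close>, up to the factor \<open>4\<pi>\<close>. At the origin its value is
  \<open>1 / 0 = 0\<close>, as for the spinor-valued kernel below.
\<close>

definition riesz :: "real^3 \<Rightarrow> real"
  where "riesz z = 1 / (norm z)\<^sup>2"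

lemma riesz_measurable [measurable]: "riesz \<in> borel_measurable borel"
  unfolding riesz_def[abs_def] by measurable

lemma riesz_nonneg [simp]: "riesz z \<ge> 0"
  by (simp add: riesz_def)

lemma riesz_minus_commute: "riesz (x - y) = riesz (y - x)"
  by (simp add: riesz_def norm_minus_commute)

lemma nn_integral_riesz_ball:
  assumes "d \<ge> 0"
  shows "(\<integral>\<^sup>+z. ennreal (riesz z) * indicator {..d} (norm z) \<partial>lborel) \<le> ennreal (4 * pi * d)"
proof -
  have "(\<integral>\<^sup>+z. ennreal (riesz z) * indicator {..d} (norm z) \<partial>lborel)
     = (\<integral>\<^sup>+r. ennreal (4 * pi * r\<^sup>2) * indicator {0..} r * (ennreal (1 / r\<^sup>2) * indicator {..d} r) \<partial>lborel)"
    unfolding riesz_def by (rule nn_integral_radial) measurable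
  also have "\<dots> \<le> (\<integral>\<^sup>+r. ennreal (4 * pi) * indicator {0..d} r \<partial>lborel)"
    by (intro nn_integral_mono) (auto simp: indicator_def ennreal_mult'[symmetric])
  also have "\<dots> = ennreal (4 * pi * d)"
    using assms by (simp add: nn_integral_cmult ennreal_mult'[symmetric])
  finally show ?thesis .
qed

lemma nn_integral_riesz_cball:
  assumes "d \<ge> 0"
  shows "(\<integral>\<^sup>+y. ennreal (riesz (x - y)) * indicator {..d} (norm (x - y)) \<partial>lborel) \<le> ennreal (4 * pi * d)"
  using nn_integral_riesz_ball[OF assms]
    nn_integral_lborel_reflect[of "\<lambda>z. ennreal (riesz z) * indicator {..d} (norm z)" x]
  by simp

lemma jb_ge_1: "japanese_bracket x \<ge> 1"
  by (simp add: japanese_bracket_def)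

lemma jb_pos [simp]: "japanese_bracket x > 0"
  using jb_ge_1[of x] by linarith

lemma jb_nonneg [simp]: "japanese_bracket x \<ge> 0"
  using jb_pos[of x] by linarith

lemma jb_nonzero [simp]: "japanese_bracket x \<noteq> 0"
  using jb_pos[of x] by linarith

lemma jb_measurable [measurable]: "japanese_bracket \<in> borel_measurable borel"
  unfolding japanese_bracket_def[abs_def] by measurable

lemma norm_le_jb: "norm x \<le> japanese_bracket x"
  unfolding japanese_bracket_def by (rule real_le_rsqrt) simp

lemma jb_le: "japanese_bracket x \<le> 1 + norm x"
  unfolding japanese_bracket_def by (rule real_le_lsqrt) (auto simp: power2_eq_square algebra_simps)

lemma jb_triangle: "japanese_bracket y \<le> japanese_bracket x + norm (x - y)"
proof -
  have "norm y \<le> norm x + norm (x - y)"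
    by (metis norm_minus_commute norm_triangle_sub)
  then have "(norm y)\<^sup>2 \<le> (norm x + norm (x - y))\<^sup>2"
    by (intro power_mono) auto
  also have "\<dots> \<le> (japanese_bracket x + norm (x - y))\<^sup>2 - 1"
  proof -
    have "(japanese_bracket x)\<^sup>2 = 1 + (norm x)\<^sup>2"
      by (simp add: japanese_bracket_def)
    moreover have "norm x * norm (x - y) \<le> japanese_bracket x * norm (x - y)"
      by (intro mult_right_mono norm_le_jb) auto
    ultimately show ?thesis by (simp add: power2_sum)
  qed
  finally have "1 + (norm y)\<^sup>2 \<le> (japanese_bracket x + norm (x - y))\<^sup>2" by simp
  then show ?thesis
    unfolding japanese_bracket_def[of y] by (intro real_le_lsqrt add_nonneg_nonneg) (auto intro: less_imp_le)
qed

text \<open>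
  In polar coordinates the integrand is at most \<open>4\<pi>\<close> for radii below \<open>1\<close> and at most \<open>4\<pi> r\<^sup>2\<^sup>-\<^sup>t\<close>
  beyond.
\<close>

lemma nn_integral_jb_finite:
  assumes "t > 3"
  shows "(\<integral>\<^sup>+y. ennreal (japanese_bracket y powr - t) \<partial>lborel) < \<infinity>"
proof -
  have "(\<integral>\<^sup>+y. ennreal (japanese_bracket y powr - t) \<partial>lborel)
      = (\<integral>\<^sup>+y. ennreal (sqrt (1 + (norm (y::real^3))\<^sup>2) powr - t) \<partial>lborel)"
    by (simp add: japanese_bracket_def)
  also have "\<dots> = (\<integral>\<^sup>+r. ennreal (4 * pi * r\<^sup>2) * indicator {0..} r * ennreal (sqrt (1 + r\<^sup>2) powr - t) \<partial>lborel)"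
    by (rule nn_integral_radial) measurable
  also have "\<dots> \<le> (\<integral>\<^sup>+r. ennreal (4 * pi) * indicator {0..1} r
                      + ennreal (4 * pi * r powr (2 - t)) * indicator {1..} r \<partial>lborel)"
  proof (intro nn_integral_mono)
    fix r :: real
    have s: "sqrt (1 + r\<^sup>2) \<ge> 1" "sqrt (1 + r\<^sup>2) \<ge> r"
      by (auto intro: real_le_rsqrt)
    consider "r < 0" | "0 \<le> r" "r \<le> 1" | "r > 1" by linarith
    then show "ennreal (4 * pi * r\<^sup>2) * indicator {0..} r * ennreal (sqrt (1 + r\<^sup>2) powr - t)
        \<le> ennreal (4 * pi) * indicator {0..1} r + ennreal (4 * pi * r powr (2 - t)) * indicator {1..} r"
    proof cases
      case 2
      have "r\<^sup>2 * sqrt (1 + r\<^sup>2) powr - t \<le> 1 * 1"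
        using s(1) 2 assms powr_mono[of "- t" 0 "sqrt (1 + r\<^sup>2)"]
        by (intro mult_mono power_le_one) (simp_all split: if_splits)
      then have "ennreal (4 * pi * r\<^sup>2 * sqrt (1 + r\<^sup>2) powr - t) \<le> ennreal (4 * pi)"
        by (intro ennreal_leI) (simp add: mult.assoc)
      then show ?thesis
        using 2 by (simp add: ennreal_mult'[symmetric] add_increasing2)
    next
      case 3
      have "r\<^sup>2 * sqrt (1 + r\<^sup>2) powr - t \<le> r\<^sup>2 * r powr - t"
        using s 3 assms by (intro mult_left_mono powr_mono2') auto
      also have "\<dots> = r powr (2 - t)"
        using 3 by (simp add: powr_diff powr_minus_divide powr_numeral)
      finally have "ennreal (4 * pi * r\<^sup>2 * sqrt (1 + r\<^sup>2) powr - t) \<le> ennreal (4 * pi * r powr (2 - t))"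
        by (intro ennreal_leI) (simp add: mult.assoc)
      then show ?thesis
        using 3 by (simp add: ennreal_mult'[symmetric])
    qed auto
  qed
  also have "\<dots> = ennreal (4 * pi) + (\<integral>\<^sup>+r. ennreal (4 * pi * r powr (2 - t)) * indicator {1..} r \<partial>lborel)"
    by (subst nn_integral_add) (auto simp: nn_integral_cmult)
  also have "(\<integral>\<^sup>+r. ennreal (4 * pi * r powr (2 - t)) * indicator {1..} r \<partial>lborel)
      = ennreal (0 - 4 * pi * (1 powr (3 - t) / (3 - t)))"
  proof (rule nn_integral_FTC_atLeast)
    show "((\<lambda>r. 4 * pi * (r powr (3 - t) / (3 - t))) has_real_derivative 4 * pi * r powr (2 - t)) (at r)"
      if "1 \<le> r" for r
      using that assms by (auto intro!: derivative_eq_intros)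
    have "((\<lambda>r. 4 * pi * (r powr (3 - t) / (3 - t))) \<longlongrightarrow> 4 * pi * (0 / (3 - t))) at_top"
      using assms by (intro tendsto_intros tendsto_neg_powr filterlim_ident) auto
    then show "((\<lambda>r. 4 * pi * (r powr (3 - t) / (3 - t))) \<longlongrightarrow> 0) at_top" by simp
  qed auto
  finally show ?thesis
    by (rule le_less_trans) simp
qed

text \<open>
  Split at \<open>|x - y| = \<langle>x\<rangle>/2\<close>. On the near part \<open>\<langle>y\<rangle> \<ge> \<langle>x\<rangle>/2\<close>, and the integral of \<open>|x - y|\<^sup>-\<^sup>2\<close> over
  a ball is proportional to the radius; this contributes \<open>\<langle>x\<rangle>\<^sup>1\<^sup>-\<^sup>t\<close>. On the far part both \<open>\<langle>x\<rangle>\<close> and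
  \<open>\<langle>y\<rangle>\<close> are at most \<open>3|x - y|\<close>, so the kernel is at most \<open>9 \<langle>x\<rangle>\<^sup>-\<^sup>a \<langle>y\<rangle>\<^sup>a\<^sup>-\<^sup>2\<close>, and \<open>\<langle>y\<rangle>\<^sup>a\<^sup>-\<^sup>2\<^sup>-\<^sup>t\<close> is
  integrable. Both parts need \<open>a < t - 1\<close>.
\<close>

lemma riesz_potential_jb:
  assumes "0 \<le> a" "a \<le> 2" "a < t - 1"
  shows "\<exists>C>0. \<forall>x. (\<integral>\<^sup>+y. ennreal (riesz (x - y) * japanese_bracket y powr - t) \<partial>lborel)
                 \<le> ennreal (C * japanese_bracket x powr - a)"
proof -
  let ?J = japanese_bracket
  obtain I where I: "I \<ge> 0" "(\<integral>\<^sup>+y. ennreal (?J y powr - (t + 2 - a)) \<partial>lborel) = ennreal I"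
  proof -
    have "(\<integral>\<^sup>+y. ennreal (?J y powr - (t + 2 - a)) \<partial>lborel) < \<infinity>"
      using assms by (intro nn_integral_jb_finite) simp
    then show thesis
      using that by (cases "\<integral>\<^sup>+y. ennreal (?J y powr - (t + 2 - a)) \<partial>lborel" rule: ennreal_cases) auto
  qed
  have add_slack: "u + 9 * s * i \<le> v + 9 * i * s + 1 * s" if "u \<le> v" "s \<ge> 0" for u v s i :: real
    using that by simp
  have powr_third: "(u / 3) powr - b = 3 powr b * u powr - b" if "u > 0" for u b :: real
    using that by (simp add: powr_divide powr_minus field_simps)
  define C where "C = 2 powr t * (2 * pi) + 9 * I + 1"
  have "(\<integral>\<^sup>+y. ennreal (riesz (x - y) * ?J y powr - t) \<partial>lborel) \<le> ennreal (C * ?J x powr - a)" for x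
  proof -
    have "(\<integral>\<^sup>+y. ennreal (riesz (x - y) * ?J y powr - t) \<partial>lborel)
      \<le> (\<integral>\<^sup>+y. ennreal ((?J x / 2) powr - t) * (ennreal (riesz (x - y)) * indicator {..?J x / 2} (norm (x - y)))
             + ennreal (9 * ?J x powr - a) * ennreal (?J y powr - (t + 2 - a)) \<partial>lborel)"
    proof (intro nn_integral_mono)
      fix y
      show "ennreal (riesz (x - y) * ?J y powr - t)
        \<le> ennreal ((?J x / 2) powr - t) * (ennreal (riesz (x - y)) * indicator {..?J x / 2} (norm (x - y)))
             + ennreal (9 * ?J x powr - a) * ennreal (?J y powr - (t + 2 - a))"
      proof (cases "norm (x - y) \<le> ?J x / 2")
        case True
        then have "?J x / 2 \<le> ?J y"
          using jb_triangle[of x y] by (simp add: norm_minus_commute)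
        then have "?J y powr - t \<le> (?J x / 2) powr - t"
          using assms by (intro powr_mono2') auto
        then have "riesz (x - y) * ?J y powr - t \<le> (?J x / 2) powr - t * riesz (x - y)"
          by (subst mult.commute) (rule mult_right_mono, simp_all)
        then show ?thesis
          using True by (simp add: ennreal_mult'[symmetric] add_increasing2 ennreal_leI)
      next
        case False
        then have d: "norm (x - y) \<ge> ?J x / 3" "norm (x - y) \<ge> ?J y / 3" "norm (x - y) > 0"
          using jb_triangle[of y x] jb_pos[of x] norm_minus_commute[of x y] by linarith+
        have "riesz (x - y) = norm (x - y) powr - a * norm (x - y) powr - (2 - a)"
          using d(3) by (subst powr_add[symmetric]) (simp add: riesz_def powr_minus_divide powr_numeral)
        also have "\<dots> \<le> (?J x / 3) powr - a * (?J y / 3) powr - (2 - a)"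
          using d assms by (intro mult_mono powr_mono2') auto
        also have "\<dots> = 3 powr a * 3 powr (2 - a) * (?J x powr - a * ?J y powr - (2 - a))"
          using powr_third[of "?J x" a] powr_third[of "?J y" "2 - a"] by simp
        also have "3 powr a * 3 powr (2 - a) = (9::real)"
          by (simp add: powr_add[symmetric] powr_numeral)
        finally have "riesz (x - y) * ?J y powr - t \<le> 9 * (?J x powr - a * ?J y powr - (2 - a)) * ?J y powr - t"
          by (intro mult_right_mono) auto
        also have "\<dots> = 9 * ?J x powr - a * ?J y powr - (t + 2 - a)"
          by (simp add: mult.assoc powr_add[symmetric] algebra_simps)
        finally show ?thesis
          using False by (simp add: ennreal_mult'[symmetric] ennreal_leI)
      qed
    qed
    also have "\<dots> = ennreal ((?J x / 2) powr - t) * (\<integral>\<^sup>+y. ennreal (riesz (x - y)) * indicator {..?J x / 2} (norm (x - y)) \<partial>lborel)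
             + ennreal (9 * ?J x powr - a) * ennreal I"
      by (subst nn_integral_add) (simp_all add: nn_integral_cmult I(2)[symmetric])
    also have "(\<integral>\<^sup>+y. ennreal (riesz (x - y)) * indicator {..?J x / 2} (norm (x - y)) \<partial>lborel) \<le> ennreal (4 * pi * (?J x / 2))"
      by (rule nn_integral_riesz_cball) (simp add: less_imp_le)
    also have "ennreal ((?J x / 2) powr - t) * ennreal (4 * pi * (?J x / 2)) + ennreal (9 * ?J x powr - a) * ennreal I
        = ennreal ((?J x / 2) powr - t * (4 * pi * (?J x / 2)) + 9 * ?J x powr - a * I)"
      using I by (simp add: ennreal_mult'[symmetric] ennreal_plus[symmetric] less_imp_le del: ennreal_plus)
    also have "\<dots> \<le> ennreal (C * ?J x powr - a)"
    proof (intro ennreal_leI)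
      have "(?J x / 2) powr - t * (4 * pi * (?J x / 2)) = 2 powr t * (2 * pi) * (?J x powr - t * ?J x powr 1)"
        by (simp add: powr_divide powr_minus_divide)
      also have "\<dots> = 2 powr t * (2 * pi) * ?J x powr (1 - t)"
        unfolding powr_add[symmetric] by simp
      also have "\<dots> \<le> 2 powr t * (2 * pi) * ?J x powr - a"
        using assms jb_ge_1 by (intro mult_left_mono powr_mono) auto
      finally show "(?J x / 2) powr - t * (4 * pi * (?J x / 2)) + 9 * ?J x powr - a * I \<le> C * ?J x powr - a"
        unfolding C_def distrib_right by (rule add_slack) simp
    qed
    finally show ?thesis
      by (simp add: add_right_mono mult_left_mono)
  qed
  moreover have "C > 0"
    unfolding C_def using I by (simp add: add_nonneg_pos)
  ultimately show ?thesis by blast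
qed

section \<open>Decay of subsolutions of a weighted Riesz potential\<close>

lemma mult_le_sum_squares: "a * b \<le> a\<^sup>2 + b\<^sup>2" if "a \<ge> 0" "b \<ge> 0" for a b :: real
  using sum_squares_bound[of a b] mult_nonneg_nonneg[OF that] by linarith

lemma jb_near:
  assumes "norm (x - y) \<le> 1 / 2"
  shows "japanese_bracket y powr - 2 \<le> 4 * japanese_bracket x powr - 2"
proof -
  have "japanese_bracket x \<le> japanese_bracket y + norm (x - y)"
    using jb_triangle[of x y] by (simp add: norm_minus_commute)
  then have "japanese_bracket x / 2 \<le> japanese_bracket y"
    using assms jb_ge_1[of x] by simp
  then have "japanese_bracket y powr - 2 \<le> (japanese_bracket x / 2) powr - 2"
    by (intro powr_mono2') auto
  then show ?thesis
    by (simp add: powr_divide powr_minus_divide)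
qed

lemma jb_powr_le_1: "t \<ge> 0 \<Longrightarrow> japanese_bracket x powr - t \<le> 1"
  using powr_mono[of "- t" 0 "japanese_bracket x"] jb_ge_1[of x] jb_pos[of x] by (simp split: if_splits)

text \<open>
  A comparison principle that gains decay and boundedness at once. Let \<open>w = \<langle>x\<rangle>\<^sup>-\<^sup>2\<close> and let \<open>S\<close> be
  the kernel restricted to \<open>\<langle>y\<rangle> > N\<close> or \<open>|x - y| \<le> d\<close>. For \<open>N\<close> large and \<open>d\<close> small, \<open>S w \<le> w/2\<close>
  and \<open>S\<^sup>T w \<le> w/2\<close>. The rest of the kernel is bounded by a multiple of \<open>w(x)\<close> and sees \<open>g\<close> only on
  a bounded set, so \<open>g \<le> S g + C w\<close>. The excess \<open>h = (g - 2 C w)\<^sup>+\<close> satisfies \<open>h \<le> S h\<close>, hence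
  \<open>\<integral> h w \<le> \<integral> (S h) w = \<integral> h (S\<^sup>T w) \<le> 1/2 \<integral> h w\<close>. The integral is finite because \<open>g\<close> and \<open>w\<close> are
  square integrable, so \<open>h = 0\<close>.
\<close>

lemma riesz_subsolution_decay:
  fixes g :: "real^3 \<Rightarrow> real"
  assumes [measurable]: "g \<in> borel_measurable borel" and g0: "\<And>x. g x \<ge> 0"
    and g2: "(\<integral>\<^sup>+x. ennreal ((g x)\<^sup>2) \<partial>lborel) < \<infinity>"
    and c: "c > 0" and rho: "\<rho> > 1"
    and sub: "AE x in lborel. ennreal (g x)
        \<le> (\<integral>\<^sup>+y. ennreal (c * riesz (x - y) * japanese_bracket y powr - \<rho> * g y) \<partial>lborel)"
  shows "\<exists>M\<ge>0. AE x in lborel. g x \<le> M * japanese_bracket x powr - 2"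
proof -
  let ?J = japanese_bracket
  \<comment> \<open>The weight enters through \<open>\<langle>y\<rangle>\<^sup>-\<^sup>\<rho> \<le> \<langle>y\<rangle>\<^sup>-\<^sup>1\<^sup>-\<^sup>2\<^sup>\<kappa>\<close>: one power \<open>\<kappa>\<close> gives smallness for
    \<open>\<langle>y\<rangle> > N\<close>, the other keeps the integrals finite.\<close>
  define \<kappa> where "\<kappa> = min 1 (\<rho> - 1) / 2"
  have \<kappa>: "\<kappa> > 0" "\<kappa> \<le> 1 / 2" "1 + 2 * \<kappa> \<le> \<rho>"
    using rho by (auto simp: \<kappa>_def)
  define w where "w x = ?J x powr - 2" for x
  have [measurable]: "w \<in> borel_measurable borel"
    unfolding w_def[abs_def] by measurable
  have w: "w x > 0" for x by (simp add: w_def)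
  define k where "k x y = c * riesz (x - y) * ?J y powr - (1 + 2 * \<kappa>)" for x y
  have k0: "k x y \<ge> 0" for x y using c by (simp add: k_def)
  \<comment> \<open>\<open>C1\<close> controls the kernel applied to \<open>w\<close>, and \<open>C2\<close> its transpose.\<close>
  obtain C1 where C1: "C1 > 0" "\<And>x. (\<integral>\<^sup>+y. ennreal (riesz (x - y) * ?J y powr - (3 + \<kappa>)) \<partial>lborel) \<le> ennreal (C1 * w x)"
    using riesz_potential_jb[of 2 "3 + \<kappa>"] \<kappa> unfolding w_def by auto
  obtain C2 where C2: "C2 > 0" "\<And>y. (\<integral>\<^sup>+x. ennreal (riesz (y - x) * w x) \<partial>lborel) \<le> ennreal (C2 * ?J y powr - (1 - \<kappa>))"
    using riesz_potential_jb[of "1 - \<kappa>" 2] \<kappa> unfolding w_def by auto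
  have "((\<lambda>N. c * (C1 + C2) * N powr - \<kappa>) \<longlongrightarrow> c * (C1 + C2) * 0) at_top"
    using \<kappa> by (intro tendsto_intros tendsto_neg_powr filterlim_ident) auto
  then have "eventually (\<lambda>N. c * (C1 + C2) * N powr - \<kappa> < 1 / 4) at_top"
    by (intro order_tendstoD(2)) auto
  then have "eventually (\<lambda>N. c * (C1 + C2) * N powr - \<kappa> < 1 / 4 \<and> N > 0) at_top"
    by (intro eventually_conj eventually_gt_at_top)
  then obtain N where N: "c * (C1 + C2) * N powr - \<kappa> < 1 / 4" "N > 0"
    unfolding eventually_at_top_linorder by auto
  \<comment> \<open>Here \<open>64 = 4 * 4 * 4\<close>: the integral \<open>4 \<pi> d\<close> of \<open>|z|\<^sup>-\<^sup>2\<close> over a ball, the oscillation of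
    \<open>w\<close> within distance \<open>1/2\<close>, and half of the admissible factor \<open>1/2\<close>.\<close>
  define d where "d = min (1 / 2) (1 / (64 * pi * c))"
  have d: "d > 0" "d \<le> 1 / 2" "c * 4 * (4 * pi * d) \<le> 1 / 4"
  proof -
    show "c * 4 * (4 * pi * d) \<le> 1 / 4"
    proof -
      have "d \<le> 1 / (64 * pi * c)" by (simp add: d_def)
      then show ?thesis using c by (simp add: field_simps)
    qed
  qed (use c in \<open>auto simp: d_def\<close>)
  have far: "?J y powr - \<kappa> \<le> N powr - \<kappa>" if "N < ?J y" for y
    using that N \<kappa> by (intro powr_mono2') auto
  define Q where "Q = {(x, y). norm (x - y) \<le> d \<or> N < ?J y}"
  have [measurable]: "Q \<in> sets (borel \<Otimes>\<^sub>M borel)"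
  proof -
    have "Q = {z \<in> space (borel \<Otimes>\<^sub>M borel). norm (fst z - snd z) \<le> d \<or> N < ?J (snd z)}"
      by (auto simp: Q_def space_pair_measure)
    also have "\<dots> \<in> sets (borel \<Otimes>\<^sub>M borel)" by measurable
    finally show ?thesis .
  qed
  define S where "S x y = k x y * indicator Q (x, y)" for x y
  have [measurable]: "(\<lambda>(x, y). S x y) \<in> borel_measurable (borel \<Otimes>\<^sub>M borel)"
    "(\<lambda>(x, y). k x y) \<in> borel_measurable (borel \<Otimes>\<^sub>M borel)"
    unfolding S_def[abs_def] k_def[abs_def] by measurable
  have S0: "S x y \<ge> 0" for x y using k0 by (simp add: S_def)
  have Sw: "(\<integral>\<^sup>+y. ennreal (S x y * w y) \<partial>lborel) \<le> ennreal (1 / 2 * w x)" for x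
  proof -
    have "(\<integral>\<^sup>+y. ennreal (S x y * w y) \<partial>lborel)
       \<le> (\<integral>\<^sup>+y. ennreal (c * 4 * w x) * (ennreal (riesz (x - y)) * indicator {..d} (norm (x - y)))
              + ennreal (c * N powr - \<kappa>) * ennreal (riesz (x - y) * ?J y powr - (3 + \<kappa>)) \<partial>lborel)"
    proof (intro nn_integral_mono)
      fix y
      consider "norm (x - y) \<le> d" | "norm (x - y) > d" "N < ?J y" | "(x, y) \<notin> Q"
        unfolding Q_def by force
      then show "ennreal (S x y * w y) \<le> ennreal (c * 4 * w x) * (ennreal (riesz (x - y)) * indicator {..d} (norm (x - y)))
              + ennreal (c * N powr - \<kappa>) * ennreal (riesz (x - y) * ?J y powr - (3 + \<kappa>))"
      proof cases
        case 1
        have "S x y \<le> c * riesz (x - y) * 1"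
          unfolding S_def k_def using 1 c \<kappa> jb_powr_le_1[of "1 + 2 * \<kappa>" y]
          by (simp add: Q_def mult_left_le)
        moreover have "w y \<le> 4 * w x"
          unfolding w_def using 1 d by (intro jb_near) auto
        ultimately have "S x y * w y \<le> (c * riesz (x - y) * 1) * (4 * w x)"
          using S0 w[of y] c by (intro mult_mono) auto
        then have "ennreal (S x y * w y) \<le> ennreal ((c * 4 * w x) * riesz (x - y))"
          by (intro ennreal_leI) (simp add: ac_simps)
        then show ?thesis
          using 1 c w[of x] by (simp add: ennreal_mult add_increasing2 less_imp_le)
      next
        case 2
        have "?J y powr - (1 + 2 * \<kappa>) * w y = ?J y powr - \<kappa> * ?J y powr - (3 + \<kappa>)"
          unfolding w_def powr_add[symmetric] by (rule arg_cong[where f = "(powr) (?J y)"]) simp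
        also have "\<dots> \<le> N powr - \<kappa> * ?J y powr - (3 + \<kappa>)"
          using far[OF 2(2)] by (intro mult_right_mono) auto
        finally have "c * riesz (x - y) * (?J y powr - (1 + 2 * \<kappa>) * w y) \<le> c * riesz (x - y) * (N powr - \<kappa> * ?J y powr - (3 + \<kappa>))"
          using c by (intro mult_left_mono) auto
        then have "ennreal (S x y * w y) \<le> ennreal ((c * N powr - \<kappa>) * (riesz (x - y) * ?J y powr - (3 + \<kappa>)))"
          using 2 by (intro ennreal_leI) (simp add: S_def k_def Q_def ac_simps)
        then show ?thesis
          using 2 c by (simp add: ennreal_mult)
      qed (simp add: S_def)
    qed
    also have "\<dots> = ennreal (c * 4 * w x) * (\<integral>\<^sup>+y. ennreal (riesz (x - y)) * indicator {..d} (norm (x - y)) \<partial>lborel)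
              + ennreal (c * N powr - \<kappa>) * (\<integral>\<^sup>+y. ennreal (riesz (x - y) * ?J y powr - (3 + \<kappa>)) \<partial>lborel)"
      by (subst nn_integral_add) (auto simp: nn_integral_cmult)
    also have "\<dots> \<le> ennreal (c * 4 * w x) * ennreal (4 * pi * d) + ennreal (c * N powr - \<kappa>) * ennreal (C1 * w x)"
      using d by (intro add_mono mult_left_mono nn_integral_riesz_cball C1) auto
    also have "\<dots> = ennreal ((c * 4 * (4 * pi * d) + c * C1 * N powr - \<kappa>) * w x)"
      using c d C1 w[of x] by (simp add: ennreal_mult[symmetric] ennreal_plus[symmetric] less_imp_le algebra_simps del: ennreal_plus)
    also have "\<dots> \<le> ennreal (1 / 2 * w x)"
    proof (intro ennreal_leI mult_right_mono)
      have "c * C1 * N powr - \<kappa> \<le> c * (C1 + C2) * N powr - \<kappa>"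
        using c C2 by (intro mult_right_mono mult_left_mono) auto
      then show "c * 4 * (4 * pi * d) + c * C1 * N powr - \<kappa> \<le> 1 / 2"
        using N d by linarith
    qed (use w[of x] in auto)
    finally show ?thesis .
  qed
  \<comment> \<open>The transposed kernel keeps the factor \<open>\<langle>y\<rangle>\<^sup>-\<^sup>1\<^sup>-\<^sup>2\<^sup>\<kappa>\<close> outside the integral; together with
    \<open>\<langle>y\<rangle>\<^sup>-\<^sup>1\<^sup>+\<^sup>\<kappa>\<close> it exceeds the decay of \<open>w\<close> by \<open>\<langle>y\<rangle>\<^sup>-\<^sup>\<kappa>\<close>.\<close>
  have Stw: "(\<integral>\<^sup>+x. ennreal (S x y * w x) \<partial>lborel) \<le> ennreal (1 / 2 * w y)" for y
  proof -
    have "(\<integral>\<^sup>+x. ennreal (S x y * w x) \<partial>lborel)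
       \<le> (\<integral>\<^sup>+x. ennreal (c * 4 * w y) * (ennreal (riesz (y - x)) * indicator {..d} (norm (y - x)))
              + ennreal (c * ?J y powr - (1 + 2 * \<kappa>) * indicator {N<..} (?J y)) * ennreal (riesz (y - x) * w x) \<partial>lborel)"
    proof (intro nn_integral_mono)
      fix x
      consider "norm (x - y) \<le> d" | "norm (x - y) > d" "N < ?J y" | "(x, y) \<notin> Q"
        unfolding Q_def by force
      then show "ennreal (S x y * w x) \<le> ennreal (c * 4 * w y) * (ennreal (riesz (y - x)) * indicator {..d} (norm (y - x)))
              + ennreal (c * ?J y powr - (1 + 2 * \<kappa>) * indicator {N<..} (?J y)) * ennreal (riesz (y - x) * w x)"
      proof cases
        case 1
        have "S x y \<le> c * riesz (y - x) * 1"
          unfolding S_def k_def using 1 c \<kappa> jb_powr_le_1[of "1 + 2 * \<kappa>" y]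
          by (simp add: Q_def mult_left_le riesz_minus_commute)
        moreover have "w x \<le> 4 * w y"
          unfolding w_def using 1 d by (intro jb_near) (auto simp: norm_minus_commute)
        ultimately have "S x y * w x \<le> (c * riesz (y - x) * 1) * (4 * w y)"
          using S0 w[of x] c by (intro mult_mono) auto
        then have "ennreal (S x y * w x) \<le> ennreal ((c * 4 * w y) * riesz (y - x))"
          by (intro ennreal_leI) (simp add: ac_simps)
        then show ?thesis
          using 1 c w[of y] by (simp add: ennreal_mult add_increasing2 less_imp_le norm_minus_commute)
      next
        case 2
        have "ennreal (S x y * w x) = ennreal ((c * ?J y powr - (1 + 2 * \<kappa>)) * (riesz (y - x) * w x))"
          using 2 by (intro arg_cong[where f = ennreal]) (simp add: S_def k_def Q_def riesz_minus_commute[of x])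
        then show ?thesis
          using 2 c w[of x] by (simp add: ennreal_mult less_imp_le)
      qed (simp add: S_def)
    qed
    also have "\<dots> = ennreal (c * 4 * w y) * (\<integral>\<^sup>+x. ennreal (riesz (y - x)) * indicator {..d} (norm (y - x)) \<partial>lborel)
              + ennreal (c * ?J y powr - (1 + 2 * \<kappa>) * indicator {N<..} (?J y)) * (\<integral>\<^sup>+x. ennreal (riesz (y - x) * w x) \<partial>lborel)"
      by (subst nn_integral_add) (auto simp: nn_integral_cmult)
    also have "\<dots> \<le> ennreal (c * 4 * w y) * ennreal (4 * pi * d)
        + ennreal (c * ?J y powr - (1 + 2 * \<kappa>) * indicator {N<..} (?J y)) * ennreal (C2 * ?J y powr - (1 - \<kappa>))"
      using d by (intro add_mono mult_left_mono nn_integral_riesz_cball C2) auto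
    also have "\<dots> = ennreal (c * 4 * (4 * pi * d) * w y + c * C2 * (?J y powr - (1 + 2 * \<kappa>) * ?J y powr - (1 - \<kappa>)) * indicator {N<..} (?J y))"
      using c d C2 w[of y] by (simp add: ennreal_mult[symmetric] ennreal_plus[symmetric] less_imp_le ac_simps del: ennreal_plus)
    also have "?J y powr - (1 + 2 * \<kappa>) * ?J y powr - (1 - \<kappa>) = ?J y powr - \<kappa> * w y"
      unfolding w_def powr_add[symmetric] by (rule arg_cong[where f = "(powr) (?J y)"]) simp
    also have "ennreal (c * 4 * (4 * pi * d) * w y + c * C2 * (?J y powr - \<kappa> * w y) * indicator {N<..} (?J y))
        \<le> ennreal (1 / 2 * w y)"
    proof (intro ennreal_leI)
      have "c * C2 * (?J y powr - \<kappa> * w y) * indicator {N<..} (?J y) \<le> c * (C1 + C2) * (N powr - \<kappa> * w y) * 1"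
        using c C1 C2 w[of y] far[of y] by (cases "N < ?J y") (auto intro!: mult_mono)
      also have "\<dots> = (c * (C1 + C2) * N powr - \<kappa>) * w y" by simp
      also have "\<dots> \<le> 1 / 4 * w y"
        using N w[of y] by (intro mult_right_mono) auto
      finally show "c * 4 * (4 * pi * d) * w y + c * C2 * (?J y powr - \<kappa> * w y) * indicator {N<..} (?J y) \<le> 1 / 2 * w y"
        using mult_right_mono[OF d(3), of "w y"] w[of y] by linarith
    qed
    finally show ?thesis .
  qed
  have "(\<integral>\<^sup>+y. ennreal (g y) * indicator {..N} (?J y) \<partial>lborel) < \<infinity>"
  proof -
    have "(\<integral>\<^sup>+y. ennreal (g y) * indicator {..N} (?J y) \<partial>lborel)
        \<le> (\<integral>\<^sup>+y. ennreal ((g y)\<^sup>2) + indicator (cball 0 N) y \<partial>lborel)"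
    proof (intro nn_integral_mono)
      fix y
      have "g y \<le> (g y)\<^sup>2 + 1"
        using sum_power2_ge_zero[of "g y - 1/2" "0"] by (simp add: power2_eq_square algebra_simps)
      then have "ennreal (g y) \<le> ennreal ((g y)\<^sup>2) + 1"
        using g0 by (simp add: ennreal_plus[symmetric] flip: ennreal_1 del: ennreal_plus)
      moreover have "norm y \<le> N" if "?J y \<le> N"
        using that norm_le_jb[of y] by linarith
      ultimately show "ennreal (g y) * indicator {..N} (?J y) \<le> ennreal ((g y)\<^sup>2) + indicator (cball 0 N) y"
        by (auto simp: indicator_def)
    qed
    also have "\<dots> < \<infinity>"
      using g2 emeasure_bounded_finite[of "cball 0 N :: (real^3) set"]
      by (subst nn_integral_add) (auto intro!: borel_measurable_indicator borel_closed)
    finally show ?thesis .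
  qed
  then obtain L where L: "L \<ge> 0" "(\<integral>\<^sup>+y. ennreal (g y) * indicator {..N} (?J y) \<partial>lborel) = ennreal L"
    by (cases "\<integral>\<^sup>+y. ennreal (g y) * indicator {..N} (?J y) \<partial>lborel" rule: ennreal_cases) auto
  have quot: "1 / n \<le> e * (1 / j)" if "j \<le> e * n" "n > 0" "j > 0" for n e j :: real
    using that by (simp add: field_simps)
  define K where "K = c * (N / d + 1)\<^sup>2"
  have K: "K \<ge> 0" using c by (simp add: K_def)
  have rest: "(\<integral>\<^sup>+y. ennreal (k x y * g y) \<partial>lborel)
      \<le> (\<integral>\<^sup>+y. ennreal (S x y) * ennreal (g y) \<partial>lborel) + ennreal (K * L * w x)" for x
  proof -
    have "(\<integral>\<^sup>+y. ennreal (k x y * g y) \<partial>lborel)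
        \<le> (\<integral>\<^sup>+y. ennreal (S x y) * ennreal (g y) + ennreal (K * w x) * (ennreal (g y) * indicator {..N} (?J y)) \<partial>lborel)"
    proof (intro nn_integral_mono)
      fix y
      show "ennreal (k x y * g y) \<le> ennreal (S x y) * ennreal (g y) + ennreal (K * w x) * (ennreal (g y) * indicator {..N} (?J y))"
      proof (cases "(x, y) \<in> Q")
        case True
        then show ?thesis using k0 g0 by (simp add: S_def ennreal_mult)
      next
        case False
        then have y: "norm (x - y) > d" "?J y \<le> N" by (auto simp: Q_def)
        have "N \<le> N / d * norm (x - y)"
          using y d N by (simp add: field_simps)
        then have "?J x \<le> (N / d + 1) * norm (x - y)"
          using jb_triangle[of x y] y by (simp add: norm_minus_commute algebra_simps)
        then have "(?J x)\<^sup>2 \<le> (N / d + 1)\<^sup>2 * (norm (x - y))\<^sup>2"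
          unfolding power_mult_distrib[symmetric] by (intro power_mono) (auto intro: less_imp_le)
        then have "riesz (x - y) \<le> (N / d + 1)\<^sup>2 * w x"
          using y d quot[of "(?J x)\<^sup>2" "(N / d + 1)\<^sup>2" "(norm (x - y))\<^sup>2"]
          by (cases "x = y") (auto simp: riesz_def w_def powr_minus_divide powr_numeral zero_less_power2)
        then have "k x y \<le> c * ((N / d + 1)\<^sup>2 * w x) * 1"
          unfolding k_def using c \<kappa> jb_powr_le_1[of "1 + 2 * \<kappa>" y] w[of x]
          by (intro mult_mono) (auto intro: mult_nonneg_nonneg less_imp_le)
        then have "k x y * g y \<le> K * w x * g y"
          unfolding K_def by (intro mult_right_mono g0) (simp add: ac_simps)
        then show ?thesis
          using False y K w[of x] g0[of y]
          by (simp add: S_def ennreal_mult[symmetric] less_imp_le ennreal_leI)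
      qed
    qed
    also have "\<dots> = (\<integral>\<^sup>+y. ennreal (S x y) * ennreal (g y) \<partial>lborel) + ennreal (K * w x) * ennreal L"
      by (subst nn_integral_add) (auto simp: nn_integral_cmult L)
    finally show ?thesis
      using K L w[of x] by (simp add: ennreal_mult[symmetric] less_imp_le ac_simps)
  qed
  \<comment> \<open>With this \<open>M\<close> the contribution of \<open>M w\<close> to \<open>S g\<close> and the remainder \<open>K L w\<close> add up to
    \<open>M w\<close>.\<close>
  define M where "M = 2 * (K * L)"
  have M: "M \<ge> 0" using K L by (simp add: M_def)
  define h where "h x = ennreal (g x) - ennreal (M * w x)" for x
  have [measurable]: "h \<in> borel_measurable borel"
    unfolding h_def[abs_def] by measurable
  have gh: "ennreal (g x) \<le> h x + ennreal (M * w x)" for x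
    unfolding h_def by (metis add.commute diff_add_cancel_ennreal le_cases ennreal_minus_cancel_iff  add_increasing2 zero_le order_refl le_iff_add)
  have hS: "AE x in lborel. h x \<le> (\<integral>\<^sup>+y. ennreal (S x y) * h y \<partial>lborel)"
    using sub
  proof eventually_elim
    case (elim x)
    have "ennreal (g x) \<le> (\<integral>\<^sup>+y. ennreal (k x y * g y) \<partial>lborel)"
    proof (rule order.trans[OF elim], intro nn_integral_mono ennreal_leI)
      fix y
      have "?J y powr - \<rho> \<le> ?J y powr - (1 + 2 * \<kappa>)"
        using \<kappa> jb_ge_1 by (intro powr_mono) auto
      then show "c * riesz (x - y) * ?J y powr - \<rho> * g y \<le> k x y * g y"
        unfolding k_def using c g0 by (intro mult_right_mono mult_left_mono) auto
    qed
    also have "\<dots> \<le> (\<integral>\<^sup>+y. ennreal (S x y) * ennreal (g y) \<partial>lborel) + ennreal (K * L * w x)"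
      by (rule rest)
    also have "(\<integral>\<^sup>+y. ennreal (S x y) * ennreal (g y) \<partial>lborel)
        \<le> (\<integral>\<^sup>+y. ennreal (S x y) * h y + ennreal M * ennreal (S x y * w y) \<partial>lborel)"
    proof (intro nn_integral_mono)
      fix y
      have "ennreal (S x y) * ennreal (g y) \<le> ennreal (S x y) * (h y + ennreal (M * w y))"
        by (intro mult_left_mono gh) auto
      then show "ennreal (S x y) * ennreal (g y) \<le> ennreal (S x y) * h y + ennreal M * ennreal (S x y * w y)"
        using S0 M w[of y] by (simp add: distrib_left ennreal_mult less_imp_le ac_simps)
    qed
    also have "\<dots> = (\<integral>\<^sup>+y. ennreal (S x y) * h y \<partial>lborel) + ennreal M * (\<integral>\<^sup>+y. ennreal (S x y * w y) \<partial>lborel)"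
      by (subst nn_integral_add) (auto simp: nn_integral_cmult)
    also have "\<dots> \<le> (\<integral>\<^sup>+y. ennreal (S x y) * h y \<partial>lborel) + ennreal M * ennreal (1 / 2 * w x)"
      by (intro add_left_mono mult_left_mono Sw) auto
    also have "ennreal M * ennreal (1 / 2 * w x) = ennreal (K * L * w x)"
      using M w[of x] by (simp add: ennreal_mult[symmetric] less_imp_le M_def mult.assoc)
    finally have "ennreal (g x) \<le> (\<integral>\<^sup>+y. ennreal (S x y) * h y \<partial>lborel) + (ennreal (K * L * w x) + ennreal (K * L * w x))"
      by (simp add: ac_simps add_right_mono)
    also have "ennreal (K * L * w x) + ennreal (K * L * w x) = ennreal (M * w x)"
      using K L w[of x] by (simp add: ennreal_plus[symmetric] M_def less_imp_le del: ennreal_plus)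
    finally show ?case
      unfolding h_def by (simp add: ennreal_minus_le_iff add.commute)
  qed
  define X where "X = (\<integral>\<^sup>+x. h x * ennreal (w x) \<partial>lborel)"
  have "X \<le> (\<integral>\<^sup>+x. (\<integral>\<^sup>+y. h y * ennreal (S x y * w x) \<partial>lborel) \<partial>lborel)"
    unfolding X_def
  proof (intro nn_integral_mono_AE, use hS in eventually_elim)
    case (elim x)
    then have "h x * ennreal (w x) \<le> (\<integral>\<^sup>+y. ennreal (S x y) * h y \<partial>lborel) * ennreal (w x)"
      by (intro mult_right_mono) auto
    also have "\<dots> = (\<integral>\<^sup>+y. h y * ennreal (S x y * w x) \<partial>lborel)"
      using S0 w[of x] by (subst nn_integral_multc[symmetric]) (auto simp: ennreal_mult less_imp_le ac_simps)
    finally show ?case .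
  qed
  also have "\<dots> = (\<integral>\<^sup>+y. (\<integral>\<^sup>+x. h y * ennreal (S x y * w x) \<partial>lborel) \<partial>lborel)"
    by (rule lborel_pair.Fubini'[symmetric]) measurable
  also have "\<dots> = (\<integral>\<^sup>+y. h y * (\<integral>\<^sup>+x. ennreal (S x y * w x) \<partial>lborel) \<partial>lborel)"
    by (simp add: nn_integral_cmult)
  also have "\<dots> \<le> (\<integral>\<^sup>+y. h y * ennreal (1 / 2 * w y) \<partial>lborel)"
    by (intro nn_integral_mono mult_left_mono Stw) auto
  also have "\<dots> = ennreal (1 / 2) * X"
  proof -
    have "ennreal (1 / 2 * w y) = ennreal (1 / 2) * ennreal (w y)" for y
      using w[of y] by (intro ennreal_mult) auto
    then show ?thesis
      unfolding X_def by (subst nn_integral_cmult[symmetric]) (simp_all only: ac_simps, measurable)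
  qed
  finally have X_half: "X \<le> ennreal (1 / 2) * X" .
  have "X \<le> (\<integral>\<^sup>+x. ennreal ((g x)\<^sup>2) + ennreal (?J x powr - 4) \<partial>lborel)"
    unfolding X_def
  proof (intro nn_integral_mono)
    fix x
    have "h x * ennreal (w x) \<le> ennreal (g x) * ennreal (w x)"
      unfolding h_def by (intro mult_right_mono) (auto simp: ennreal_minus_le_iff add_increasing)
    also have "\<dots> = ennreal (g x * w x)"
      using g0 w[of x] by (simp add: ennreal_mult less_imp_le)
    also have "\<dots> \<le> ennreal ((g x)\<^sup>2 + ?J x powr - 4)"
    proof (intro ennreal_leI)
      have "g x * w x \<le> (g x)\<^sup>2 + (w x)\<^sup>2"
        using g0 w by (intro mult_le_sum_squares) (auto intro: less_imp_le)
      also have "(w x)\<^sup>2 = ?J x powr - 4"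
        by (simp add: w_def power2_eq_square powr_add[symmetric])
      finally show "g x * w x \<le> (g x)\<^sup>2 + ?J x powr - 4" .
    qed
    finally show "h x * ennreal (w x) \<le> ennreal ((g x)\<^sup>2) + ennreal (?J x powr - 4)"
      by simp
  qed
  also have "\<dots> < \<infinity>"
    using g2 nn_integral_jb_finite[of 4] by (subst nn_integral_add) auto
  finally have "X < \<infinity>" .
  then obtain X' where X': "X' \<ge> 0" "X = ennreal X'"
    by (cases X rule: ennreal_cases) auto
  have "ennreal X' \<le> ennreal (1 / 2 * X')"
    using X_half X' ennreal_mult[of "1 / 2" X'] by (simp only: X'(2))
  then have "X' \<le> 1 / 2 * X'"
    using X' by (subst (asm) ennreal_le_iff) auto
  then have "X = 0"
    using X' by simp
  then have "AE x in lborel. h x * ennreal (w x) = 0"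
    unfolding X_def by (subst (asm) nn_integral_0_iff_AE) auto
  then have "AE x in lborel. g x \<le> M * w x"
  proof eventually_elim
    case (elim x)
    then have "h x = 0" using w[of x] by (simp add: not_le)
    then have "ennreal (g x) \<le> ennreal (M * w x)"
      unfolding h_def by (simp add: ennreal_minus_eq_0)
    then show ?case
      using M w[of x] by (subst (asm) ennreal_le_iff) (auto intro: mult_nonneg_nonneg less_imp_le)
  qed
  then show ?thesis
    using M unfolding w_def by blast
qed

section \<open>Test functions built from a regularised kernel\<close>

lemma Ck_SucI:
  assumes "\<And>x. (h has_derivative D x) (at x)" "\<And>v. Ck k (\<lambda>x. D x v)"
  shows "Ck (Suc k) h"
proof -
  have "frechet_derivative h (at x) = D x" for x
    using frechet_derivative_at[OF assms(1)] by simp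
  then show ?thesis
    using assms by (auto simp: differentiable_def)
qed

lemma Ck_SucD_diff: "Ck (Suc k) h \<Longrightarrow> (h has_derivative frechet_derivative h (at x)) (at x)"
  by (simp add: frechet_derivative_works)

lemma Ck_mono: "Ck (Suc k) h \<Longrightarrow> Ck k h"
proof (induction k arbitrary: h)
  case 0
  then show ?case
    by (auto simp: continuous_on_eq_continuous_at intro: differentiable_imp_continuous_within)
next
  case (Suc k)
  from Suc.prems have "h differentiable (at x)" "Ck (Suc k) (\<lambda>x. frechet_derivative h (at x) v)" for x v
    by simp_all
  then show ?case using Suc.IH by simp
qed

lemma Ck_const [simp]: "Ck k (\<lambda>x. c)"
proof (induction k arbitrary: c)
  case (Suc k)
  then show ?case by (intro Ck_SucI[where D = "\<lambda>_ _. 0"]) auto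
qed simp

lemma Ck_add: "Ck k f \<Longrightarrow> Ck k g \<Longrightarrow> Ck k (\<lambda>x. f x + g x)"
proof (induction k arbitrary: f g)
  case 0
  then show ?case by (auto intro: continuous_on_add)
next
  case (Suc k)
  show ?case
  proof (rule Ck_SucI)
    show "((\<lambda>x. f x + g x) has_derivative (\<lambda>v. frechet_derivative f (at x) v + frechet_derivative g (at x) v)) (at x)" for x
      using Suc.prems by (intro has_derivative_add Ck_SucD_diff)
    show "Ck k (\<lambda>x. frechet_derivative f (at x) v + frechet_derivative g (at x) v)" for v
      using Suc.prems by (intro Suc.IH) auto
  qed
qed

lemma Ck_mult: "Ck k f \<Longrightarrow> Ck k g \<Longrightarrow> Ck k (\<lambda>x. f x * g x)"
proof (induction k arbitrary: f g)
  case 0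
  then show ?case by (auto intro: continuous_on_mult)
next
  case (Suc k)
  show ?case
  proof (rule Ck_SucI)
    show "((\<lambda>x. f x * g x) has_derivative
        (\<lambda>v. f x * frechet_derivative g (at x) v + frechet_derivative f (at x) v * g x)) (at x)" for x
      using Suc.prems by (intro has_derivative_mult Ck_SucD_diff)
    show "Ck k (\<lambda>x. f x * frechet_derivative g (at x) v + frechet_derivative f (at x) v * g x)" for v
      using Suc.prems Ck_mono[OF Suc.prems(1)] Ck_mono[OF Suc.prems(2)] by (intro Ck_add Suc.IH) auto
  qed
qed

lemma Ck_sum: "(\<And>i. i \<in> I \<Longrightarrow> Ck k (f i)) \<Longrightarrow> Ck k (\<lambda>x. \<Sum>i\<in>I. f i x)"
  by (induction I rule: infinite_finite_induct) (auto intro: Ck_add)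

lemma Ck_affine:
  assumes "bounded_linear L"
  shows "Ck k (\<lambda>x. c + L x)"
proof (cases k)
  case 0
  then show ?thesis
    using assms by (simp add: continuous_on_add[OF continuous_on_const linear_continuous_on])
next
  case (Suc l)
  have "Ck (Suc l) (\<lambda>x. c + L x)"
    by (rule Ck_SucI[where D = "\<lambda>_. L"])
       (auto intro!: derivative_eq_intros bounded_linear_imp_has_derivative assms)
  then show ?thesis using Suc by simp
qed

text \<open>
  The outer function is given together with all its derivatives, since the chain rule passes from
  each of them to the next.
\<close>

lemma Ck_compose:
  assumes d: "\<And>n t. t \<in> S \<Longrightarrow> (d n has_real_derivative d (Suc n) t) (at t)"
    and "\<And>x. h x \<in> S" "Ck k h"
  shows "Ck k (\<lambda>x. d n (h x))"
  using assms(3)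
proof (induction k arbitrary: n)
  case 0
  then have "isCont h x" for x
    by (simp add: continuous_on_eq_continuous_at)
  then have "isCont (\<lambda>x. d n (h x)) x" for x
    by (rule isCont_o2) (rule DERIV_isCont[OF d[OF assms(2)]])
  then show ?case by (simp add: continuous_on_eq_continuous_at)
next
  case (Suc k)
  let ?D = "\<lambda>x v. d (Suc n) (h x) * frechet_derivative h (at x) v"
  have "((\<lambda>x. d n (h x)) has_derivative ?D x) (at x)" for x
    using has_derivative_compose[OF Ck_SucD_diff[OF Suc.prems] d[OF assms(2), unfolded has_field_derivative_def]]
    by simp
  moreover have "Ck k (\<lambda>x. ?D x v)" for v
  proof (rule Ck_mult)
    show "Ck k (\<lambda>x. d (Suc n) (h x))"
      by (rule Suc.IH[OF Ck_mono[OF Suc.prems]])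
    show "Ck k (\<lambda>x. frechet_derivative h (at x) v)"
      using Suc.prems by simp
  qed
  ultimately show ?case by (rule Ck_SucI[where D = ?D])
qed

text \<open>
  The derivatives of \<open>exp (- 1/t)\<close> for \<open>t > 0\<close> have the form \<open>p(1/t) exp (- 1/t)\<close>; with \<open>s = 1/t\<close>,
  differentiation replaces \<open>p\<close> by \<open>s\<^sup>2 (p - p')\<close>.
\<close>

primrec bump_poly :: "nat \<Rightarrow> real poly" where
  "bump_poly 0 = 1"
| "bump_poly (Suc n) = [:0, 0, 1:] * (bump_poly n - pderiv (bump_poly n))"

definition bump_deriv :: "nat \<Rightarrow> real \<Rightarrow> real" where
  "bump_deriv n t = (if t > 0 then poly (bump_poly n) (1 / t) * exp (- (1 / t)) else 0)"

lemma poly_exp_decay: "((\<lambda>s. poly p s * exp (- s)) \<longlongrightarrow> 0) at_top" for p :: "real poly"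
proof -
  have "((\<lambda>s. \<Sum>i\<le>degree p. coeff p i * (s ^ i / exp s)) \<longlongrightarrow> (\<Sum>i\<le>degree p. coeff p i * 0)) at_top"
    by (intro tendsto_sum tendsto_mult tendsto_const tendsto_power_div_exp_0)
  then show ?thesis
    by (simp add: poly_altdef sum_distrib_right exp_minus divide_inverse mult.assoc)
qed

text \<open>
  At \<open>t = 0\<close> the difference quotient is \<open>s p(s) exp (- s)\<close> with \<open>s = 1/t \<rightarrow> \<infinity>\<close>.
\<close>

lemma bump_deriv: "(bump_deriv n has_real_derivative bump_deriv (Suc n) t) (at t)"
proof -
  consider "t < 0" | "t > 0" | "t = 0" by linarith
  then show ?thesis
  proof cases
    case 1
    have "(bump_deriv n has_real_derivative 0) (at t)"
    proof (rule has_field_derivative_transform_within_open[where S = "{..<0}"])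
      show "((\<lambda>_. 0) has_real_derivative 0) (at t)" by simp
    qed (use 1 in \<open>auto simp: bump_deriv_def\<close>)
    then show ?thesis using 1 by (simp add: bump_deriv_def)
  next
    case 2
    have "(bump_deriv n has_real_derivative bump_deriv (Suc n) t) (at t)"
    proof (rule has_field_derivative_transform_within_open[where S = "{0<..}"])
      show "((\<lambda>t. poly (bump_poly n) (1 / t) * exp (- (1 / t))) has_real_derivative bump_deriv (Suc n) t) (at t)"
      proof -
        have inv: "((\<lambda>t. 1 / t) has_real_derivative - (1 / t\<^sup>2)) (at t)"
          using 2 by (auto intro!: derivative_eq_intros simp: power2_eq_square)
        show ?thesis
          using 2 by (auto intro!: derivative_eq_intros DERIV_chain2[OF poly_DERIV inv] inv simp: bump_deriv_def)
             (simp add: algebra_simps power2_eq_square diff_divide_distrib add_divide_distrib)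
      qed
    qed (use 2 in \<open>auto simp: bump_deriv_def\<close>)
    then show ?thesis .
  next
    case 3
    have "((\<lambda>h. (bump_deriv n h - bump_deriv n 0) / (h - 0)) \<longlongrightarrow> 0) (at 0)"
    proof (rule filterlim_split_at)
      show "((\<lambda>h. (bump_deriv n h - bump_deriv n 0) / (h - 0)) \<longlongrightarrow> 0) (at_left 0)"
        by (rule tendsto_eventually) (simp add: eventually_at_filter bump_deriv_def)
      have "((\<lambda>h. poly (pCons 0 (bump_poly n)) (inverse h) * exp (- inverse h)) \<longlongrightarrow> 0) (at_right 0)"
        by (rule filterlim_compose[OF poly_exp_decay filterlim_inverse_at_top_right])
      then show "((\<lambda>h. (bump_deriv n h - bump_deriv n 0) / (h - 0)) \<longlongrightarrow> 0) (at_right 0)"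
        by (rule Lim_transform_eventually)
           (simp add: eventually_at_filter bump_deriv_def inverse_eq_divide)
    qed
    then show ?thesis
      using 3 by (simp add: has_field_derivative_iff bump_deriv_def)
  qed
qed

text \<open>
  A smooth function with value \<open>1\<close> at \<open>0\<close> that vanishes on \<open>[1, \<infinity>)\<close>. It is not constant near \<open>0\<close>;
  boundedness of \<open>s cutoff'(s)\<close> and continuity at \<open>0\<close> are enough to remove it by dominated
  convergence.
\<close>

definition cutoff :: "real \<Rightarrow> real" where "cutoff s = exp 1 * bump_deriv 0 (1 - s)"
definition cutoff' :: "real \<Rightarrow> real" where "cutoff' s = - exp 1 * bump_deriv 1 (1 - s)"

lemma bump_deriv_cont: "continuous_on S (bump_deriv n)"
  by (rule DERIV_continuous_on) (rule has_field_derivative_at_within[OF bump_deriv])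

lemma cutoff_deriv: "(cutoff has_real_derivative cutoff' s) (at s)"
proof -
  have "((\<lambda>s. bump_deriv 0 (1 - s)) has_real_derivative bump_deriv (Suc 0) (1 - s) * (-1)) (at s)"
    by (rule DERIV_chain2[where f = "bump_deriv 0", OF bump_deriv]) (auto intro!: derivative_eq_intros)
  from DERIV_cmult[OF this, of "exp 1"] show ?thesis
    by (simp add: cutoff_def[abs_def] cutoff'_def)
qed

lemma cutoff_cont: "continuous_on S cutoff" "continuous_on S cutoff'"
  unfolding cutoff_def[abs_def] cutoff'_def[abs_def]
  by (intro continuous_intros continuous_on_compose2[OF bump_deriv_cont]; auto)+

lemma cutoff_0: "cutoff 0 = 1"
  by (simp add: cutoff_def bump_deriv_def mult_exp_exp)

lemma cutoff_eq_0: "s \<ge> 1 \<Longrightarrow> cutoff s = 0" "s \<ge> 1 \<Longrightarrow> cutoff' s = 0"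
  by (auto simp: cutoff_def cutoff'_def bump_deriv_def)

lemma cutoff_bounds: "0 \<le> cutoff s" "s \<ge> 0 \<Longrightarrow> cutoff s \<le> 1"
proof -
  show "s \<ge> 0 \<Longrightarrow> cutoff s \<le> 1"
  proof (cases "s < 1")
    case True
    assume "s \<ge> 0"
    then have "1 \<le> 1 / (1 - s)" using True by simp
    then show ?thesis using True by (simp add: cutoff_def bump_deriv_def mult_exp_exp)
  qed (simp add: cutoff_def bump_deriv_def)
qed (auto simp: cutoff_def bump_deriv_def)

lemma cutoff'_bound: "\<exists>M\<ge>0. \<forall>s\<ge>0. \<bar>s * cutoff' s\<bar> \<le> M"
proof -
  have "compact ((\<lambda>s. s * cutoff' s) ` {0..1})"
    by (intro compact_continuous_image continuous_intros cutoff_cont) auto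
  then obtain M where M: "\<And>s. s \<in> {0..1} \<Longrightarrow> \<bar>s * cutoff' s\<bar> \<le> M"
    by (meson bounded_real compact_imp_bounded imageI)
  have "\<bar>s * cutoff' s\<bar> \<le> max M 0" if "s \<ge> 0" for s
    using M[of s] that cutoff_eq_0(2)[of s] by (cases "s \<le> 1") auto
  then show ?thesis by (intro exI[of _ "max M 0"]) auto
qed

text \<open>
  The profile \<open>q\<close> of the regularised and cut off kernel \<open>z q(|z|\<^sup>2)\<close>: for \<open>d \<rightarrow> 0\<close> and \<open>R \<rightarrow> \<infinity>\<close> it
  becomes \<open>|z|\<^sup>-\<^sup>3\<close>.
\<close>

definition reg_profile :: "real \<Rightarrow> real \<Rightarrow> real \<Rightarrow> real" where
  "reg_profile d R s = (s + d\<^sup>2) powr - (3 / 2) * cutoff (s / R\<^sup>2)"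

definition reg_profile' :: "real \<Rightarrow> real \<Rightarrow> real \<Rightarrow> real" where
  "reg_profile' d R s = - (3 / 2) * (s + d\<^sup>2) powr - (5 / 2) * cutoff (s / R\<^sup>2)
     + (s + d\<^sup>2) powr - (3 / 2) * (cutoff' (s / R\<^sup>2) / R\<^sup>2)"

lemma reg_profile_deriv:
  assumes "s + d\<^sup>2 > 0" "R > 0"
  shows "(reg_profile d R has_real_derivative reg_profile' d R s) (at s)"
  unfolding reg_profile_def[abs_def] reg_profile'_def
  using assms by (auto intro!: derivative_eq_intros DERIV_chain2[OF cutoff_deriv]
      simp: power2_eq_square power4_eq_xxxx)

definition kernel_test :: "real \<Rightarrow> real \<Rightarrow> real^3 \<Rightarrow> 3 \<Rightarrow> real^3 \<Rightarrow> real" where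
  "kernel_test d R x k y = (x - y) $ k * reg_profile d R ((norm (x - y))\<^sup>2)"

lemma Ck_sqnorm: "Ck n (\<lambda>y. (norm (x - y))\<^sup>2)"
proof -
  have "(\<lambda>y. (norm (x - y))\<^sup>2) = (\<lambda>y. \<Sum>k\<in>UNIV. (x $ k + (- (y $ k))) * (x $ k + (- (y $ k))))"
    by (auto simp: norm_vec_def L2_set_def power2_eq_square sum_nonneg)
  then show ?thesis
    by (simp only:) (intro Ck_sum Ck_mult Ck_affine bounded_linear_minus bounded_linear_vec_nth)
qed

lemma Ck_powr:
  assumes "d > 0"
  shows "Ck n (\<lambda>y. ((norm (x - y))\<^sup>2 + d\<^sup>2) powr a)"
proof -
  define D where "D n t = (\<Prod>i<n. a - real i) * t powr (a - real n)" for n and t :: real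
  have D: "(D n has_real_derivative D (Suc n) t) (at t)" if "t \<in> {0<..}" for n t
    unfolding D_def[abs_def] using that by (auto intro!: derivative_eq_intros simp: algebra_simps)
  have pos: "(norm (x - y))\<^sup>2 + d\<^sup>2 \<in> {0<..}" for y
    using assms add_nonneg_pos[of "(norm (x - y))\<^sup>2" "d\<^sup>2"] by simp
  have "Ck n (\<lambda>y. D 0 ((norm (x - y))\<^sup>2 + d\<^sup>2))"
    by (rule Ck_compose[where d = D and n = 0 and S = "{0<..}" and h = "\<lambda>y. (norm (x - y))\<^sup>2 + d\<^sup>2",
          OF D pos Ck_add[OF Ck_sqnorm Ck_const]])
  then show ?thesis by (simp add: D_def)
qed

lemma Ck_cutoff: "Ck n (\<lambda>y. cutoff ((norm (x - y))\<^sup>2 / R\<^sup>2))"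
proof -
  define h where "h y = 1 + (- (1 / R\<^sup>2)) * (norm (x - y))\<^sup>2" for y :: "real^3"
  have h: "Ck n h"
    unfolding h_def[abs_def] by (rule Ck_add[OF Ck_const Ck_mult[OF Ck_const Ck_sqnorm]])
  have B: "(bump_deriv n has_real_derivative bump_deriv (Suc n) t) (at t)" if "t \<in> UNIV" for n t
    by (rule bump_deriv)
  have "Ck n (\<lambda>y. bump_deriv 0 (h y))"
    by (rule Ck_compose[where d = bump_deriv and n = 0 and S = UNIV and h = h, OF B UNIV_I h])
  then have "Ck n (\<lambda>y. exp 1 * bump_deriv 0 (h y))"
    by (rule Ck_mult[OF Ck_const])
  then show ?thesis by (simp add: cutoff_def h_def)
qed

lemma kernel_test_test_fun:
  assumes "d > 0" "R > 0"
  shows "test_fun (kernel_test d R x k)"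
  unfolding test_fun_def
proof (intro conjI allI)
  fix n
  have "Ck n (\<lambda>y. (x $ k + (- (y $ k))) * (((norm (x - y))\<^sup>2 + d\<^sup>2) powr - (3 / 2) * cutoff ((norm (x - y))\<^sup>2 / R\<^sup>2)))"
    by (rule Ck_mult[OF Ck_affine[OF bounded_linear_minus[OF bounded_linear_vec_nth]]
          Ck_mult[OF Ck_powr[OF assms(1)] Ck_cutoff]])
  then show "Ck n (kernel_test d R x k)"
    by (simp add: kernel_test_def[abs_def] reg_profile_def)
next
  have "{y. kernel_test d R x k y \<noteq> 0} \<subseteq> cball x R"
  proof
    fix y assume "y \<in> {y. kernel_test d R x k y \<noteq> 0}"
    then have "\<not> (norm (x - y))\<^sup>2 / R\<^sup>2 \<ge> 1"
      using cutoff_eq_0 by (auto simp: kernel_test_def reg_profile_def)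
    then have "\<not> R\<^sup>2 \<le> (norm (x - y))\<^sup>2" using assms by simp
    then show "y \<in> cball x R"
      using assms power_mono[of R "norm (x - y)" 2] by (simp add: dist_norm)
  qed
  then show "compact (closure {y. kernel_test d R x k y \<noteq> 0})"
    by (meson bounded_cball bounded_subset compact_closure)
qed

lemma kernel_test_gradient:
  assumes "d > 0" "R > 0"
  shows "(\<chi> j. frechet_derivative (kernel_test d R x k) (at y) (axis j 1))
     = - (reg_profile d R ((norm (x - y))\<^sup>2) *\<^sub>R axis k 1
          + (2 * reg_profile' d R ((norm (x - y))\<^sup>2) * (x - y) $ k) *\<^sub>R (x - y))"
proof -
  have pos: "(norm (x - y))\<^sup>2 + d\<^sup>2 > 0" using assms(1) by (intro add_nonneg_pos) simp_all
  have lin: "((\<lambda>y. x - y) has_derivative (\<lambda>v. - v)) (at y)"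
    using has_derivative_diff[OF has_derivative_const has_derivative_ident] by simp
  have sq: "((\<lambda>y. (norm (x - y))\<^sup>2) has_derivative (\<lambda>v. - 2 * ((x - y) \<bullet> v))) (at y)"
    using has_derivative_inner[OF lin lin] by (simp add: power2_norm_eq_inner inner_commute)
  have "((\<lambda>y. reg_profile d R ((norm (x - y))\<^sup>2)) has_derivative
      (\<lambda>v. reg_profile' d R ((norm (x - y))\<^sup>2) * (- 2 * ((x - y) \<bullet> v)))) (at y)"
    using has_derivative_compose[OF sq reg_profile_deriv[OF pos assms(2), unfolded has_field_derivative_def]]
    by simp
  moreover have "((\<lambda>y. (x - y) $ k) has_derivative (\<lambda>v. - (v $ k))) (at y)"
    using bounded_linear.has_derivative[OF bounded_linear_vec_nth lin] by simp
  ultimately have "(kernel_test d R x k has_derivative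
     (\<lambda>v. (x - y) $ k * (reg_profile' d R ((norm (x - y))\<^sup>2) * (- 2 * ((x - y) \<bullet> v)))
        + - (v $ k) * reg_profile d R ((norm (x - y))\<^sup>2))) (at y)"
    unfolding kernel_test_def[abs_def] by (intro has_derivative_mult)
  then have "frechet_derivative (kernel_test d R x k) (at y) =
     (\<lambda>v. (x - y) $ k * (reg_profile' d R ((norm (x - y))\<^sup>2) * (- 2 * ((x - y) \<bullet> v)))
        + - (v $ k) * reg_profile d R ((norm (x - y))\<^sup>2))"
    by (rule frechet_derivative_at[symmetric])
  then show ?thesis
    by (simp add: vec_eq_iff inner_axis) (simp add: axis_def algebra_simps)
qed

section \<open>Clifford multiplication by vectors of three-space\<close>

text \<open>
  The action of \<open>\<sigma>\<cdot>v\<close> on spinors, kept as a real bilinear map of \<open>v\<close> and \<open>\<psi>\<close>. Analysis takes place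
  in the real inner product space \<open>complex^2\<close>, for which it is symmetric with square \<open>|v|\<^sup>2\<close>.
\<close>

definition cliff :: "real^3 \<Rightarrow> complex^2 \<Rightarrow> complex^2" where
  "cliff v \<psi> = sigma_dot v *v \<psi>"

definition icliff :: "real^3 \<Rightarrow> complex^2 \<Rightarrow> complex^2" where
  "icliff v \<psi> = \<i> *s cliff v \<psi>"

lemma cliff_nth:
  "cliff v \<psi> $ 1 = of_real (v $ 3) * \<psi> $ 1 + (of_real (v $ 1) - \<i> * of_real (v $ 2)) * \<psi> $ 2"
  "cliff v \<psi> $ 2 = (of_real (v $ 1) + \<i> * of_real (v $ 2)) * \<psi> $ 1 - of_real (v $ 3) * \<psi> $ 2"
  by (simp_all add: cliff_def sigma_dot_def matrix_vector_mult_def cscale_mat_def pauli_def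
      sum_2 sum_3 vector_3 vector_2 algebra_simps)

lemma vec2_eqI: "a $ 1 = b $ 1 \<Longrightarrow> a $ 2 = b $ 2 \<Longrightarrow> a = (b :: 'a^2)"
  by (simp add: vec_eq_iff forall_2)

lemma inner_vec2: "a \<bullet> b = a $ 1 \<bullet> b $ 1 + a $ 2 \<bullet> b $ 2" for a b :: "complex^2"
  by (simp add: inner_vec_def sum_2)

lemma cliff_cliff_self: "cliff v (cliff v \<psi>) = (norm v)\<^sup>2 *\<^sub>R \<psi>"
proof -
  have "(norm v)\<^sup>2 = (v $ 1)\<^sup>2 + (v $ 2)\<^sup>2 + (v $ 3)\<^sup>2"
    unfolding power2_norm_eq_inner by (simp add: inner_vec_def sum_3 power2_eq_square)
  then show ?thesis
    by (intro vec2_eqI) (simp_all add: cliff_nth complex_eq_iff algebra_simps power2_eq_square)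
qed

lemma cliff_self_adjoint: "cliff v \<psi> \<bullet> \<xi> = \<psi> \<bullet> cliff v \<xi>"
  by (simp add: inner_vec2 cliff_nth inner_complex_def algebra_simps)

lemma norm_cliff: "norm (cliff v \<psi>) = norm v * norm \<psi>"
proof (rule power2_eq_imp_eq)
  show "(norm (cliff v \<psi>))\<^sup>2 = (norm v * norm \<psi>)\<^sup>2"
    by (simp add: power2_norm_eq_inner[of "cliff v \<psi>"] cliff_self_adjoint cliff_cliff_self
        power_mult_distrib power2_norm_eq_inner[of \<psi>])
qed auto

lemma bounded_bilinear_cliff: "bounded_bilinear cliff"
proof
  show "\<exists>K. \<forall>v \<psi>. norm (cliff v \<psi>) \<le> norm v * norm \<psi> * K"
    by (intro exI[of _ 1]) (simp add: norm_cliff)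
qed (auto intro!: vec2_eqI simp: cliff_nth complex_eq_iff algebra_simps)

lemma norm_imult: "norm (\<i> *s \<psi>) = norm \<psi>" for \<psi> :: "complex^'n"
  by (simp add: norm_vec_def norm_mult)

lemma bounded_linear_imult: "bounded_linear (\<lambda>\<psi>. \<i> *s \<psi> :: complex^'n)"
  by (rule bounded_linear_intro[where K = 1])
     (simp_all add: norm_imult vector_add_ldistrib, simp add: vec_eq_iff)

lemma inner_imult: "(\<i> *s \<psi>) \<bullet> \<xi> = - (\<psi> \<bullet> (\<i> *s \<xi>))" for \<psi> :: "complex^'n"
  by (simp add: inner_vec_def inner_complex_def sum_negf[symmetric] algebra_simps)

lemma bounded_bilinear_icliff: "bounded_bilinear icliff"
proof -
  interpret bounded_bilinear cliff by (rule bounded_bilinear_cliff)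
  interpret I: bounded_linear "\<lambda>\<psi>. \<i> *s \<psi> :: complex^2" by (rule bounded_linear_imult)
  show ?thesis
    unfolding icliff_def
    by standard (auto simp: add_left add_right I.add scaleR_left scaleR_right I.scaleR norm_imult norm_cliff
        intro!: exI[of _ 1])
qed

interpretation cliff: bounded_bilinear cliff by (rule bounded_bilinear_cliff)
interpretation icliff: bounded_bilinear icliff by (rule bounded_bilinear_icliff)

lemma norm_icliff: "norm (icliff v \<psi>) = norm v * norm \<psi>"
  by (simp add: icliff_def norm_imult norm_cliff)

lemma cliff_imult: "cliff v (\<i> *s \<psi>) = icliff v \<psi>"
  by (intro vec2_eqI) (simp_all add: icliff_def cliff_nth algebra_simps)

lemma icliff_adjoint: "icliff v \<psi> \<bullet> \<xi> = \<psi> \<bullet> icliff (- v) \<xi>"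
  unfolding icliff.minus_left by (simp add: icliff_def inner_imult cliff_self_adjoint cliff_imult)

lemma cliff_axis_sum: "(\<Sum>k\<in>UNIV. (v $ k) *\<^sub>R cliff (axis k 1) \<psi>) = cliff v \<psi>"
proof -
  have "v = (\<Sum>k\<in>UNIV. (v $ k) *\<^sub>R axis k 1)"
    by (simp add: vec_eq_iff axis_def sum_component if_distrib[of "(*) _"] cong: if_cong)
  then show ?thesis
    by (metis (no_types, lifting) cliff.scaleR_left cliff.sum_left sum.cong)
qed

lemma cliff_axis_square_sum: "(\<Sum>k\<in>UNIV. cliff (axis k 1) (cliff (axis k 1) \<psi>)) = 3 *\<^sub>R \<psi>"
  by (simp add: cliff_cliff_self norm_axis_1 sum_constant_scaleR del: sum_constant)

text \<open>
  The product rule \<open>\<sigma>\<cdot>w \<sigma>\<cdot>a = w\<cdot>a + i\<sigma>\<cdot>(w \<times> a)\<close>.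
\<close>

lemma cliff_cliff_profile:
  "(cscale_mat (of_real (w \<bullet> a)) (mat 1) + cscale_mat \<i> (sigma_dot (cross3 w a))) *v \<psi> = cliff w (cliff a \<psi>)"
proof -
  have "cscale_mat \<i> M *v \<psi> = \<i> *s (M *v \<psi>)" for M :: "complex^2^2"
    by (simp add: vec_eq_iff cscale_mat_def matrix_vector_mult_def sum_distrib_left mult.assoc)
  moreover have "cscale_mat (of_real c) (mat 1) *v \<psi> = c *\<^sub>R \<psi>" for c
    by (intro vec2_eqI) (simp_all add: cscale_mat_def matrix_vector_mult_def mat_def sum_2 scaleR_conv_of_real[where 'a = complex])
  ultimately have "(cscale_mat (of_real (w \<bullet> a)) (mat 1) + cscale_mat \<i> (sigma_dot (cross3 w a))) *v \<psi>
      = (w \<bullet> a) *\<^sub>R \<psi> + \<i> *s cliff (cross3 w a) \<psi>"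
    by (simp add: matrix_vector_mult_add_rdistrib cliff_def)
  also have "\<dots> = cliff w (cliff a \<psi>)"
    by (intro vec2_eqI)
       (simp_all add: cliff_nth inner_vec_def sum_3 cross3_def vector_3 complex_eq_iff algebra_simps)
  finally show ?thesis .
qed

section \<open>The weak equation tested against the regularised kernel\<close>

definition test_gradient :: "(real^3 \<Rightarrow> real) \<Rightarrow> real^3 \<Rightarrow> real^3" where
  "test_gradient h y = (\<chi> j. frechet_derivative h (at y) (axis j 1))"

text \<open>
  The weak form of \<open>\<sigma>\<cdot>D \<phi> = F\<close>, written over Lebesgue-Borel measure for Borel representatives.
\<close>

definition weak_dirac_eq :: "(real^3 \<Rightarrow> complex^2) \<Rightarrow> (real^3 \<Rightarrow> complex^2) \<Rightarrow> bool" where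
  "weak_dirac_eq \<phi> F \<longleftrightarrow> (\<forall>h. test_fun h \<longrightarrow>
     (LINT y|lborel. cliff (test_gradient h y) (\<phi> y)) = - (LINT y|lborel. h y *\<^sub>R (\<i> *s F y)))"

lemma cliff_measurable [measurable]:
  assumes [measurable]: "f \<in> borel_measurable M" "g \<in> borel_measurable M"
  shows "(\<lambda>x. cliff (f x) (g x)) \<in> borel_measurable M"
  by (rule borel_measurable_continuous_Pair) (auto intro!: cliff.continuous_on continuous_intros)

lemma imult_measurable [measurable]:
  assumes [measurable]: "g \<in> borel_measurable M"
  shows "(\<lambda>x. \<i> *s g x :: complex^'n) \<in> borel_measurable M"
  by (rule borel_measurable_continuous_on[OF linear_continuous_on[OF bounded_linear_imult] assms])

lemma vec_nth_measurable [measurable]: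
  fixes f :: "'a \<Rightarrow> real^'n"
  assumes [measurable]: "f \<in> borel_measurable M"
  shows "(\<lambda>x. f x $ k) \<in> borel_measurable M"
  by (rule borel_measurable_continuous_on[OF linear_continuous_on[OF bounded_linear_vec_nth] assms])

lemma icliff_measurable [measurable]:
  assumes [measurable]: "f \<in> borel_measurable M" "g \<in> borel_measurable M"
  shows "(\<lambda>x. icliff (f x) (g x)) \<in> borel_measurable M"
  unfolding icliff_def by measurable

lemma integrable_jb_powr:
  assumes "t > 3"
  shows "integrable lborel (\<lambda>y. japanese_bracket y powr - t)"
  using nn_integral_jb_finite[OF assms] by (intro integrableI_bounded) auto

lemma integrable_jb_powr_diff:
  assumes "t > 3"
  shows "integrable lborel (\<lambda>y. japanese_bracket (x - y) powr - t)"
  using nn_integral_jb_finite[OF assms]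
  by (intro integrableI_bounded)
     (auto simp: nn_integral_lborel_reflect[of "\<lambda>z. ennreal (japanese_bracket z powr - t)" x])

text \<open>
  Cauchy-Schwarz in the form \<open>2 s t \<le> s\<^sup>2 + t\<^sup>2\<close>: the weight \<open>\<langle>x - y\<rangle>\<^sup>-\<^sup>a\<close> is square integrable for
  \<open>a > 3/2\<close>.
\<close>

lemma integrable_weighted_powr:
  fixes \<phi> :: "real^3 \<Rightarrow> complex^2" and g :: "real^3 \<Rightarrow> 'b::{banach, second_countable_topology}"
  assumes [measurable]: "\<phi> \<in> borel_measurable borel" "g \<in> borel_measurable borel"
    and L2: "integrable lborel (\<lambda>y. (norm (\<phi> y))\<^sup>2)" and a: "a > 3 / 2"
    and bound: "\<And>y. norm (g y) \<le> c * (japanese_bracket (x - y) powr - a * norm (\<phi> y))"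
  shows "integrable lborel g"
proof (rule Bochner_Integration.integrable_bound)
  let ?m = "\<lambda>y. \<bar>c\<bar> * (japanese_bracket (x - y) powr - (2 * a) + (norm (\<phi> y))\<^sup>2)"
  show "integrable lborel ?m"
    using a by (intro integrable_mult_right Bochner_Integration.integrable_add integrable_jb_powr_diff L2) simp
  show "AE y in lborel. norm (g y) \<le> norm (?m y)"
  proof (rule AE_I2)
    fix y
    let ?w = "japanese_bracket (x - y) powr - a"
    have "?w * norm (\<phi> y) \<le> ?w\<^sup>2 + (norm (\<phi> y))\<^sup>2"
      by (rule mult_le_sum_squares) simp_all
    also have "?w\<^sup>2 = japanese_bracket (x - y) powr - (2 * a)"
      by (simp add: power2_eq_square powr_add[symmetric])
    finally have le: "?w * norm (\<phi> y) \<le> japanese_bracket (x - y) powr - (2 * a) + (norm (\<phi> y))\<^sup>2" .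
    have "norm (g y) \<le> \<bar>c\<bar> * (?w * norm (\<phi> y))"
      by (rule order.trans[OF bound]) (intro mult_right_mono, auto)
    also have "\<dots> \<le> ?m y"
      by (intro mult_left_mono le) auto
    finally show "norm (g y) \<le> norm (?m y)"
      by simp
  qed
qed measurable

lemmas integrable_weighted = integrable_weighted_powr[where a = 2, simplified]

lemma reg_weight_bound:
  assumes "0 < d" "d \<le> 1" "0 \<le> t" "t \<le> japanese_bracket z"
  shows "((norm z)\<^sup>2 + d\<^sup>2) powr - (3 / 2) * t \<le> d powr - 3 * japanese_bracket z powr - 2"
proof -
  let ?J = "japanese_bracket z"
  have J2: "?J\<^sup>2 = 1 + (norm z)\<^sup>2" by (simp add: japanese_bracket_def)
  have "d\<^sup>2 * (norm z)\<^sup>2 \<le> 1 * (norm z)\<^sup>2"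
    using assms by (intro mult_right_mono power_le_one) auto
  then have "(d * ?J)\<^sup>2 \<le> (norm z)\<^sup>2 + d\<^sup>2"
    by (simp add: power_mult_distrib J2 algebra_simps)
  then have "((norm z)\<^sup>2 + d\<^sup>2) powr - (3 / 2) \<le> ((d * ?J)\<^sup>2) powr - (3 / 2)"
    using assms by (intro powr_mono2') auto
  also have "((d * ?J)\<^sup>2) powr - (3 / 2) = (d * ?J) powr - 3"
    using assms by (simp add: powr_powr flip: powr_numeral)
  also have "\<dots> = d powr - 3 * ?J powr - 3"
    using assms by (simp add: powr_mult)
  finally have "((norm z)\<^sup>2 + d\<^sup>2) powr - (3 / 2) * t \<le> d powr - 3 * ?J powr - 3 * ?J"
    using assms by (intro mult_mono) auto
  also have "\<dots> = d powr - 3 * (?J powr - 3 * ?J powr 1)" by simp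
  also have "?J powr - 3 * ?J powr 1 = ?J powr - 2"
    unfolding powr_add[symmetric] by simp
  finally show ?thesis .
qed

lemma reg_profile_bounds:
  assumes "s \<ge> 0"
  shows "0 \<le> reg_profile d R s" "reg_profile d R s \<le> (s + d\<^sup>2) powr - (3 / 2)"
  using assms cutoff_bounds[of "s / R\<^sup>2"] by (auto simp: reg_profile_def intro: mult_left_le)

text \<open>
  The constant does not depend on \<open>R\<close>, which makes it a dominating function when the cutoff is
  removed.
\<close>

lemma reg_profile'_bound:
  "\<exists>K\<ge>0. \<forall>d R s. s \<ge> 0 \<longrightarrow> d > 0 \<longrightarrow> \<bar>s * reg_profile' d R s\<bar> \<le> K * (s + d\<^sup>2) powr - (3 / 2)"
proof -
  obtain M where M: "M \<ge> 0" "\<And>s. s \<ge> 0 \<Longrightarrow> \<bar>s * cutoff' s\<bar> \<le> M"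
    using cutoff'_bound by blast
  have combine: "\<bar>u\<bar> \<le> (3 / 2 + M) * P" if "\<bar>a\<bar> \<le> P * 1" "\<bar>b\<bar> \<le> P * M" "u = - (3 / 2) * a + b" for a b u P :: real
    using that by (auto simp: abs_le_iff algebra_simps)
  have "\<bar>s * reg_profile' d R s\<bar> \<le> (3 / 2 + M) * (s + d\<^sup>2) powr - (3 / 2)" if s: "s \<ge> 0" and d: "d > 0" for d R s
  proof -
    have p: "s + d\<^sup>2 > 0" using s zero_less_power[OF d, of 2] by linarith
    have "(s + d\<^sup>2) powr - (5 / 2) * (s + d\<^sup>2) powr 1 = (s + d\<^sup>2) powr - (3 / 2)"
      unfolding powr_add[symmetric] by simp
    then have e: "(s + d\<^sup>2) powr - (5 / 2) * (s + d\<^sup>2) = (s + d\<^sup>2) powr - (3 / 2)"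
      using p by simp
    have "s * (s + d\<^sup>2) powr - (5 / 2) \<le> (s + d\<^sup>2) powr - (5 / 2) * (s + d\<^sup>2)"
      by (subst mult.commute) (intro mult_left_mono, auto)
    then have 1: "s * (s + d\<^sup>2) powr - (5 / 2) \<le> (s + d\<^sup>2) powr - (3 / 2)"
      unfolding e .
    have c: "\<bar>cutoff (s / R\<^sup>2)\<bar> \<le> 1"
      using s cutoff_bounds[of "s / R\<^sup>2"] by simp
    have "\<bar>s * (s + d\<^sup>2) powr - (5 / 2) * cutoff (s / R\<^sup>2)\<bar> \<le> (s + d\<^sup>2) powr - (3 / 2) * 1"
      unfolding abs_mult using 1 c s by (intro mult_mono) auto
    moreover have "\<bar>(s + d\<^sup>2) powr - (3 / 2) * (s / R\<^sup>2 * cutoff' (s / R\<^sup>2))\<bar> \<le> (s + d\<^sup>2) powr - (3 / 2) * M"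
      unfolding abs_mult[of "(s + d\<^sup>2) powr - (3 / 2)"] using M(2)[of "s / R\<^sup>2"] s by (intro mult_mono) auto
    moreover have "s * reg_profile' d R s = - (3 / 2) * (s * (s + d\<^sup>2) powr - (5 / 2) * cutoff (s / R\<^sup>2))
        + (s + d\<^sup>2) powr - (3 / 2) * (s / R\<^sup>2 * cutoff' (s / R\<^sup>2))"
      by (simp add: reg_profile'_def algebra_simps)
    ultimately show ?thesis by (rule combine)
  qed
  then show ?thesis using M(1) by (intro exI[of _ "3 / 2 + M"]) auto
qed

lemma reg_profile_measurable [measurable]: "reg_profile d R \<in> borel_measurable borel" "reg_profile' d R \<in> borel_measurable borel"
proof -
  have [measurable]: "cutoff \<in> borel_measurable borel" "cutoff' \<in> borel_measurable borel"
    by (intro borel_measurable_continuous_onI cutoff_cont)+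
  show "reg_profile d R \<in> borel_measurable borel" "reg_profile' d R \<in> borel_measurable borel"
    unfolding reg_profile_def[abs_def] reg_profile'_def[abs_def] by measurable
qed

lemma test_kernel_gradient_cliff:
  assumes "d > 0" "R > 0"
  shows "cliff (test_gradient (kernel_test d R x k) y) \<psi>
     = - (reg_profile d R ((norm (x - y))\<^sup>2) *\<^sub>R cliff (axis k 1) \<psi>
          + (2 * reg_profile' d R ((norm (x - y))\<^sup>2) * (x - y) $ k) *\<^sub>R cliff (x - y) \<psi>)"
  unfolding test_gradient_def kernel_test_gradient[OF assms]
  by (simp add: cliff.minus_left cliff.add_left cliff.diff_left cliff.scaleR_left)

text \<open>
  Test the weak equation with the components \<open>z\<^sub>k q(|z|\<^sup>2)\<close>, \<open>z = x - y\<close>, apply \<open>\<sigma>\<^sub>k\<close> and sum over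
  \<open>k\<close>. As the field \<open>z q(|z|\<^sup>2)\<close> is a gradient, the relations \<open>\<sigma>\<^sub>j \<sigma>\<^sub>k + \<sigma>\<^sub>k \<sigma>\<^sub>j = 2 \<delta>\<^sub>j\<^sub>k\<close> leave only
  its divergence \<open>3 q + 2 |z|\<^sup>2 q'\<close> on the left-hand side.
\<close>

lemma weak_dirac_cutoff_identity:
  assumes [measurable]: "\<phi> \<in> borel_measurable borel" "F \<in> borel_measurable borel"
    and L2: "integrable lborel (\<lambda>y. (norm (\<phi> y))\<^sup>2)" "integrable lborel (\<lambda>y. (norm (F y))\<^sup>2)"
    and weak: "weak_dirac_eq \<phi> F" and d: "0 < d" "d \<le> 1" and R: "R > 0"
  shows "(LINT y|lborel. (3 * reg_profile d R ((norm (x - y))\<^sup>2) + 2 * ((norm (x - y))\<^sup>2 * reg_profile' d R ((norm (x - y))\<^sup>2))) *\<^sub>R \<phi> y)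
      = (LINT y|lborel. reg_profile d R ((norm (x - y))\<^sup>2) *\<^sub>R icliff (x - y) (F y))"
proof -
  let ?q = "\<lambda>y. reg_profile d R ((norm (x - y))\<^sup>2)" and ?q' = "\<lambda>y. reg_profile' d R ((norm (x - y))\<^sup>2)"
  let ?p = "\<lambda>y. ((norm (x - y))\<^sup>2 + d\<^sup>2) powr - (3 / 2)"
  let ?J = japanese_bracket
  obtain K where K: "K \<ge> 0" "\<And>s. s \<ge> 0 \<Longrightarrow> \<bar>s * reg_profile' d R s\<bar> \<le> K * (s + d\<^sup>2) powr - (3 / 2)"
    using reg_profile'_bound d by blast
  have p1: "?p y \<le> d powr - 3 * ?J (x - y) powr - 2" for y
    using reg_weight_bound[OF d, of 1 "x - y"] jb_ge_1[of "x - y"] by simp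
  have p2: "?p y * norm (x - y) \<le> d powr - 3 * ?J (x - y) powr - 2" for y
    using reg_weight_bound[OF d, of "norm (x - y)" "x - y"] norm_le_jb[of "x - y"] by simp
  define G where "G k y = - (?q y *\<^sub>R cliff (axis k 1) (\<phi> y) + (2 * ?q' y * (x - y) $ k) *\<^sub>R cliff (x - y) (\<phi> y))" for k y
  define H where "H k y = kernel_test d R x k y *\<^sub>R (\<i> *s F y)" for k y
  have [measurable]: "G k \<in> borel_measurable borel" for k
    unfolding G_def[abs_def] by measurable
  have [measurable]: "H k \<in> borel_measurable borel" for k
    unfolding H_def[abs_def] kernel_test_def by measurable
  have intG: "integrable lborel (G k)" for k
  proof (rule integrable_weighted[OF assms(1) _ L2(1)])
    fix y
    have a: "norm (?q y *\<^sub>R cliff (axis k 1) (\<phi> y)) \<le> ?p y * norm (\<phi> y)"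
      using reg_profile_bounds[of "(norm (x - y))\<^sup>2" d R] by (simp add: norm_cliff norm_axis_1 mult_right_mono)
    have "norm ((2 * ?q' y * (x - y) $ k) *\<^sub>R cliff (x - y) (\<phi> y))
        = 2 * (\<bar>?q' y\<bar> * \<bar>(x - y) $ k\<bar> * norm (x - y)) * norm (\<phi> y)"
      by (simp add: norm_cliff abs_mult)
    also have "\<dots> \<le> 2 * (\<bar>?q' y\<bar> * norm (x - y) * norm (x - y)) * norm (\<phi> y)"
      by (intro mult_right_mono mult_left_mono component_le_norm_cart) auto
    also have "\<dots> = 2 * \<bar>(norm (x - y))\<^sup>2 * ?q' y\<bar> * norm (\<phi> y)"
      by (simp add: abs_mult power2_eq_square)
    also have "\<dots> \<le> 2 * (K * ?p y) * norm (\<phi> y)"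
      by (intro mult_right_mono mult_left_mono K) auto
    finally have b: "norm ((2 * ?q' y * (x - y) $ k) *\<^sub>R cliff (x - y) (\<phi> y)) \<le> 2 * (K * ?p y) * norm (\<phi> y)" .
    have "norm (G k y) \<le> ?p y * norm (\<phi> y) + 2 * (K * ?p y) * norm (\<phi> y)"
      unfolding G_def norm_minus_cancel by (rule norm_triangle_mono[OF a b])
    also have "\<dots> = (1 + 2 * K) * ?p y * norm (\<phi> y)"
      by (simp add: algebra_simps)
    also have "\<dots> \<le> (1 + 2 * K) * (d powr - 3 * ?J (x - y) powr - 2) * norm (\<phi> y)"
      using K by (intro mult_right_mono mult_left_mono p1) auto
    finally show "norm (G k y) \<le> ((1 + 2 * K) * d powr - 3) * (?J (x - y) powr - 2 * norm (\<phi> y))"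
      by (simp add: mult.assoc)
  qed measurable
  have intH: "integrable lborel (H k)" for k
  proof (rule integrable_weighted[OF assms(2) _ L2(2)])
    fix y
    have "norm (H k y) = (\<bar>(x - y) $ k\<bar> * \<bar>?q y\<bar>) * norm (F y)"
      by (simp add: H_def kernel_test_def norm_imult abs_mult)
    also have "\<dots> \<le> (norm (x - y) * ?p y) * norm (F y)"
      using reg_profile_bounds[of "(norm (x - y))\<^sup>2" d R] component_le_norm_cart[of "x - y" k]
      by (intro mult_right_mono mult_mono) auto
    also have "\<dots> \<le> (d powr - 3 * ?J (x - y) powr - 2) * norm (F y)"
      using p2[of y] by (intro mult_right_mono) (auto simp: mult.commute)
    finally show "norm (H k y) \<le> d powr - 3 * (?J (x - y) powr - 2 * norm (F y))"
      by (simp add: mult.assoc)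
  qed measurable
  have eq: "(LINT y|lborel. cliff (axis k 1) (G k y)) = - (LINT y|lborel. cliff (axis k 1) (H k y))" for k
  proof -
    have "(LINT y|lborel. G k y) = - (LINT y|lborel. H k y)"
      using weak kernel_test_test_fun[OF d(1) R, of x k]
      unfolding weak_dirac_eq_def G_def H_def test_kernel_gradient_cliff[OF d(1) R, symmetric] by blast
    then show ?thesis
      using integral_bounded_linear[OF cliff.bounded_linear_right intG, of "axis k 1" k]
        integral_bounded_linear[OF cliff.bounded_linear_right intH, of "axis k 1" k]
      by (simp add: cliff.minus_right)
  qed
  have sumG: "(\<Sum>k\<in>UNIV. cliff (axis k 1) (G k y))
      = - ((3 * ?q y + 2 * ((norm (x - y))\<^sup>2 * ?q' y)) *\<^sub>R \<phi> y)" for y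
  proof -
    have "(\<Sum>k\<in>UNIV. cliff (axis k 1) (G k y))
      = - (?q y *\<^sub>R (\<Sum>k\<in>UNIV. cliff (axis k 1) (cliff (axis k 1) (\<phi> y)))
        + (2 * ?q' y) *\<^sub>R (\<Sum>k\<in>UNIV. ((x - y) $ k) *\<^sub>R cliff (axis k 1) (cliff (x - y) (\<phi> y))))"
      by (simp add: G_def cliff.minus_right cliff.add_right cliff.diff_right cliff.scaleR_right
          sum_negf sum.distrib sum_subtractf scaleR_sum_right)
    also have "\<dots> = - ((3 * ?q y + 2 * ((norm (x - y))\<^sup>2 * ?q' y)) *\<^sub>R \<phi> y)"
      unfolding cliff_axis_sum cliff_axis_square_sum unfolding cliff_cliff_self scaleR_scaleR scaleR_left_distrib
      by (simp only: mult_ac)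
    finally show ?thesis .
  qed
  have sumH: "(\<Sum>k\<in>UNIV. cliff (axis k 1) (H k y)) = ?q y *\<^sub>R icliff (x - y) (F y)" for y
  proof -
    have "(\<Sum>k\<in>UNIV. cliff (axis k 1) (H k y))
        = ?q y *\<^sub>R (\<Sum>k\<in>UNIV. ((x - y) $ k) *\<^sub>R cliff (axis k 1) (\<i> *s F y))"
      by (simp add: H_def kernel_test_def cliff.scaleR_right scaleR_sum_right mult.commute)
    then show ?thesis
      unfolding cliff_axis_sum by (simp add: cliff_imult)
  qed
  have "(\<Sum>k\<in>UNIV. LINT y|lborel. cliff (axis k 1) (G k y)) = (LINT y|lborel. (\<Sum>k\<in>UNIV. cliff (axis k 1) (G k y)))"
    by (intro Bochner_Integration.integral_sum[symmetric] integrable_bounded_linear[OF cliff.bounded_linear_right intG])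
  moreover have "(\<Sum>k\<in>UNIV. LINT y|lborel. cliff (axis k 1) (H k y)) = (LINT y|lborel. (\<Sum>k\<in>UNIV. cliff (axis k 1) (H k y)))"
    by (intro Bochner_Integration.integral_sum[symmetric] integrable_bounded_linear[OF cliff.bounded_linear_right intH])
  ultimately show ?thesis
    unfolding sumG sumH eq by (simp add: sum_negf)
qed

text \<open>
  The integral kernel of \<open>4\<pi> (\<sigma>\<cdot>D)\<^sup>-\<^sup>1\<close>, regularised at distance \<open>d\<close>. The value \<open>d = 0\<close> is admitted
  and gives \<open>i\<sigma>\<cdot>z |z|\<^sup>-\<^sup>3\<close>, with value \<open>0\<close> at the origin.
\<close>

definition dirac_kernel :: "real \<Rightarrow> real^3 \<Rightarrow> complex^2 \<Rightarrow> complex^2" where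
  "dirac_kernel d z \<psi> = ((norm z)\<^sup>2 + d\<^sup>2) powr - (3 / 2) *\<^sub>R icliff z \<psi>"

text \<open>
  Let \<open>R \<rightarrow> \<infinity>\<close> in the preceding identity. Both integrands are dominated by \<open>\<langle>x - y\<rangle>\<^sup>-\<^sup>2\<close> times a
  square-integrable function.
\<close>

lemma weak_dirac_regularized_identity:
  assumes [measurable]: "\<phi> \<in> borel_measurable borel" "F \<in> borel_measurable borel"
    and L2: "integrable lborel (\<lambda>y. (norm (\<phi> y))\<^sup>2)" "integrable lborel (\<lambda>y. (norm (F y))\<^sup>2)"
    and weak: "weak_dirac_eq \<phi> F" and d: "0 < d" "d \<le> 1"
  shows "(LINT y|lborel. (3 * d\<^sup>2 * ((norm (x - y))\<^sup>2 + d\<^sup>2) powr - (5 / 2)) *\<^sub>R \<phi> y)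
      = (LINT y|lborel. dirac_kernel d (x - y) (F y))"
proof -
  let ?R = "\<lambda>n. real (Suc n)"
  let ?p = "\<lambda>y. ((norm (x - y))\<^sup>2 + d\<^sup>2) powr - (3 / 2)"
  let ?e = "\<lambda>n y. 3 * reg_profile d (?R n) ((norm (x - y))\<^sup>2) + 2 * ((norm (x - y))\<^sup>2 * reg_profile' d (?R n) ((norm (x - y))\<^sup>2))"
  let ?J = japanese_bracket
  obtain K where K: "K \<ge> 0" "\<And>R s. s \<ge> 0 \<Longrightarrow> \<bar>s * reg_profile' d R s\<bar> \<le> K * (s + d\<^sup>2) powr - (3 / 2)"
    using reg_profile'_bound d by blast
  have p1: "?p y \<le> d powr - 3 * ?J (x - y) powr - 2" for y
    using reg_weight_bound[OF d, of 1 "x - y"] jb_ge_1[of "x - y"] by simp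
  have p2: "?p y * norm (x - y) \<le> d powr - 3 * ?J (x - y) powr - 2" for y
    using reg_weight_bound[OF d, of "norm (x - y)" "x - y"] norm_le_jb[of "x - y"] by simp
  have to0: "(\<lambda>n. s / (?R n)\<^sup>2) \<longlonglongrightarrow> 0" for s :: real
    by real_asymp
  have lim_cut: "(\<lambda>n. cutoff (s / (?R n)\<^sup>2)) \<longlonglongrightarrow> 1" for s
    using isCont_tendsto_compose[OF _ to0, of cutoff s] cutoff_cont(1)[of UNIV] cutoff_0
    by (simp add: continuous_on_eq_continuous_at)
  have lim_cut': "(\<lambda>n. cutoff' (s / (?R n)\<^sup>2)) \<longlonglongrightarrow> cutoff' 0" for s
    using isCont_tendsto_compose[OF _ to0, of cutoff' s] cutoff_cont(2)[of UNIV]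
    by (simp add: continuous_on_eq_continuous_at)
  have limq: "(\<lambda>n. reg_profile d (?R n) s) \<longlonglongrightarrow> (s + d\<^sup>2) powr - (3 / 2)" for s
    unfolding reg_profile_def using tendsto_mult[OF tendsto_const lim_cut[of s]] by simp
  have limq': "(\<lambda>n. s * reg_profile' d (?R n) s) \<longlonglongrightarrow> - (3 / 2) * (s * (s + d\<^sup>2) powr - (5 / 2))" for s
  proof -
    have "(\<lambda>n. - (3 / 2) * (s * (s + d\<^sup>2) powr - (5 / 2)) * cutoff (s / (?R n)\<^sup>2)
        + (s + d\<^sup>2) powr - (3 / 2) * (cutoff' (s / (?R n)\<^sup>2) * (s / (?R n)\<^sup>2)))
      \<longlonglongrightarrow> - (3 / 2) * (s * (s + d\<^sup>2) powr - (5 / 2)) * 1 + (s + d\<^sup>2) powr - (3 / 2) * (cutoff' 0 * 0)"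
      by (intro tendsto_intros lim_cut lim_cut' to0)
    then show ?thesis
      by (simp add: reg_profile'_def algebra_simps)
  qed
  have lhs_alg: "3 * (s + d\<^sup>2) powr - (3 / 2) + 2 * (- (3 / 2) * (s * (s + d\<^sup>2) powr - (5 / 2)))
      = 3 * d\<^sup>2 * (s + d\<^sup>2) powr - (5 / 2)" if "s \<ge> 0" for s
  proof -
    have p: "s + d\<^sup>2 > 0" using that zero_less_power[OF d(1), of 2] by linarith
    have "(s + d\<^sup>2) powr - (3 / 2) = (s + d\<^sup>2) powr - (5 / 2) * (s + d\<^sup>2) powr 1"
      unfolding powr_add[symmetric] by simp
    then have "(s + d\<^sup>2) powr - (3 / 2) = (s + d\<^sup>2) powr - (5 / 2) * (s + d\<^sup>2)" using p by simp
    then show ?thesis by (simp add: algebra_simps)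
  qed
  have "(\<lambda>n. LINT y|lborel. ?e n y *\<^sub>R \<phi> y)
      \<longlonglongrightarrow> (LINT y|lborel. (3 * d\<^sup>2 * ((norm (x - y))\<^sup>2 + d\<^sup>2) powr - (5 / 2)) *\<^sub>R \<phi> y)"
  proof (rule integral_dominated_convergence[where w = "\<lambda>y. ((3 + 2 * K) * d powr - 3) * (?J (x - y) powr - 2 * norm (\<phi> y))"])
    show "integrable lborel (\<lambda>y. ((3 + 2 * K) * d powr - 3) * (?J (x - y) powr - 2 * norm (\<phi> y)))"
      using K by (intro integrable_weighted[OF assms(1) _ L2(1)]) (auto simp: abs_mult)
    show "AE y in lborel. (\<lambda>n. ?e n y *\<^sub>R \<phi> y)
        \<longlonglongrightarrow> (3 * d\<^sup>2 * ((norm (x - y))\<^sup>2 + d\<^sup>2) powr - (5 / 2)) *\<^sub>R \<phi> y"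
      unfolding lhs_alg[OF zero_le_power2, symmetric]
      by (intro AE_I2 tendsto_intros limq limq')
    show "AE y in lborel. norm (?e n y *\<^sub>R \<phi> y)
        \<le> ((3 + 2 * K) * d powr - 3) * (?J (x - y) powr - 2 * norm (\<phi> y))" for n
    proof (rule AE_I2)
      fix y
      have "\<bar>?e n y\<bar>
          \<le> (3 + 2 * K) * ?p y"
        using K(2)[OF zero_le_power2, of "norm (x - y)" "?R n"]
          reg_profile_bounds[OF zero_le_power2, of d "?R n" "norm (x - y)"]
        unfolding distrib_right abs_le_iff by (intro conjI) linarith+
      also have "\<dots> \<le> (3 + 2 * K) * (d powr - 3 * ?J (x - y) powr - 2)"
        using K by (intro mult_left_mono p1) auto
      finally have c: "\<bar>?e n y\<bar>
          \<le> (3 + 2 * K) * (d powr - 3 * ?J (x - y) powr - 2)" .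
      show "norm (?e n y *\<^sub>R \<phi> y)
        \<le> ((3 + 2 * K) * d powr - 3) * (?J (x - y) powr - 2 * norm (\<phi> y))"
        using mult_right_mono[OF c norm_ge_zero[of "\<phi> y"]] by (simp add: mult.assoc)
    qed
  qed measurable
  moreover have "(\<lambda>n. LINT y|lborel. reg_profile d (?R n) ((norm (x - y))\<^sup>2) *\<^sub>R icliff (x - y) (F y))
      \<longlonglongrightarrow> (LINT y|lborel. dirac_kernel d (x - y) (F y))"
  proof (rule integral_dominated_convergence[where w = "\<lambda>y. d powr - 3 * (?J (x - y) powr - 2 * norm (F y))"])
    show "integrable lborel (\<lambda>y. d powr - 3 * (?J (x - y) powr - 2 * norm (F y)))"
      by (intro integrable_weighted[OF assms(2) _ L2(2)]) (auto simp: abs_mult)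
    show "AE y in lborel. (\<lambda>n. reg_profile d (?R n) ((norm (x - y))\<^sup>2) *\<^sub>R icliff (x - y) (F y)) \<longlonglongrightarrow> dirac_kernel d (x - y) (F y)"
      unfolding dirac_kernel_def by (intro AE_I2 tendsto_intros limq)
    show "AE y in lborel. norm (reg_profile d (?R n) ((norm (x - y))\<^sup>2) *\<^sub>R icliff (x - y) (F y))
        \<le> d powr - 3 * (?J (x - y) powr - 2 * norm (F y))" for n
    proof (rule AE_I2)
      fix y
      have "norm (reg_profile d (?R n) ((norm (x - y))\<^sup>2) *\<^sub>R icliff (x - y) (F y)) \<le> ?p y * (norm (x - y) * norm (F y))"
        unfolding norm_scaleR norm_icliff using reg_profile_bounds[OF zero_le_power2, of d "?R n" "norm (x - y)"]
        by (intro mult_right_mono) auto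
      also have "\<dots> \<le> (d powr - 3 * ?J (x - y) powr - 2) * norm (F y)"
        unfolding mult.assoc[symmetric] by (rule mult_right_mono[OF p2[unfolded mult.assoc[symmetric]]]) simp
      finally show "norm (reg_profile d (?R n) ((norm (x - y))\<^sup>2) *\<^sub>R icliff (x - y) (F y))
        \<le> d powr - 3 * (?J (x - y) powr - 2 * norm (F y))"
        by (simp add: mult.assoc)
    qed
  qed (unfold dirac_kernel_def, measurable)
  ultimately show ?thesis
    unfolding weak_dirac_cutoff_identity[OF assms(1,2) L2 weak d, of "?R _", OF of_nat_0_less_iff[THEN iffD2, OF zero_less_Suc]]
    by (rule LIMSEQ_unique)
qed

section \<open>The potential of a square-integrable spinor\<close>

lemma norm_dirac_kernel: "norm (dirac_kernel d z \<psi>) \<le> riesz z * norm \<psi>"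
proof (cases "z = 0")
  case False
  have "((norm z)\<^sup>2 + d\<^sup>2) powr - (3 / 2) \<le> ((norm z)\<^sup>2) powr - (3 / 2)"
    using False by (intro powr_mono2') auto
  also have "\<dots> = norm z powr - 3"
    using False by (simp add: powr_powr flip: powr_numeral)
  finally have "((norm z)\<^sup>2 + d\<^sup>2) powr - (3 / 2) * norm z \<le> norm z powr - 3 * norm z powr 1"
    by (simp add: mult_right_mono)
  also have "\<dots> = riesz z"
    unfolding powr_add[symmetric] using False by (simp add: riesz_def powr_minus_divide powr_numeral)
  finally have "((norm z)\<^sup>2 + d\<^sup>2) powr - (3 / 2) * norm z * norm \<psi> \<le> riesz z * norm \<psi>"
    by (rule mult_right_mono) simp
  then show ?thesis
    by (simp add: dirac_kernel_def norm_icliff mult.assoc)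
qed (simp add: dirac_kernel_def icliff.zero_left)

lemma dirac_kernel_tendsto:
  assumes "d \<longlonglongrightarrow> 0"
  shows "(\<lambda>n. dirac_kernel (d n) z \<psi>) \<longlonglongrightarrow> dirac_kernel 0 z \<psi>"
proof (cases "z = 0")
  case False
  have "(\<lambda>n. ((norm z)\<^sup>2 + (d n)\<^sup>2) powr - (3 / 2) *\<^sub>R icliff z \<psi>)
      \<longlonglongrightarrow> ((norm z)\<^sup>2 + 0\<^sup>2) powr - (3 / 2) *\<^sub>R icliff z \<psi>"
    using False by (intro tendsto_intros assms) auto
  then show ?thesis by (simp add: dirac_kernel_def)
qed (simp add: dirac_kernel_def icliff.zero_left)

lemma dirac_kernel_measurable [measurable]:
  assumes [measurable]: "f \<in> borel_measurable M" "g \<in> borel_measurable M"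
  shows "(\<lambda>x. dirac_kernel d (f x) (g x)) \<in> borel_measurable M"
  unfolding dirac_kernel_def by measurable

lemma indicator_le_jb:
  assumes "bounded B" "t \<ge> 0"
  shows "\<exists>c\<ge>0. \<forall>x. indicator B x \<le> c * japanese_bracket x powr - t"
proof -
  obtain r where r: "\<And>x. x \<in> B \<Longrightarrow> norm x \<le> r" "r > 0"
    using assms bounded_pos by blast
  have "indicator B x \<le> (1 + r) powr t * japanese_bracket x powr - t" for x
  proof (cases "x \<in> B")
    case True
    have "japanese_bracket x powr t \<le> (1 + r) powr t"
      using True r jb_le[of x] assms by (intro powr_mono2) (auto intro: order.trans)
    then show ?thesis
      using True by (simp add: powr_minus_divide field_simps)
  qed simp
  then show ?thesis by (intro exI[of _ "(1 + r) powr t"]) simp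
qed

text \<open>
  By Tonelli it suffices to integrate the kernel over \<open>x\<close> in \<open>B\<close> first; the result is \<open>O(\<langle>y\<rangle>\<^sup>-\<^sup>2)\<close>,
  which is square integrable.
\<close>

lemma nn_integral_potential_finite:
  fixes F :: "real^3 \<Rightarrow> complex^2"
  assumes [measurable]: "F \<in> borel_measurable borel" "B \<in> sets borel"
    and L2: "integrable lborel (\<lambda>y. (norm (F y))\<^sup>2)" and B: "bounded B"
  shows "(\<integral>\<^sup>+x. indicator B x * (\<integral>\<^sup>+y. ennreal (riesz (x - y) * norm (F y)) \<partial>lborel) \<partial>lborel) < \<infinity>"
proof -
  let ?J = japanese_bracket
  obtain c where c: "c \<ge> 0" "\<And>x. indicator B x \<le> c * ?J x powr - 4"
    using indicator_le_jb[OF B, of 4] by auto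
  obtain C where C: "C > 0" "\<And>x. (\<integral>\<^sup>+y. ennreal (riesz (x - y) * ?J y powr - 4) \<partial>lborel) \<le> ennreal (C * ?J x powr - 2)"
    using riesz_potential_jb[of 2 4] by auto
  have "(\<integral>\<^sup>+x. indicator B x * (\<integral>\<^sup>+y. ennreal (riesz (x - y) * norm (F y)) \<partial>lborel) \<partial>lborel)
     = (\<integral>\<^sup>+x. (\<integral>\<^sup>+y. indicator B x * ennreal (riesz (x - y) * norm (F y)) \<partial>lborel) \<partial>lborel)"
    by (simp add: nn_integral_cmult)
  also have "\<dots> = (\<integral>\<^sup>+y. (\<integral>\<^sup>+x. indicator B x * ennreal (riesz (x - y) * norm (F y)) \<partial>lborel) \<partial>lborel)"
    by (rule lborel_pair.Fubini'[symmetric]) measurable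
  also have "\<dots> \<le> (\<integral>\<^sup>+y. ennreal ((c * C) * (?J y powr - 2 * norm (F y))) \<partial>lborel)"
  proof (intro nn_integral_mono)
    fix y
    have "(\<integral>\<^sup>+x. indicator B x * ennreal (riesz (x - y) * norm (F y)) \<partial>lborel)
        \<le> (\<integral>\<^sup>+x. ennreal (c * norm (F y)) * ennreal (riesz (y - x) * ?J x powr - 4) \<partial>lborel)"
    proof (intro nn_integral_mono)
      fix x
      have "indicator B x * (riesz (x - y) * norm (F y)) \<le> (c * ?J x powr - 4) * (riesz (x - y) * norm (F y))"
        by (intro mult_right_mono c) auto
      then have "ennreal (indicator B x * (riesz (x - y) * norm (F y))) \<le> ennreal ((c * norm (F y)) * (riesz (y - x) * ?J x powr - 4))"
        by (intro ennreal_leI) (simp add: mult_ac riesz_minus_commute)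
      then show "indicator B x * ennreal (riesz (x - y) * norm (F y))
          \<le> ennreal (c * norm (F y)) * ennreal (riesz (y - x) * ?J x powr - 4)"
        using c by (simp add: ennreal_mult' ennreal_indicator)
    qed
    also have "\<dots> \<le> ennreal (c * norm (F y)) * ennreal (C * ?J y powr - 2)"
      by (subst nn_integral_cmult) (auto intro!: mult_left_mono C)
    also have "\<dots> = ennreal ((c * C) * (?J y powr - 2 * norm (F y)))"
      using c C by (simp add: ennreal_mult'[symmetric] mult_ac)
    finally show "(\<integral>\<^sup>+x. indicator B x * ennreal (riesz (x - y) * norm (F y)) \<partial>lborel)
        \<le> ennreal ((c * C) * (?J y powr - 2 * norm (F y)))" .
  qed
  also have "\<dots> < \<infinity>"
  proof -
    have "integrable lborel (\<lambda>y. (c * C) * (?J y powr - 2 * norm (F y)))"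
      using c C by (intro integrable_weighted[OF assms(1) _ L2, of _ "c * C" 0])
         (auto simp: japanese_bracket_def abs_mult)
    from integrableD(2)[OF this] c C show ?thesis
      by (simp add: abs_mult top.not_eq_extremum)
  qed
  finally show ?thesis .
qed

text \<open>
  The inverse of \<open>\<sigma>\<cdot>D\<close> applied to \<open>F\<close>, without the factor \<open>1/(4\<pi>)\<close>.
\<close>

definition spin_potential :: "(real^3 \<Rightarrow> complex^2) \<Rightarrow> real^3 \<Rightarrow> complex^2" where
  "spin_potential F x = (LINT y|lborel. dirac_kernel 0 (x - y) (F y))"

text \<open>
  The kernels with \<open>d > 0\<close> are all dominated by the one with \<open>d = 0\<close>, whose potential is finite
  almost everywhere on \<open>B\<close> and integrable there. Dominated convergence applies to the inner
  integral and then to the outer one.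
\<close>

lemma
  fixes F :: "real^3 \<Rightarrow> complex^2"
  assumes [measurable]: "F \<in> borel_measurable borel" "B \<in> sets borel"
    and L2: "integrable lborel (\<lambda>y. (norm (F y))\<^sup>2)" and B: "bounded B"
  shows regularized_potential_tendsto:
      "d \<longlonglongrightarrow> 0 \<Longrightarrow> (\<lambda>n. LINT x|lborel. indicator B x *\<^sub>R (LINT y|lborel. dirac_kernel (d n) (x - y) (F y)))
         \<longlonglongrightarrow> (LINT x|lborel. indicator B x *\<^sub>R spin_potential F x)" (is "_ \<Longrightarrow> ?lim")
    and spin_potential_locally_integrable: "integrable lborel (\<lambda>x. indicator B x *\<^sub>R spin_potential F x)" (is ?int)
proof -
  define U where "U x = (\<integral>\<^sup>+y. ennreal (riesz (x - y) * norm (F y)) \<partial>lborel)" for x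
  define u where "u x = (LINT y|lborel. riesz (x - y) * norm (F y))" for x
  have [measurable]: "U \<in> borel_measurable borel" "u \<in> borel_measurable borel"
    unfolding U_def[abs_def] u_def[abs_def] by measurable
  have fin: "(\<integral>\<^sup>+x. indicator B x * U x \<partial>lborel) < \<infinity>"
    unfolding U_def by (rule nn_integral_potential_finite[OF assms])
  then have AE_fin: "AE x in lborel. x \<in> B \<longrightarrow> U x < \<infinity>"
    using nn_integral_PInf_AE[of "\<lambda>x. indicator B x * U x" lborel]
    by (auto simp: less_top indicator_def elim!: eventually_mono)
  have inner_int: "integrable lborel (\<lambda>y. riesz (x - y) * norm (F y))" if "U x < \<infinity>" for x
    using that unfolding U_def by (intro integrableI_bounded) (auto simp: abs_mult)
  have U_eq: "U x = ennreal (u x)" if "U x < \<infinity>" for x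
    unfolding U_def u_def using inner_int[OF that] by (intro nn_integral_eq_integral) auto
  have int_u: "integrable lborel (\<lambda>x. indicator B x * u x)"
  proof (rule integrableI_bounded)
    have u0: "u x \<ge> 0" for x unfolding u_def by (intro integral_nonneg_AE) auto
    have "(\<integral>\<^sup>+x. ennreal (norm (indicator B x * u x)) \<partial>lborel) \<le> (\<integral>\<^sup>+x. indicator B x * U x \<partial>lborel)"
      by (intro nn_integral_mono_AE, use AE_fin in eventually_elim)
         (auto simp: indicator_def U_eq u0 abs_mult)
    then show "(\<integral>\<^sup>+x. ennreal (norm (indicator B x * u x)) \<partial>lborel) < \<infinity>"
      using fin by (rule order.strict_trans1)
  qed measurable
  have bound: "norm (indicator B x *\<^sub>R (LINT y|lborel. dirac_kernel d (x - y) (F y))) \<le> indicator B x * u x"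
    if "x \<in> B \<longrightarrow> U x < \<infinity>" for d x
  proof (cases "x \<in> B")
    case True
    then have "norm (LINT y|lborel. dirac_kernel d (x - y) (F y)) \<le> u x"
      unfolding u_def using that inner_int norm_dirac_kernel
      by (intro Bochner_Integration.integral_norm_bound_integral Bochner_Integration.integrable_bound[OF inner_int[of x]])
         (auto intro!: AE_I2 simp: abs_mult)
    then show ?thesis using True by simp
  qed simp
  show ?int
    unfolding spin_potential_def
  proof (rule Bochner_Integration.integrable_bound[OF int_u])
    show "AE x in lborel. norm (indicator B x *\<^sub>R (LINT y|lborel. dirac_kernel 0 (x - y) (F y))) \<le> norm (indicator B x * u x)"
      using AE_fin by eventually_elim (rule order.trans[OF bound], simp_all only: real_norm_def abs_ge_self)
  qed measurable
  show ?lim if d: "d \<longlonglongrightarrow> 0"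
    unfolding spin_potential_def
  proof (rule integral_dominated_convergence[OF _ _ int_u])
    show "AE x in lborel. norm (indicator B x *\<^sub>R (LINT y|lborel. dirac_kernel (d n) (x - y) (F y))) \<le> indicator B x * u x" for n
      using AE_fin by eventually_elim (rule bound)
    show "AE x in lborel. (\<lambda>n. indicator B x *\<^sub>R (LINT y|lborel. dirac_kernel (d n) (x - y) (F y)))
        \<longlonglongrightarrow> indicator B x *\<^sub>R (LINT y|lborel. dirac_kernel 0 (x - y) (F y))"
      using AE_fin
    proof eventually_elim
      case (elim x)
      show ?case
      proof (cases "x \<in> B")
        case True
        have "(\<lambda>n. LINT y|lborel. dirac_kernel (d n) (x - y) (F y)) \<longlonglongrightarrow> (LINT y|lborel. dirac_kernel 0 (x - y) (F y))"
          by (rule integral_dominated_convergence[where w = "\<lambda>y. riesz (x - y) * norm (F y)"])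
             (use inner_int elim True norm_dirac_kernel dirac_kernel_tendsto[OF d] in auto)
        then show ?thesis by (intro tendsto_intros)
      qed simp
    qed
  qed measurable
qed

section \<open>Mollification and the integral representation\<close>

text \<open>
  Boxes form an intersection-stable generator of the Borel sets, so that equality of integrals
  extends from boxes to all Borel subsets of a fixed box.
\<close>

lemma AE_eq_of_box_integrals:
  fixes f g :: "'a::euclidean_space \<Rightarrow> 'b::{banach, second_countable_topology}"
  assumes int: "\<And>a b. integrable lborel (\<lambda>x. indicator (box a b) x *\<^sub>R f x)"
      "\<And>a b. integrable lborel (\<lambda>x. indicator (box a b) x *\<^sub>R g x)"
    and eq: "\<And>a b. (LINT x|lborel. indicator (box a b) x *\<^sub>R f x) = (LINT x|lborel. indicator (box a b) x *\<^sub>R g x)"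
  shows "AE x in lborel. f x = g x"
proof -
  let ?Q = "\<lambda>n::nat. box (- (real n *\<^sub>R One)) (real n *\<^sub>R One) :: 'a set"
  let ?E = "range (\<lambda>(a, b). box a b :: 'a set)"
  have sets: "sets lborel = sigma_sets UNIV ?E"
    by (simp add: borel_eq_box)
  have stable: "Int_stable ?E"
    by (auto simp: Int_stable_def box_Int_box)
  have "AE x in lborel. \<forall>n. indicator (?Q n) x *\<^sub>R (f x - g x) = 0"
    unfolding AE_all_countable
  proof
    fix n
    let ?h = "\<lambda>x. indicator (?Q n) x *\<^sub>R (f x - g x)"
    have int_h: "integrable lborel ?h"
      using Bochner_Integration.integrable_diff[OF int(1) int(2)] by (simp add: scaleR_diff_right)
    have zero: "(LINT x|lborel. indicator (box a b) x *\<^sub>R (f x - g x)) = 0" for a b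
      using Bochner_Integration.integral_diff[OF int(1) int(2), of a b a b] eq[of a b]
      by (simp add: scaleR_diff_right)
    show "AE x in lborel. ?h x = 0"
    proof (rule sigma_finite_measure.density_zero[OF sigma_finite_lborel int_h])
      fix A :: "'a set" assume "A \<in> sets lborel"
      then have "A \<in> sigma_sets UNIV ?E" unfolding sets .
      from stable subset_UNIV[of ?E, folded Pow_UNIV] this
      show "set_lebesgue_integral lborel A ?h = 0"
      proof (induction rule: sigma_sets_induct_disjoint)
        case (basic A)
        then obtain a b where A: "A = box a b" by auto
        obtain a' b' where Q: "A \<inter> ?Q n = box a' b'"
          unfolding A box_Int_box by blast
        have "indicator A x *\<^sub>R ?h x = indicator (box a' b') x *\<^sub>R (f x - g x)" for x
          unfolding Q[symmetric] by (simp add: indicator_inter_arith)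
        then show ?case
          unfolding set_lebesgue_integral_def by (simp add: zero del: scaleR_scaleR)
      next
        case (compl A)
        then have A: "A \<in> sets lborel" unfolding sets by simp
        have "(LINT x|lborel. indicator (UNIV - A) x *\<^sub>R ?h x) = (LINT x|lborel. ?h x - indicator A x *\<^sub>R ?h x)"
          by (intro Bochner_Integration.integral_cong) (auto simp: indicator_def)
        also have "\<dots> = (LINT x|lborel. ?h x) - (LINT x|lborel. indicator A x *\<^sub>R ?h x)"
          by (rule Bochner_Integration.integral_diff[OF int_h integrable_mult_indicator[OF A int_h]])
        also have "\<dots> = 0"
          using compl unfolding set_lebesgue_integral_def zero by simp
        finally show ?case
          unfolding set_lebesgue_integral_def .
      next
        case (union B)
        then have B: "\<And>i. B i \<in> sets lborel" unfolding sets by auto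
        have "set_integrable lborel (\<Union>i. B i) ?h"
          unfolding set_integrable_def using B by (intro integrable_mult_indicator int_h) auto
        then have "set_lebesgue_integral lborel (\<Union>i. B i) ?h = (\<Sum>i. set_lebesgue_integral lborel (B i) ?h)"
          using B union(1) by (intro lebesgue_integral_countable_add) (auto simp: disjoint_family_on_def)
        then show ?case using union by simp
      qed (auto simp: set_lebesgue_integral_def)
    qed
  qed
  then show ?thesis
  proof eventually_elim
    case (elim x)
    have "x \<in> (\<Union>n. ?Q n)" unfolding UN_box_eq_UNIV by simp
    then obtain n where "x \<in> ?Q n" by blast
    with elim have "f x - g x = 0" by (metis indicator_simps(1) scaleR_one)
    then show ?case by simp
  qed
qed

text \<open>
  The divergence of \<open>z (|z|\<^sup>2 + d\<^sup>2)\<^sup>-\<^sup>3\<^sup>/\<^sup>2 / (4\<pi>)\<close>: an approximate identity of width \<open>d\<close>, and the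
  rescaling of \<open>3/(4\<pi>) \<langle>w\<rangle>\<^sup>-\<^sup>5\<close>.
\<close>

definition mollifier :: "real \<Rightarrow> real^3 \<Rightarrow> real" where
  "mollifier d z = 3 / (4 * pi) * (d\<^sup>2 * ((norm z)\<^sup>2 + d\<^sup>2) powr - (5 / 2))"

lemma mollifier_measurable [measurable]: "mollifier d \<in> borel_measurable borel"
  unfolding mollifier_def[abs_def] by measurable

lemma mollifier_nonneg [simp]: "mollifier d z \<ge> 0"
  by (simp add: mollifier_def)

lemma mollifier_scale:
  assumes "d > 0"
  shows "d ^ 3 * mollifier d (d *\<^sub>R w) = 3 / (4 * pi) * japanese_bracket w powr - 5"
proof -
  have J: "(japanese_bracket w)\<^sup>2 = 1 + (norm w)\<^sup>2" by (simp add: japanese_bracket_def)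
  have "(norm (d *\<^sub>R w))\<^sup>2 + d\<^sup>2 = (d * japanese_bracket w)\<^sup>2"
    unfolding power_mult_distrib J by (simp add: power_mult_distrib algebra_simps)
  then have "((norm (d *\<^sub>R w))\<^sup>2 + d\<^sup>2) powr - (5 / 2) = (d * japanese_bracket w) powr - 5"
    using assms by (simp add: powr_powr flip: powr_numeral)
  also have "\<dots> = d powr - 5 * japanese_bracket w powr - 5"
    using assms by (simp add: powr_mult)
  also have "d powr - 5 = 1 / d ^ 5"
    using assms by (simp add: powr_minus_divide powr_numeral)
  finally show ?thesis
    using assms by (simp add: mollifier_def power2_eq_square eval_nat_numeral)
qed

text \<open>
  In polar coordinates the integrand \<open>3 r\<^sup>2 (1 + r\<^sup>2)\<^sup>-\<^sup>5\<^sup>/\<^sup>2\<close> has the primitive \<open>r\<^sup>3 (1 + r\<^sup>2)\<^sup>-\<^sup>3\<^sup>/\<^sup>2\<close>.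
\<close>

lemma mollifier_mass: "(LINT w|lborel. 3 / (4 * pi) * japanese_bracket w powr - 5) = 1"
proof -
  have "(\<integral>\<^sup>+w. ennreal (3 / (4 * pi) * japanese_bracket w powr - 5) \<partial>lborel)
      = (\<integral>\<^sup>+w. ennreal (3 / (4 * pi) * (sqrt (1 + (norm (w::real^3))\<^sup>2)) powr - 5) \<partial>lborel)"
    by (simp add: japanese_bracket_def)
  also have "\<dots> = (\<integral>\<^sup>+r. ennreal (4 * pi * r\<^sup>2) * indicator {0..} r * ennreal (3 / (4 * pi) * sqrt (1 + r\<^sup>2) powr - 5) \<partial>lborel)"
    by (rule nn_integral_radial) measurable
  also have "\<dots> = (\<integral>\<^sup>+r. ennreal (3 * r\<^sup>2 * (1 + r\<^sup>2) powr - (5 / 2)) * indicator {0..} r \<partial>lborel)"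
  proof (intro nn_integral_cong)
    fix r :: real
    have "sqrt (1 + r\<^sup>2) powr - 5 = (1 + r\<^sup>2) powr - (5 / 2)"
      by (simp add: powr_half_sqrt[symmetric] powr_powr add_pos_nonneg)
    then have "4 * pi * r\<^sup>2 * (3 / (4 * pi) * sqrt (1 + r\<^sup>2) powr - 5) = 3 * r\<^sup>2 * (1 + r\<^sup>2) powr - (5 / 2)"
      by simp
    then show "ennreal (4 * pi * r\<^sup>2) * indicator {0..} r * ennreal (3 / (4 * pi) * sqrt (1 + r\<^sup>2) powr - 5)
        = ennreal (3 * r\<^sup>2 * (1 + r\<^sup>2) powr - (5 / 2)) * indicator {0..} r"
      by (auto simp: indicator_def ennreal_mult'[symmetric])
  qed
  also have "\<dots> = ennreal (1 - 0 ^ 3 * (1 + 0\<^sup>2) powr - (3 / 2))"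
  proof (rule nn_integral_FTC_atLeast)
    fix r :: real
    have p: "1 + r\<^sup>2 > 0" by (simp add: add_pos_nonneg)
    have "(1 + r\<^sup>2) powr - (3 / 2) = (1 + r\<^sup>2) powr - (5 / 2) * (1 + r\<^sup>2) powr 1"
      unfolding powr_add[symmetric] by simp
    then have e: "(1 + r\<^sup>2) powr - (3 / 2) = (1 + r\<^sup>2) powr - (5 / 2) * (1 + r\<^sup>2)"
      using p by simp
    have sq: "((\<lambda>r. 1 + r\<^sup>2) has_real_derivative 2 * r) (at r)"
      by (auto intro!: derivative_eq_intros)
    have "((\<lambda>r. r ^ 3 * (1 + r\<^sup>2) powr - (3 / 2)) has_real_derivative
        (3 * r\<^sup>2 * (1 + r\<^sup>2) powr - (3 / 2) + - (3 / 2) * (1 + r\<^sup>2) powr (- (3 / 2) - 1) * (2 * r) * r ^ 3)) (at r)"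
      by (rule DERIV_mult[OF _ DERIV_chain2[OF has_real_derivative_powr[OF p] sq], THEN DERIV_cong])
         (auto intro!: derivative_eq_intros)
    then show "((\<lambda>r. r ^ 3 * (1 + r\<^sup>2) powr - (3 / 2)) has_real_derivative 3 * r\<^sup>2 * (1 + r\<^sup>2) powr - (5 / 2)) (at r)"
      by (rule DERIV_cong) (unfold e, simp add: algebra_simps power2_eq_square power3_eq_cube)
  next
    show "((\<lambda>r::real. r ^ 3 * (1 + r\<^sup>2) powr - (3 / 2)) \<longlongrightarrow> 1) at_top"
      by real_asymp
  qed auto
  also have "\<dots> = 1" by simp
  finally show ?thesis
    by (subst integral_eq_nn_integral) auto
qed

lemma mollifier_le:
  assumes "0 < d" "d \<le> 1"
  shows "mollifier d z \<le> d powr - 3 * japanese_bracket z powr - 2"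
proof -
  let ?p = "(norm z)\<^sup>2 + d\<^sup>2"
  have p: "?p > 0" using zero_less_power[OF assms(1), of 2] by (simp add: add_nonneg_pos)
  have "d\<^sup>2 * ?p powr - (5 / 2) \<le> ?p powr 1 * ?p powr - (5 / 2)"
    using p by (intro mult_right_mono) auto
  also have "\<dots> = ?p powr - (3 / 2)"
    unfolding powr_add[symmetric] by simp
  also have "\<dots> \<le> d powr - 3 * japanese_bracket z powr - 2"
    using reg_weight_bound[OF assms, of 1 z] jb_ge_1[of z] by simp
  finally have le: "d\<^sup>2 * ?p powr - (5 / 2) \<le> d powr - 3 * japanese_bracket z powr - 2" .
  have "mollifier d z \<le> 1 * (d\<^sup>2 * ?p powr - (5 / 2))"
    unfolding mollifier_def using pi_gt3 by (intro mult_right_mono) (auto simp: field_simps)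
  with le show ?thesis by simp
qed

lemma integral_lborel_scale:
  fixes f :: "real^3 \<Rightarrow> real"
  assumes [measurable]: "f \<in> borel_measurable borel" and "d > 0"
  shows "(LINT x|lborel. f x) = (LINT w|lborel. d ^ 3 * f (y + d *\<^sub>R w))"
proof -
  have "(LINT x|lborel. f x) = integral\<^sup>L (density (distr lborel borel (\<lambda>w. y + d *\<^sub>R w)) (\<lambda>_. ennreal (\<bar>d\<bar> ^ DIM(real^3)))) f"
    using assms by (intro arg_cong[where f = "\<lambda>M. integral\<^sup>L M f"] lborel_affine) simp
  also have "\<dots> = (LINT w|lborel. d ^ 3 * f (y + d *\<^sub>R w))"
    using assms by (subst integral_real_density) (simp_all add: integral_distr)
  finally show ?thesis .
qed

lemma integral_jb_diff:
  "(LINT y|lborel. japanese_bracket (x - y) powr - t) = (LINT y|lborel. japanese_bracket y powr - t)"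
  by (simp add: integral_eq_nn_integral nn_integral_lborel_reflect[of "\<lambda>z. ennreal (japanese_bracket z powr - t)"])

text \<open>
  Move the mollifier from \<open>\<phi>\<close> to the indicator function of \<open>B\<close> by Fubini. The mollified indicator
  function is the integral of \<open>1\<^sub>B(y + d w)\<close> against the fixed density \<open>3/(4\<pi>) \<langle>w\<rangle>\<^sup>-\<^sup>5\<close>, hence
  converges to \<open>1\<^sub>B(y)\<close> off the boundary.
\<close>

lemma mollified_integral_tendsto:
  fixes \<phi> :: "real^3 \<Rightarrow> complex^2"
  assumes [measurable]: "\<phi> \<in> borel_measurable borel" "B \<in> sets borel"
    and L2: "integrable lborel (\<lambda>y. (norm (\<phi> y))\<^sup>2)" and B: "bounded B"
    and fr: "AE y in lborel. y \<notin> frontier B"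
    and d: "\<And>n. 0 < d n" "\<And>n. d n \<le> 1" "d \<longlonglongrightarrow> 0"
  shows "(\<lambda>n. LINT x|lborel. indicator B x *\<^sub>R (LINT y|lborel. mollifier (d n) (x - y) *\<^sub>R \<phi> y))
      \<longlonglongrightarrow> (LINT y|lborel. indicator B y *\<^sub>R \<phi> y)"
proof -
  let ?J = japanese_bracket
  let ?\<eta> = "\<lambda>w. 3 / (4 * pi) * ?J w powr - 5"
  define \<psi> where "\<psi> n y = (LINT x|lborel. indicator B x * mollifier (d n) (x - y))" for n y
  have \<psi>_eq: "\<psi> n y = (LINT w|lborel. indicator B (y + d n *\<^sub>R w) * ?\<eta> w)" for n y
  proof -
    have "\<psi> n y = (LINT w|lborel. d n ^ 3 * (indicator B (y + d n *\<^sub>R w) * mollifier (d n) (y + d n *\<^sub>R w - y)))"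
      unfolding \<psi>_def using d(1) by (intro integral_lborel_scale) simp_all
    also have "\<dots> = (LINT w|lborel. indicator B (y + d n *\<^sub>R w) * (d n ^ 3 * mollifier (d n) (d n *\<^sub>R w)))"
      by (simp add: mult_ac)
    finally show ?thesis unfolding mollifier_scale[OF d(1)] .
  qed
  have [measurable]: "\<psi> n \<in> borel_measurable borel" for n
    unfolding \<psi>_def[abs_def] by measurable
  have "(LINT x|lborel. indicator B x *\<^sub>R (LINT y|lborel. mollifier (d n) (x - y) *\<^sub>R \<phi> y))
      = (LINT y|lborel. \<psi> n y *\<^sub>R \<phi> y)" for n
  proof -
    define f where "f x y = (indicator B x * mollifier (d n) (x - y)) *\<^sub>R \<phi> y" for x y
    have [measurable]: "(\<lambda>z. f (fst z) (snd z)) \<in> borel_measurable (lborel \<Otimes>\<^sub>M lborel)"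
      unfolding f_def by measurable
    define c where "c = d n powr - 3"
    have bound: "norm (f x y) \<le> indicator B x * (c * (?J (x - y) powr - 2 * norm (\<phi> y)))" for x y
    proof -
      have "mollifier (d n) (x - y) * norm (\<phi> y) \<le> c * ?J (x - y) powr - 2 * norm (\<phi> y)"
        unfolding c_def by (intro mult_right_mono mollifier_le d) auto
      then show ?thesis
        by (simp add: f_def indicator_def mult.assoc)
    qed
    have int_y: "integrable lborel (\<lambda>y. f x y)" for x
    proof (rule integrable_weighted[OF assms(1) _ L2])
      show "norm (f x y) \<le> c * (?J (x - y) powr - 2 * norm (\<phi> y))" for y
        using bound[of x y] by (auto simp: indicator_def c_def split: if_splits intro: order.trans)
    qed (unfold f_def, measurable)
    define K where "K = c * ((LINT y|lborel. ?J y powr - 4) + (LINT y|lborel. (norm (\<phi> y))\<^sup>2))"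
    have int_x: "integrable lborel (\<lambda>x. LINT y|lborel. norm (f x y))"
    proof (rule Bochner_Integration.integrable_bound)
      show "integrable lborel (\<lambda>x. K * indicator B x)"
        using emeasure_bounded_finite[OF B] by (intro integrable_mult_right integrable_real_indicator) auto
      show "AE x in lborel. norm (LINT y|lborel. norm (f x y)) \<le> norm (K * indicator B x)"
      proof (rule AE_I2)
        fix x
        show "norm (LINT y|lborel. norm (f x y)) \<le> norm (K * indicator B x)"
        proof (cases "x \<in> B")
          case True
          have "(LINT y|lborel. norm (f x y)) \<le> (LINT y|lborel. c * (?J (x - y) powr - 4 + (norm (\<phi> y))\<^sup>2))"
          proof (intro integral_mono)
            show "integrable lborel (\<lambda>y. norm (f x y))" using int_y by simp
            show "integrable lborel (\<lambda>y. c * (?J (x - y) powr - 4 + (norm (\<phi> y))\<^sup>2))"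
              by (intro integrable_mult_right Bochner_Integration.integrable_add integrable_jb_powr_diff L2) simp
            fix y
            let ?w = "?J (x - y) powr - 2"
            have "?w * norm (\<phi> y) \<le> ?w\<^sup>2 + (norm (\<phi> y))\<^sup>2"
              by (rule mult_le_sum_squares) simp_all
            also have "?w\<^sup>2 = ?J (x - y) powr - 4"
              by (simp add: power2_eq_square powr_add[symmetric])
            finally have "c * (?w * norm (\<phi> y)) \<le> c * (?J (x - y) powr - 4 + (norm (\<phi> y))\<^sup>2)"
              unfolding c_def by (intro mult_left_mono) auto
            then show "norm (f x y) \<le> c * (?J (x - y) powr - 4 + (norm (\<phi> y))\<^sup>2)"
              using bound[of x y] True by simp
          qed
          also have "\<dots> = K"
            unfolding K_def using integrable_jb_powr_diff[of 4 x] L2 by (simp add: integral_jb_diff)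
          finally have "(LINT y|lborel. norm (f x y)) \<le> K" .
          moreover have "0 \<le> (LINT y|lborel. norm (f x y))" by simp
          ultimately show ?thesis using True by simp
        qed (simp add: f_def)
      qed
    qed measurable
    have "integrable (lborel \<Otimes>\<^sub>M lborel) (\<lambda>(x, y). f x y)"
      by (rule lborel_pair.Fubini_integrable) (use int_x int_y in \<open>auto simp: split_beta'\<close>)
    then have "(LINT y|lborel. LINT x|lborel. f x y) = (LINT x|lborel. LINT y|lborel. f x y)"
      by (rule lborel_pair.Fubini_integral)
    moreover have "(LINT y|lborel. f x y) = indicator B x *\<^sub>R (LINT y|lborel. mollifier (d n) (x - y) *\<^sub>R \<phi> y)" for x
      by (cases "x \<in> B") (simp_all add: f_def)
    moreover have "(LINT x|lborel. f x y) = \<psi> n y *\<^sub>R \<phi> y" for y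
    proof -
      have "integrable lborel (\<lambda>x. indicator B x * mollifier (d n) (x - y))"
      proof (rule Bochner_Integration.integrable_bound)
        show "integrable lborel (\<lambda>x. c * indicator B x)"
          using emeasure_bounded_finite[OF B] by (intro integrable_mult_right integrable_real_indicator) auto
        have "mollifier (d n) z \<le> c" for z
        proof -
          have "mollifier (d n) z \<le> c * ?J z powr - 2"
            unfolding c_def by (rule mollifier_le[OF d(1,2)])
          also have "\<dots> \<le> c"
            using jb_powr_le_1[of 2 z] by (simp add: c_def mult_left_le)
          finally show ?thesis .
        qed
        then show "AE x in lborel. norm (indicator B x * mollifier (d n) (x - y)) \<le> norm (c * indicator B x)"
          by (auto simp: indicator_def c_def)
      qed measurable
      then show ?thesis
        unfolding f_def \<psi>_def by simp
    qed
    ultimately show ?thesis by simp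
  qed
  moreover have "(\<lambda>n. LINT y|lborel. \<psi> n y *\<^sub>R \<phi> y) \<longlonglongrightarrow> (LINT y|lborel. indicator B y *\<^sub>R \<phi> y)"
  proof -
    \<comment> \<open>Any exponent \<open>a\<close> in \<open>(3/2, 2)\<close> works: \<open>\<langle>y\<rangle>\<^sup>-\<^sup>a\<close> has to be square integrable and \<open>\<langle>w\<rangle>\<^sup>a\<^sup>-\<^sup>5\<close>
      integrable.\<close>
    define a :: real where "a = 7 / 4"
    obtain c where c: "c \<ge> 0" "\<And>x. indicator B x \<le> c * ?J x powr - a"
      using indicator_le_jb[OF B, of a] unfolding a_def by auto
    define K where "K = c * 2 powr a * (3 / (4 * pi)) * (LINT w|lborel. ?J w powr - (5 - a))"
    have \<psi>_bound: "\<bar>\<psi> n y\<bar> \<le> K * ?J y powr - a" for n y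
    proof -
      have "\<bar>\<psi> n y\<bar> \<le> (LINT w|lborel. (c * 2 powr a * (3 / (4 * pi)) * ?J y powr - a) * ?J w powr - (5 - a))"
        unfolding \<psi>_eq real_norm_def[symmetric]
      proof (rule Bochner_Integration.integral_norm_bound_integral)
        show "integrable lborel (\<lambda>w. (c * 2 powr a * (3 / (4 * pi)) * ?J y powr - a) * ?J w powr - (5 - a))"
          by (intro integrable_mult_right integrable_jb_powr) (simp add: a_def)
        show le: "norm (indicator B (y + d n *\<^sub>R w) * ?\<eta> w) \<le> (c * 2 powr a * (3 / (4 * pi)) * ?J y powr - a) * ?J w powr - (5 - a)" for w
        proof -
          have "?J y \<le> ?J (y + d n *\<^sub>R w) + norm (d n *\<^sub>R w)"
            using jb_triangle[of y "y + d n *\<^sub>R w"] by simp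
          also have "norm (d n *\<^sub>R w) \<le> 1 * norm w"
            using d(1)[of n] d(2)[of n] unfolding norm_scaleR by (intro mult_right_mono) auto
          also have "1 * norm w \<le> ?J w" using norm_le_jb by simp
          also have "?J (y + d n *\<^sub>R w) + ?J w \<le> 2 * (?J (y + d n *\<^sub>R w) * ?J w)"
          proof -
            have "?J (y + d n *\<^sub>R w) * 1 \<le> ?J (y + d n *\<^sub>R w) * ?J w" "1 * ?J w \<le> ?J (y + d n *\<^sub>R w) * ?J w"
              using jb_ge_1 by (intro mult_left_mono mult_right_mono; simp)+
            then show ?thesis by linarith
          qed
          finally have "?J y powr a \<le> (2 * (?J (y + d n *\<^sub>R w) * ?J w)) powr a"
            by (intro powr_mono2) (auto simp: a_def)
          then have "?J (y + d n *\<^sub>R w) powr - a \<le> 2 powr a * ?J w powr a * ?J y powr - a"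
            by (simp add: powr_mult powr_minus_divide field_simps)
          then have "c * ?J (y + d n *\<^sub>R w) powr - a \<le> c * (2 powr a * ?J w powr a * ?J y powr - a)"
            by (intro mult_left_mono c)
          then have "indicator B (y + d n *\<^sub>R w) \<le> c * (2 powr a * ?J w powr a * ?J y powr - a)"
            by (rule order.trans[OF c(2)])
          then have "indicator B (y + d n *\<^sub>R w) * ?\<eta> w \<le> c * (2 powr a * ?J w powr a * ?J y powr - a) * ?\<eta> w"
            by (intro mult_right_mono) auto
          also have "\<dots> = (c * 2 powr a * (3 / (4 * pi)) * ?J y powr - a) * (?J w powr a * ?J w powr - 5)"
            by (simp add: mult_ac)
          also have "?J w powr a * ?J w powr - 5 = ?J w powr - (5 - a)"
            unfolding powr_add[symmetric] by simp
          finally show ?thesis by simp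
        qed
        show "integrable lborel (\<lambda>w. indicator B (y + d n *\<^sub>R w) * ?\<eta> w)"
          by (rule Bochner_Integration.integrable_bound[OF integrable_jb_powr[of 5]])
             (use pi_gt3 in \<open>auto simp: indicator_def field_simps intro!: AE_I2\<close>)
      qed
      also have "\<dots> = K * ?J y powr - a"
        unfolding K_def by (simp add: mult_ac)
      finally show ?thesis .
    qed
    have \<psi>_lim: "(\<lambda>n. \<psi> n y) \<longlonglongrightarrow> indicator B y" if "y \<notin> frontier B" for y
    proof -
      have "(\<lambda>n. LINT w|lborel. indicator B (y + d n *\<^sub>R w) * ?\<eta> w) \<longlonglongrightarrow> (LINT w|lborel. indicator B y * ?\<eta> w)"
      proof (rule integral_dominated_convergence[where w = ?\<eta>])
        show "AE w in lborel. (\<lambda>n. indicator B (y + d n *\<^sub>R w) * ?\<eta> w) \<longlonglongrightarrow> indicator B y * ?\<eta> w"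
        proof (rule AE_I2)
          fix w
          have lim: "(\<lambda>n. y + d n *\<^sub>R w) \<longlonglongrightarrow> y + 0 *\<^sub>R w"
            by (intro tendsto_intros d)
          have "(\<lambda>n. indicator B (y + d n *\<^sub>R w) :: real) \<longlonglongrightarrow> indicator B y"
          proof (cases "y \<in> interior B")
            case True
            then have "eventually (\<lambda>n. y + d n *\<^sub>R w \<in> interior B) sequentially"
              using lim by (intro topological_tendstoD) auto
            then have "eventually (\<lambda>n. indicator B (y + d n *\<^sub>R w) = (indicator B y :: real)) sequentially"
              by eventually_elim (use True interior_subset in \<open>auto simp: indicator_def\<close>)
            then show ?thesis by (rule tendsto_eventually)
          next
            case False
            then have y: "y \<in> - closure B" using that by (auto simp: frontier_def)
            then have "eventually (\<lambda>n. y + d n *\<^sub>R w \<in> - closure B) sequentially"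
              using lim by (intro topological_tendstoD) auto
            then have "eventually (\<lambda>n. indicator B (y + d n *\<^sub>R w) = (indicator B y :: real)) sequentially"
              by eventually_elim (use y closure_subset in \<open>auto simp: indicator_def\<close>)
            then show ?thesis by (rule tendsto_eventually)
          qed
          then show "(\<lambda>n. indicator B (y + d n *\<^sub>R w) * ?\<eta> w) \<longlonglongrightarrow> indicator B y * ?\<eta> w"
            by (intro tendsto_intros)
        qed
        show "integrable lborel ?\<eta>"
          by (intro integrable_mult_right integrable_jb_powr) simp
        show "AE w in lborel. norm (indicator B (y + d n *\<^sub>R w) * ?\<eta> w) \<le> ?\<eta> w" for n
          by (rule AE_I2) (simp add: indicator_def)
      qed measurable
      moreover have "(LINT w|lborel. indicator B y * ?\<eta> w) = indicator B y"
        by (simp only: integral_mult_right_zero[of _ "indicator B y" ?\<eta>] mollifier_mass mult_1_right)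
      ultimately show ?thesis
        unfolding \<psi>_eq by (simp only:)
    qed
    show ?thesis
    proof (rule integral_dominated_convergence[where w = "\<lambda>y. K * (?J (0 - y) powr - a * norm (\<phi> y))"])
      have Jm: "?J (0 - y) = ?J y" for y by (simp add: japanese_bracket_def)
      show "integrable lborel (\<lambda>y. K * (?J (0 - y) powr - a * norm (\<phi> y)))"
      proof (rule integrable_weighted_powr[where a = a and c = "\<bar>K\<bar>" and x = 0, OF assms(1) _ L2])
        show "a > 3 / 2" by (simp add: a_def)
      qed (auto simp: abs_mult)
      show "AE y in lborel. norm (\<psi> n y *\<^sub>R \<phi> y) \<le> K * (?J (0 - y) powr - a * norm (\<phi> y))" for n
      proof (rule AE_I2)
        fix y
        show "norm (\<psi> n y *\<^sub>R \<phi> y) \<le> K * (?J (0 - y) powr - a * norm (\<phi> y))"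
          using mult_right_mono[OF \<psi>_bound norm_ge_zero[of "\<phi> y"]] unfolding Jm by (simp add: mult.assoc)
      qed
      show "AE y in lborel. (\<lambda>n. \<psi> n y *\<^sub>R \<phi> y) \<longlonglongrightarrow> indicator B y *\<^sub>R \<phi> y"
        using fr by eventually_elim (intro tendsto_intros \<psi>_lim)
    qed measurable
  qed
  ultimately show ?thesis by simp
qed

text \<open>
  Integrate the regularised identity over a box and let \<open>d \<rightarrow> 0\<close>: the left-hand side tends to the
  integral of \<open>\<phi>\<close>, the right-hand side to that of the potential.
\<close>

theorem spin_potential_representation:
  assumes [measurable]: "\<phi> \<in> borel_measurable borel" "F \<in> borel_measurable borel"
    and L2: "integrable lborel (\<lambda>y. (norm (\<phi> y))\<^sup>2)" "integrable lborel (\<lambda>y. (norm (F y))\<^sup>2)"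
    and weak: "weak_dirac_eq \<phi> F"
  shows "AE x in lborel. \<phi> x = (1 / (4 * pi)) *\<^sub>R spin_potential F x"
proof (rule AE_eq_of_box_integrals)
  fix a b :: "real^3"
  let ?B = "box a b"
  define d where "d n = 1 / real (Suc n)" for n
  have d: "0 < d n" "d n \<le> 1" "d \<longlonglongrightarrow> 0" for n
    unfolding d_def[abs_def] using LIMSEQ_inverse_real_of_nat by (auto simp: inverse_eq_divide)
  obtain c where c: "c \<ge> 0" "\<And>x. indicator ?B x \<le> c * japanese_bracket x powr - 2"
    using indicator_le_jb[of ?B 2] by auto
  show "integrable lborel (\<lambda>x. indicator ?B x *\<^sub>R \<phi> x)"
  proof (rule integrable_weighted[OF assms(1) _ L2(1)])
    fix y :: "real^3"
    show "norm (indicator ?B y *\<^sub>R \<phi> y) \<le> c * (japanese_bracket (0 - y) powr - 2 * norm (\<phi> y))"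
      using mult_right_mono[OF c(2)[of y] norm_ge_zero[of "\<phi> y"]] by (simp add: japanese_bracket_def mult.assoc)
  qed measurable
  show "integrable lborel (\<lambda>x. indicator ?B x *\<^sub>R ((1 / (4 * pi)) *\<^sub>R spin_potential F x))"
    using integrable_scaleR_right[OF spin_potential_locally_integrable[OF assms(2) _ L2(2) bounded_box, of a b], of "1 / (4 * pi)"]
    by (simp add: mult.commute)
  have fr: "AE y in lborel. y \<notin> frontier ?B"
  proof -
    have "negligible (frontier ?B)" by (intro negligible_convex_frontier convex_box)
    then have "AE y in lebesgue. y \<notin> frontier ?B"
      unfolding negligible_iff_null_sets by (rule AE_not_in)
    then show ?thesis by (simp add: AE_completion_iff)
  qed
  have "(LINT y|lborel. mollifier (d n) (x - y) *\<^sub>R \<phi> y) = (1 / (4 * pi)) *\<^sub>R (LINT y|lborel. dirac_kernel (d n) (x - y) (F y))" for n x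
    unfolding weak_dirac_regularized_identity[OF assms(1,2) L2 weak d(1,2), symmetric]
    by (subst integral_scaleR_right[symmetric])
       (auto intro!: Bochner_Integration.integral_cong simp: mollifier_def simp del: integral_scaleR_right)
  then have "(\<lambda>n. (1 / (4 * pi)) *\<^sub>R (LINT x|lborel. indicator ?B x *\<^sub>R (LINT y|lborel. dirac_kernel (d n) (x - y) (F y))))
      \<longlonglongrightarrow> (LINT y|lborel. indicator ?B y *\<^sub>R \<phi> y)"
    using mollified_integral_tendsto[OF assms(1) _ L2(1) bounded_box fr d]
    by (simp add: mult.commute flip: integral_scaleR_right)
  moreover have "(\<lambda>n. (1 / (4 * pi)) *\<^sub>R (LINT x|lborel. indicator ?B x *\<^sub>R (LINT y|lborel. dirac_kernel (d n) (x - y) (F y))))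
      \<longlonglongrightarrow> (1 / (4 * pi)) *\<^sub>R (LINT x|lborel. indicator ?B x *\<^sub>R spin_potential F x)"
    by (intro tendsto_intros regularized_potential_tendsto assms L2 bounded_box d) simp
  ultimately have "(LINT y|lborel. indicator ?B y *\<^sub>R \<phi> y) = (1 / (4 * pi)) *\<^sub>R (LINT x|lborel. indicator ?B x *\<^sub>R spin_potential F x)"
    by (rule LIMSEQ_unique)
  then show "(LINT x|lborel. indicator ?B x *\<^sub>R \<phi> x) = (LINT x|lborel. indicator ?B x *\<^sub>R ((1 / (4 * pi)) *\<^sub>R spin_potential F x))"
    by (simp add: mult.commute flip: integral_scaleR_right)
qed

section \<open>Decay of zero modes and symmetry of the Weyl-Dirac operator\<close>

lemma norm_integral_le_nn_integral:
  fixes f :: "'a \<Rightarrow> 'b::{banach, second_countable_topology}"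
  shows "ennreal (norm (LINT x|M. f x)) \<le> (\<integral>\<^sup>+x. ennreal (norm (f x)) \<partial>M)"
  by (cases "integrable M f") (auto intro: integral_norm_bound_ennreal simp: not_integrable_integral_eq)

lemma AE_integrable_dirac_kernel:
  fixes F :: "real^3 \<Rightarrow> complex^2"
  assumes [measurable]: "F \<in> borel_measurable borel" and L2: "integrable lborel (\<lambda>y. (norm (F y))\<^sup>2)"
  shows "AE x in lborel. integrable lborel (\<lambda>y. dirac_kernel 0 (x - y) (F y))"
proof -
  let ?U = "\<lambda>x. \<integral>\<^sup>+y. ennreal (riesz (x - y) * norm (F y)) \<partial>lborel"
  have "AE x in lborel. \<forall>n::nat. indicator (ball 0 (real n)) x * ?U x \<noteq> \<infinity>"
    unfolding AE_all_countable
  proof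
    fix n :: nat
    have [measurable]: "ball 0 (real n) \<in> sets (borel :: (real^3) measure)" by simp
    have "(\<lambda>x. indicator (ball 0 (real n)) x * ?U x) \<in> borel_measurable lborel"
      by measurable
    moreover have "(\<integral>\<^sup>+x. indicator (ball 0 (real n)) x * ?U x \<partial>lborel) \<noteq> \<infinity>"
      using nn_integral_potential_finite[OF assms(1) _ L2, of "ball 0 (real n)"] by auto
    ultimately show "AE x in lborel. indicator (ball 0 (real n)) x * ?U x \<noteq> \<infinity>"
      by (rule nn_integral_PInf_AE)
  qed
  then show ?thesis
  proof eventually_elim
    case (elim x)
    obtain n :: nat where "norm x < real n" using reals_Archimedean2 by blast
    then have "?U x < \<infinity>" using elim by (auto simp: less_top dest: spec[of _ n])
    then have "integrable lborel (\<lambda>y. riesz (x - y) * norm (F y))"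
      by (intro integrableI_bounded) (auto simp: abs_mult)
    then show ?case
      by (rule Bochner_Integration.integrable_bound) (use norm_dirac_kernel in \<open>auto simp: abs_mult\<close>)
  qed
qed

text \<open>
  The representation bounds \<open>|\<phi>|\<close> by the Riesz potential of \<open>|F|\<close>, so the comparison principle
  applies.
\<close>

lemma zero_mode_decay:
  assumes [measurable]: "\<phi> \<in> borel_measurable borel" "F \<in> borel_measurable borel"
    and L2: "integrable lborel (\<lambda>y. (norm (\<phi> y))\<^sup>2)" "integrable lborel (\<lambda>y. (norm (F y))\<^sup>2)"
    and weak: "weak_dirac_eq \<phi> F" and c: "c > 0" and rho: "\<rho> > 1"
    and F: "AE y in lborel. norm (F y) \<le> c * japanese_bracket y powr - \<rho> * norm (\<phi> y)"
  shows "\<exists>M\<ge>0. AE x in lborel. norm (\<phi> x) \<le> M * japanese_bracket x powr - 2"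
proof (rule riesz_subsolution_decay[OF _ _ _ c rho])
  show "(\<integral>\<^sup>+x. ennreal ((norm (\<phi> x))\<^sup>2) \<partial>lborel) < \<infinity>"
    using integrableD(2)[OF L2(1)] by (simp add: top.not_eq_extremum)
  show "AE x in lborel. ennreal (norm (\<phi> x))
      \<le> (\<integral>\<^sup>+y. ennreal (c * riesz (x - y) * japanese_bracket y powr - \<rho> * norm (\<phi> y)) \<partial>lborel)"
    using spin_potential_representation[OF assms(1,2) L2 weak]
  proof eventually_elim
    case (elim x)
    have "1 / (4 * pi) \<le> 1" using pi_gt3 by simp
    from mult_right_mono[OF this norm_ge_zero[of "spin_potential F x"]]
    have "norm (\<phi> x) \<le> norm (spin_potential F x)"
      unfolding elim by simp
    then have "ennreal (norm (\<phi> x)) \<le> ennreal (norm (spin_potential F x))"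
      by (rule ennreal_leI)
    also have "\<dots> \<le> (\<integral>\<^sup>+y. ennreal (norm (dirac_kernel 0 (x - y) (F y))) \<partial>lborel)"
      unfolding spin_potential_def by (rule norm_integral_le_nn_integral)
    also have "\<dots> \<le> (\<integral>\<^sup>+y. ennreal (c * riesz (x - y) * japanese_bracket y powr - \<rho> * norm (\<phi> y)) \<partial>lborel)"
    proof (intro nn_integral_mono_AE, use F in eventually_elim)
      case (elim y)
      have "norm (dirac_kernel 0 (x - y) (F y)) \<le> riesz (x - y) * (c * japanese_bracket y powr - \<rho> * norm (\<phi> y))"
        by (rule order.trans[OF norm_dirac_kernel]) (intro mult_left_mono elim, simp)
      then show ?case by (intro ennreal_leI) (simp add: mult_ac)
    qed
    finally show ?case .
  qed
qed auto

lemma zero_mode_source_decay: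
  assumes "\<phi> \<in> borel_measurable borel" "F \<in> borel_measurable borel"
    and L2: "integrable lborel (\<lambda>y. (norm (\<phi> y))\<^sup>2)" "integrable lborel (\<lambda>y. (norm (F y))\<^sup>2)"
    and weak: "weak_dirac_eq \<phi> F" and c: "c > 0" and rho: "\<rho> > 1"
    and F: "AE y in lborel. norm (F y) \<le> c * japanese_bracket y powr - \<rho> * norm (\<phi> y)"
  shows "\<exists>K\<ge>0. AE y in lborel. norm (F y) \<le> K * japanese_bracket y powr - (\<rho> + 2)"
proof -
  let ?J = japanese_bracket
  obtain M where M: "M \<ge> 0" "AE x in lborel. norm (\<phi> x) \<le> M * ?J x powr - 2"
    using zero_mode_decay[OF assms] by blast
  have "AE y in lborel. norm (F y) \<le> c * M * ?J y powr - (\<rho> + 2)"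
    using F M(2)
  proof eventually_elim
    case (elim y)
    have "norm (F y) \<le> c * ?J y powr - \<rho> * (M * ?J y powr - 2)"
      using c by (intro order.trans[OF elim(1)] mult_left_mono elim(2)) auto
    also have "\<dots> = c * M * (?J y powr - \<rho> * ?J y powr - 2)"
      by simp
    also have "?J y powr - \<rho> * ?J y powr - 2 = ?J y powr - (\<rho> + 2)"
      unfolding powr_add[symmetric] by simp
    finally show ?case .
  qed
  then show ?thesis using c M(1) by (intro exI[of _ "c * M"]) simp
qed

lemma dirac_kernel_adjoint: "dirac_kernel d z \<psi> \<bullet> \<xi> = \<psi> \<bullet> dirac_kernel d (- z) \<xi>"
  by (simp add: dirac_kernel_def icliff_adjoint)

text \<open>
  Write \<open>u\<close> and \<open>v\<close> as potentials of \<open>f\<close> and \<open>g\<close>; then both sides are the same double integral,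
  because the kernel is odd and pointwise antisymmetric. The decay of \<open>g\<close> gives absolute
  convergence: its Riesz potential is \<open>O(\<langle>y\<rangle>\<^sup>-\<^sup>2)\<close>, hence square integrable.
\<close>

lemma weak_dirac_symmetric:
  assumes [measurable]: "u \<in> borel_measurable borel" "f \<in> borel_measurable borel"
      "v \<in> borel_measurable borel" "g \<in> borel_measurable borel"
    and L2: "integrable lborel (\<lambda>y. (norm (u y))\<^sup>2)" "integrable lborel (\<lambda>y. (norm (f y))\<^sup>2)"
      "integrable lborel (\<lambda>y. (norm (v y))\<^sup>2)" "integrable lborel (\<lambda>y. (norm (g y))\<^sup>2)"
    and weak: "weak_dirac_eq u f" "weak_dirac_eq v g"
    and g: "AE y in lborel. norm (g y) \<le> K * japanese_bracket y powr - t" and t: "t > 3" and K: "K \<ge> 0"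
  shows "(LINT x|lborel. u x \<bullet> g x) = (LINT y|lborel. f y \<bullet> v y)"
proof -
  let ?J = japanese_bracket
  define h where "h x y = dirac_kernel 0 (x - y) (f y) \<bullet> g x" for x y
  have h_alt: "h x y = f y \<bullet> dirac_kernel 0 (y - x) (g x)" for x y
    unfolding h_def dirac_kernel_adjoint by simp
  have [measurable]: "(\<lambda>z. h (fst z) (snd z)) \<in> borel_measurable (lborel \<Otimes>\<^sub>M lborel)"
    unfolding h_def by measurable
  obtain C where C: "C > 0" "\<And>x. (\<integral>\<^sup>+y. ennreal (riesz (x - y) * ?J y powr - t) \<partial>lborel) \<le> ennreal (C * ?J x powr - 2)"
    using riesz_potential_jb[of 2 t] t by auto
  have "(\<integral>\<^sup>+z. ennreal (norm (h (fst z) (snd z))) \<partial>(lborel \<Otimes>\<^sub>M lborel))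
      = (\<integral>\<^sup>+x. (\<integral>\<^sup>+y. ennreal (norm (h x y)) \<partial>lborel) \<partial>lborel)"
    using lborel.nn_integral_fst[of "\<lambda>z. ennreal (norm (h (fst z) (snd z)))" lborel] by simp
  also have "\<dots> = (\<integral>\<^sup>+y. (\<integral>\<^sup>+x. ennreal (norm (h x y)) \<partial>lborel) \<partial>lborel)"
    by (rule lborel_pair.Fubini'[symmetric]) (simp add: split_beta')
  also have "\<dots> \<le> (\<integral>\<^sup>+y. ennreal (K * C * (?J (0 - y) powr - 2 * norm (f y))) \<partial>lborel)"
  proof (intro nn_integral_mono)
    fix y
    have "(\<integral>\<^sup>+x. ennreal (norm (h x y)) \<partial>lborel) \<le> (\<integral>\<^sup>+x. ennreal (norm (f y) * K) * ennreal (riesz (y - x) * ?J x powr - t) \<partial>lborel)"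
    proof (intro nn_integral_mono_AE, use g in eventually_elim)
      case (elim x)
      have "norm (h x y) \<le> norm (f y) * norm (dirac_kernel 0 (y - x) (g x))"
        unfolding h_alt by (rule norm_cauchy_schwarz[unfolded real_norm_def[symmetric]] | simp add: Cauchy_Schwarz_ineq2)+
      also have "\<dots> \<le> norm (f y) * (riesz (y - x) * (K * ?J x powr - t))"
        by (intro mult_left_mono order.trans[OF norm_dirac_kernel] elim) auto
      finally have "ennreal (norm (h x y)) \<le> ennreal ((norm (f y) * K) * (riesz (y - x) * ?J x powr - t))"
        by (intro ennreal_leI) (simp add: mult_ac)
      then show ?case using K by (simp add: ennreal_mult')
    qed
    also have "\<dots> \<le> ennreal (norm (f y) * K) * ennreal (C * ?J y powr - 2)"
      by (subst nn_integral_cmult) (auto intro!: mult_left_mono C)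
    also have "\<dots> = ennreal (K * C * (?J (0 - y) powr - 2 * norm (f y)))"
      using K by (simp add: ennreal_mult'[symmetric] mult_ac japanese_bracket_def)
    finally show "(\<integral>\<^sup>+x. ennreal (norm (h x y)) \<partial>lborel) \<le> ennreal (K * C * (?J (0 - y) powr - 2 * norm (f y)))" .
  qed
  also have "\<dots> < \<infinity>"
  proof -
    have "integrable lborel (\<lambda>y. K * C * (?J (0 - y) powr - 2 * norm (f y)))"
      using K C by (intro integrable_weighted[OF assms(2) _ L2(2), of _ "K * C" 0]) (auto simp: abs_mult)
    from integrableD(2)[OF this] K C show ?thesis
      by (simp add: abs_mult top.not_eq_extremum)
  qed
  finally have int: "integrable (lborel \<Otimes>\<^sub>M lborel) (\<lambda>(x, y). h x y)"
    by (intro integrableI_bounded) (simp_all add: split_beta')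
  have "(LINT x|lborel. u x \<bullet> g x) = (LINT x|lborel. (1 / (4 * pi)) * (LINT y|lborel. h x y))"
  proof (rule integral_cong_AE)
    show "AE x in lborel. u x \<bullet> g x = (1 / (4 * pi)) * (LINT y|lborel. h x y)"
      using spin_potential_representation[OF assms(1,2) L2(1,2) weak(1)] AE_integrable_dirac_kernel[OF assms(2) L2(2)]
    proof eventually_elim
      case (elim x)
      show ?case
        unfolding elim(1) h_def integral_inner_left[OF elim(2)] spin_potential_def by simp
    qed
  qed (unfold h_def, measurable)
  moreover have "(LINT y|lborel. f y \<bullet> v y) = (LINT y|lborel. (1 / (4 * pi)) * (LINT x|lborel. h x y))"
  proof (rule integral_cong_AE)
    show "AE y in lborel. f y \<bullet> v y = (1 / (4 * pi)) * (LINT x|lborel. h x y)"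
      using spin_potential_representation[OF assms(3,4) L2(3,4) weak(2)] AE_integrable_dirac_kernel[OF assms(4) L2(4)]
    proof eventually_elim
      case (elim x)
      show ?case
        unfolding elim(1) h_alt integral_inner_right[OF elim(2)] spin_potential_def by simp
    qed
  qed (unfold h_def, measurable)
  ultimately show ?thesis
    using lborel_pair.Fubini_integral[OF int] by simp
qed

lemma integrable_inner_L2:
  fixes u v :: "real^3 \<Rightarrow> complex^2"
  assumes [measurable]: "u \<in> borel_measurable borel" "v \<in> borel_measurable borel"
    and "integrable lborel (\<lambda>y. (norm (u y))\<^sup>2)" "integrable lborel (\<lambda>y. (norm (v y))\<^sup>2)"
  shows "integrable lborel (\<lambda>x. u x \<bullet> v x)"
proof (rule Bochner_Integration.integrable_bound)
  show "integrable lborel (\<lambda>x. (norm (u x))\<^sup>2 + (norm (v x))\<^sup>2)"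
    using assms by simp
  show "AE x in lborel. norm (u x \<bullet> v x) \<le> norm ((norm (u x))\<^sup>2 + (norm (v x))\<^sup>2)"
  proof (rule AE_I2)
    fix x
    have "norm (u x) * norm (v x) \<le> (norm (u x))\<^sup>2 + (norm (v x))\<^sup>2"
      by (rule mult_le_sum_squares) simp_all
    then show "norm (u x \<bullet> v x) \<le> norm ((norm (u x))\<^sup>2 + (norm (v x))\<^sup>2)"
      using Cauchy_Schwarz_ineq2[of "u x" "v x"] by simp
  qed
qed measurable

text \<open>
  The symmetric operator \<open>\<sigma>\<cdot>(D - a)\<close> maps \<open>u\<close> to \<open>k v\<close> and \<open>v\<close> to \<open>0\<close>, so \<open>k \<parallel>v\<parallel>\<^sup>2 = 0\<close>. The zero
  mode \<open>v\<close> decays first, which is what the symmetry needs.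
\<close>

lemma partner_vanishes:
  assumes [measurable]: "u \<in> borel_measurable borel" "f \<in> borel_measurable borel"
      "v \<in> borel_measurable borel" "g \<in> borel_measurable borel"
    and L2: "integrable lborel (\<lambda>y. (norm (u y))\<^sup>2)" "integrable lborel (\<lambda>y. (norm (f y))\<^sup>2)"
      "integrable lborel (\<lambda>y. (norm (v y))\<^sup>2)" "integrable lborel (\<lambda>y. (norm (g y))\<^sup>2)"
    and weak: "weak_dirac_eq u f" "weak_dirac_eq v g"
    and f: "AE y in lborel. f y = cliff (a y) (u y) + k *\<^sub>R v y"
    and g: "AE y in lborel. g y = cliff (a y) (v y)"
    and a: "AE y in lborel. norm (a y) \<le> c * japanese_bracket y powr - \<rho>"
    and c: "c > 0" and rho: "\<rho> > 1" and k: "k \<noteq> 0"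
  shows "AE y in lborel. v y = 0"
proof -
  let ?J = japanese_bracket
  have g_le: "AE y in lborel. norm (g y) \<le> c * ?J y powr - \<rho> * norm (v y)"
    using g a by eventually_elim (simp add: norm_cliff mult_right_mono)
  obtain K where K: "K \<ge> 0" "AE y in lborel. norm (g y) \<le> K * ?J y powr - (\<rho> + 2)"
    using zero_mode_source_decay[OF assms(3,4) L2(3,4) weak(2) c rho g_le] by blast
  from weak_dirac_symmetric[OF assms(1-4) L2 weak K(2)] K(1) rho
  have sym: "(LINT x|lborel. u x \<bullet> g x) = (LINT y|lborel. f y \<bullet> v y)"
    by simp
  have "(LINT x|lborel. k * (norm (v x))\<^sup>2) = (LINT x|lborel. f x \<bullet> v x - u x \<bullet> g x)"
  proof (rule integral_cong_AE)
    show "AE x in lborel. k * (norm (v x))\<^sup>2 = f x \<bullet> v x - u x \<bullet> g x"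
      using f g
      by eventually_elim (simp add: inner_add_left cliff_self_adjoint power2_norm_eq_inner)
  qed measurable
  also have "\<dots> = 0"
    using sym by (simp add: Bochner_Integration.integral_diff integrable_inner_L2 L2)
  finally have "(LINT x|lborel. (norm (v x))\<^sup>2) = 0"
    using k by simp
  then have "AE x in lborel. (norm (v x))\<^sup>2 = 0"
    using L2(3) by (subst (asm) integral_nonneg_eq_0_iff_AE) auto
  then show ?thesis by simp
qed

section \<open>Continuity and leading term of the potential\<close>

lemma riesz_potential_integral:
  assumes "0 \<le> a" "a \<le> 2" "a < t - 1"
  shows "\<exists>C>0. \<forall>x. integrable lborel (\<lambda>y. riesz (x - y) * japanese_bracket y powr - t)
      \<and> (LINT y|lborel. riesz (x - y) * japanese_bracket y powr - t) \<le> C * japanese_bracket x powr - a"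
proof -
  obtain C where C: "C > 0" "\<And>x. (\<integral>\<^sup>+y. ennreal (riesz (x - y) * japanese_bracket y powr - t) \<partial>lborel)
                 \<le> ennreal (C * japanese_bracket x powr - a)"
    using riesz_potential_jb[OF assms] by blast
  have "integrable lborel (\<lambda>y. riesz (x - y) * japanese_bracket y powr - t)" for x
    using order.strict_trans1[OF C(2)[of x] ennreal_less_top]
    by (intro integrableI_bounded) (auto simp: abs_mult)
  moreover have "(LINT y|lborel. riesz (x - y) * japanese_bracket y powr - t) \<le> C * japanese_bracket x powr - a" for x
    using C by (subst integral_eq_nn_integral) (auto intro!: enn2real_leI)
  ultimately show ?thesis using C(1) by blast
qed

lemma AE_bound_integrable:
  fixes F :: "real^3 \<Rightarrow> complex^2"
  assumes [measurable]: "F \<in> borel_measurable borel"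
    and F: "AE y in lborel. norm (F y) \<le> K * japanese_bracket y powr - t" and t: "t > 3"
  shows "integrable lborel F"
  by (rule Bochner_Integration.integrable_bound[OF integrable_mult_right[OF integrable_jb_powr[OF t], of K]])
     (use F in \<open>auto elim!: eventually_mono intro: order.trans[OF _ abs_ge_self]\<close>)

lemma dirac_kernel_integrable:
  fixes F :: "real^3 \<Rightarrow> complex^2"
  assumes [measurable]: "F \<in> borel_measurable borel"
    and F: "AE y in lborel. norm (F y) \<le> K * japanese_bracket y powr - t" and t: "t > 3"
  shows "integrable lborel (\<lambda>y. dirac_kernel 0 (x - y) (F y))"
proof -
  have "integrable lborel (\<lambda>y. K * (riesz (x - y) * japanese_bracket y powr - t))"
    using riesz_potential_integral[of 2 t] t by auto
  then show ?thesis
  proof (rule Bochner_Integration.integrable_bound)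
    show "AE y in lborel. norm (dirac_kernel 0 (x - y) (F y)) \<le> norm (K * (riesz (x - y) * japanese_bracket y powr - t))"
      using F
    proof eventually_elim
      case (elim y)
      have "norm (dirac_kernel 0 (x - y) (F y)) \<le> riesz (x - y) * (K * japanese_bracket y powr - t)"
        by (rule order.trans[OF norm_dirac_kernel]) (intro mult_left_mono elim, simp)
      also have "\<dots> = K * (riesz (x - y) * japanese_bracket y powr - t)" by simp
      also have "\<dots> \<le> norm \<dots>" by simp
      finally show ?case .
    qed
  qed measurable
qed

text \<open>
  Replacing \<open>|z|\<^sup>-\<^sup>3\<close> by \<open>max(|z|, \<delta>)\<^sup>-\<^sup>3\<close> makes the kernel bounded and continuous and changes the
  potential by at most a multiple of \<open>\<delta>\<close>, uniformly in \<open>x\<close>, because \<open>F\<close> is bounded.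
\<close>

lemma spin_potential_continuous:
  fixes F :: "real^3 \<Rightarrow> complex^2"
  assumes [measurable]: "F \<in> borel_measurable borel"
    and F: "AE y in lborel. norm (F y) \<le> K * japanese_bracket y powr - t" and t: "t > 3" and K: "K \<ge> 0"
  shows "continuous_on UNIV (spin_potential F)"
proof -
  define \<delta> where "\<delta> n = 1 / real (Suc n)" for n
  have \<delta>: "\<delta> n > 0" "\<delta> \<longlonglongrightarrow> 0" for n
    unfolding \<delta>_def[abs_def] using LIMSEQ_inverse_real_of_nat by (auto simp: inverse_eq_divide)
  define k where "k n z \<psi> = (1 / max (norm z) (\<delta> n) ^ 3) *\<^sub>R icliff z \<psi>" for n z \<psi>
  have k_bound: "norm (k n z \<psi>) \<le> (1 / (\<delta> n)\<^sup>2) * norm \<psi>" for n z \<psi>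
  proof -
    let ?m = "max (norm z) (\<delta> n)"
    have m: "?m > 0" "\<delta> n \<le> ?m" "norm z \<le> ?m" using \<delta>(1)[of n] by auto
    have "1 / ?m ^ 3 * norm z \<le> 1 / ?m ^ 3 * ?m"
      using m by (intro mult_left_mono) auto
    also have "\<dots> = 1 / ?m\<^sup>2" using m by (simp add: power3_eq_cube power2_eq_square)
    also have "\<dots> \<le> 1 / (\<delta> n)\<^sup>2"
      using m \<delta>(1)[of n] by (intro divide_left_mono power_mono) auto
    finally have "1 / ?m ^ 3 * norm z * norm \<psi> \<le> (1 / (\<delta> n)\<^sup>2) * norm \<psi>"
      by (rule mult_right_mono) simp
    then show ?thesis using m by (simp add: k_def norm_icliff)
  qed
  have k_diff: "norm (dirac_kernel 0 z \<psi> - k n z \<psi>) \<le> riesz z * indicator {..\<delta> n} (norm z) * norm \<psi>" for n z \<psi>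
  proof (cases "z = 0")
    case False
    have e: "((norm z)\<^sup>2) powr - (3 / 2) = 1 / norm z ^ 3"
      using False by (simp add: powr_powr powr_minus_divide powr_numeral flip: powr_numeral)
    show ?thesis
    proof (cases "norm z \<le> \<delta> n")
      case True
      have "\<bar>1 / norm z ^ 3 - 1 / \<delta> n ^ 3\<bar> \<le> 1 / norm z ^ 3"
        using True False \<delta>(1)[of n] by (simp add: abs_le_iff frac_le power_mono)
      then have "\<bar>1 / norm z ^ 3 - 1 / \<delta> n ^ 3\<bar> * (norm z * norm \<psi>) \<le> 1 / norm z ^ 3 * (norm z * norm \<psi>)"
        by (rule mult_right_mono) simp
      also have "\<dots> = riesz z * norm \<psi>"
        using False by (simp add: riesz_def power3_eq_cube power2_eq_square)
      finally show ?thesis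
        using True by (simp add: dirac_kernel_def k_def e norm_icliff max_def flip: scaleR_diff_left)
    next
      case False
      then show ?thesis by (simp add: dirac_kernel_def k_def e max_def)
    qed
  qed (simp add: dirac_kernel_def k_def icliff.zero_left)
  have [measurable]: "(\<lambda>y. k n (x - y) (F y)) \<in> borel_measurable borel" for n x
    unfolding k_def by measurable
  have int_F: "integrable lborel F" by (rule AE_bound_integrable[OF assms(1) F t])
  have int_k: "integrable lborel (\<lambda>y. k n (x - y) (F y))" for n x
    by (rule Bochner_Integration.integrable_bound[OF integrable_mult_right[OF integrable_norm[OF int_F], of "1 / (\<delta> n)\<^sup>2"]])
       (auto intro!: AE_I2 order.trans[OF k_bound])
  have cont: "continuous_on UNIV (\<lambda>x. LINT y|lborel. k n (x - y) (F y))" for n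
  proof (rule continuous_on_sequentiallyI)
    fix X :: "nat \<Rightarrow> real^3" and x assume X: "X \<longlonglongrightarrow> x"
    show "(\<lambda>i. LINT y|lborel. k n (X i - y) (F y)) \<longlonglongrightarrow> (LINT y|lborel. k n (x - y) (F y))"
    proof (rule integral_dominated_convergence[where w = "\<lambda>y. 1 / (\<delta> n)\<^sup>2 * norm (F y)"])
      show "integrable lborel (\<lambda>y. 1 / (\<delta> n)\<^sup>2 * norm (F y))"
        using int_F by (intro integrable_mult_right integrable_norm) auto
      show "AE y in lborel. (\<lambda>i. k n (X i - y) (F y)) \<longlonglongrightarrow> k n (x - y) (F y)"
      proof (rule AE_I2)
        fix y
        have "max (norm (x - y)) (\<delta> n) > 0" using \<delta>(1)[of n] by (simp add: less_max_iff_disj)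
        then show "(\<lambda>i. k n (X i - y) (F y)) \<longlonglongrightarrow> k n (x - y) (F y)"
          unfolding k_def by (intro tendsto_intros icliff.tendsto X) auto
      qed
    qed (use k_bound in auto)
  qed
  have bound: "norm (spin_potential F x - (LINT y|lborel. k n (x - y) (F y))) \<le> K * (4 * pi * \<delta> n)" for n x
  proof -
    have "spin_potential F x - (LINT y|lborel. k n (x - y) (F y)) = (LINT y|lborel. dirac_kernel 0 (x - y) (F y) - k n (x - y) (F y))"
      unfolding spin_potential_def
      by (rule Bochner_Integration.integral_diff[symmetric, OF dirac_kernel_integrable[OF assms(1) F t] int_k])
    then have "ennreal (norm (spin_potential F x - (LINT y|lborel. k n (x - y) (F y))))
        \<le> (\<integral>\<^sup>+y. ennreal (norm (dirac_kernel 0 (x - y) (F y) - k n (x - y) (F y))) \<partial>lborel)"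
      using integral_norm_bound_ennreal[OF Bochner_Integration.integrable_diff[OF dirac_kernel_integrable[OF assms(1) F t] int_k], of x n x]
      by simp
    also have "\<dots> \<le> (\<integral>\<^sup>+y. ennreal K * (ennreal (riesz (x - y)) * indicator {..\<delta> n} (norm (x - y))) \<partial>lborel)"
    proof (intro nn_integral_mono_AE, use F in eventually_elim)
      case (elim y)
      have "norm (F y) \<le> K * 1"
        using K t by (intro order.trans[OF elim] mult_left_mono jb_powr_le_1) auto
      then have "norm (dirac_kernel 0 (x - y) (F y) - k n (x - y) (F y)) \<le> riesz (x - y) * indicator {..\<delta> n} (norm (x - y)) * K"
        by (intro order.trans[OF k_diff] mult_left_mono) auto
      then have "ennreal (norm (dirac_kernel 0 (x - y) (F y) - k n (x - y) (F y)))
          \<le> ennreal (K * (riesz (x - y) * indicator {..\<delta> n} (norm (x - y))))"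
        by (intro ennreal_leI) (simp add: mult_ac)
      then show ?case using K by (simp add: ennreal_mult' ennreal_indicator)
    qed
    also have "\<dots> \<le> ennreal K * ennreal (4 * pi * \<delta> n)"
      by (subst nn_integral_cmult) (auto intro!: mult_left_mono nn_integral_riesz_cball less_imp_le[OF \<delta>(1)])
    also have "\<dots> = ennreal (K * (4 * pi * \<delta> n))"
      using K by (simp add: ennreal_mult')
    finally show ?thesis
      using K \<delta>(1)[of n] by (subst (asm) ennreal_le_iff) auto
  qed
  show ?thesis
  proof (rule uniform_limit_theorem)
    show "uniform_limit UNIV (\<lambda>n x. LINT y|lborel. k n (x - y) (F y)) (spin_potential F) sequentially"
    proof (rule uniform_limitI)
      fix e :: real assume "e > 0"
      have "(\<lambda>n. K * (4 * pi * \<delta> n)) \<longlonglongrightarrow> K * (4 * pi * 0)"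
        by (intro tendsto_intros \<delta>)
      then have "eventually (\<lambda>n. K * (4 * pi * \<delta> n) < e) sequentially"
        using \<open>e > 0\<close> by (intro order_tendstoD(2)) auto
      then show "eventually (\<lambda>n. \<forall>x\<in>UNIV. dist (LINT y|lborel. k n (x - y) (F y)) (spin_potential F x) < e) sequentially"
      proof eventually_elim
        case (elim n)
        then show ?case using bound[of _ n] by (auto simp: dist_norm norm_minus_commute intro: order.strict_trans1)
      qed
    qed
  qed (auto simp: cont)
qed

text \<open>
  With \<open>s = |x - y|\<close> and \<open>|y| < r/2\<close>, the difference is \<open>(r\<^sup>3 - s\<^sup>3)/s\<^sup>3 \<omega> - r\<^sup>2/s\<^sup>3 y\<close>, of size
  \<open>|y|/r\<close> because \<open>|r - s| \<le> |y|\<close>. For larger \<open>y\<close> both terms are estimated separately, as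
  \<open>(\<langle>y\<rangle>/r)\<^sup>\<kappa> \<ge> 1/2\<close>.
\<close>

lemma kernel_direction_bound:
  fixes y \<omega> :: "real^3"
  assumes \<kappa>: "0 < \<kappa>" "\<kappa> \<le> 1" and r: "r \<ge> 1" and \<omega>: "norm \<omega> = 1"
  defines "x \<equiv> r *\<^sub>R \<omega>"
  shows "norm ((r\<^sup>2 / norm (x - y) ^ 3) *\<^sub>R (x - y) - \<omega>)
    \<le> 46 * r powr - \<kappa> * (1 + r\<^sup>2 * riesz (x - y)) * japanese_bracket y powr \<kappa>"
proof -
  let ?J = "japanese_bracket y" and ?s = "norm (x - y)"
  have r0: "r > 0" using r by simp
  have q: "r powr - \<kappa> * ?J powr \<kappa> = (?J / r) powr \<kappa>"
    using r0 by (simp add: powr_divide powr_minus_divide)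
  have nx: "norm x = r" unfolding x_def using r0 \<omega> by simp
  have fac: "1 \<le> 1 + r\<^sup>2 * riesz (x - y)" by simp
  show ?thesis
  proof (cases "norm y < r / 2")
    case True
    have s: "\<bar>r - ?s\<bar> \<le> norm y"
      using norm_triangle_ineq3[of x "x - y"] by (simp add: nx)
    then have s2: "r / 2 < ?s" "?s < 3 / 2 * r" using True by auto
    then have s0: "?s > 0" using r0 by linarith
    have cube: "?s ^ 3 \<ge> r ^ 3 / 8"
      using power_mono[of "r / 2" ?s 3] s2 r0 by (simp add: power_divide)
    have "(r\<^sup>2 / ?s ^ 3) *\<^sub>R (x - y) - \<omega> = ((r ^ 3 - ?s ^ 3) / ?s ^ 3) *\<^sub>R \<omega> - (r\<^sup>2 / ?s ^ 3) *\<^sub>R y"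
    proof -
      have "(r\<^sup>2 / ?s ^ 3) *\<^sub>R (x - y) - \<omega> = (r\<^sup>2 / ?s ^ 3 * r - 1) *\<^sub>R \<omega> - (r\<^sup>2 / ?s ^ 3) *\<^sub>R y"
        by (simp add: x_def algebra_simps)
      also have "r\<^sup>2 / ?s ^ 3 * r - 1 = (r ^ 3 - ?s ^ 3) / ?s ^ 3"
        using s0 by (simp add: power2_eq_square power3_eq_cube diff_divide_distrib)
      finally show ?thesis .
    qed
    then have "norm ((r\<^sup>2 / ?s ^ 3) *\<^sub>R (x - y) - \<omega>) \<le> \<bar>r ^ 3 - ?s ^ 3\<bar> / ?s ^ 3 + r\<^sup>2 / ?s ^ 3 * norm y"
      using norm_triangle_ineq4[of "((r ^ 3 - ?s ^ 3) / ?s ^ 3) *\<^sub>R \<omega>" "(r\<^sup>2 / ?s ^ 3) *\<^sub>R y"] \<omega> by simp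
    also have "\<bar>r ^ 3 - ?s ^ 3\<bar> \<le> norm y * (19 / 4 * r\<^sup>2)"
    proof -
      have "r ^ 3 - ?s ^ 3 = (r - ?s) * (r\<^sup>2 + r * ?s + ?s\<^sup>2)"
        by (simp add: power2_eq_square power3_eq_cube algebra_simps)
      moreover have "r * ?s \<le> r * (3 / 2 * r)" "?s\<^sup>2 \<le> (3 / 2 * r)\<^sup>2"
        using s2 s0 r0 by (auto intro!: mult_left_mono power_mono)
      then have "r\<^sup>2 + r * ?s + ?s\<^sup>2 \<le> 19 / 4 * r\<^sup>2"
        by (simp add: power2_eq_square)
      moreover have "0 \<le> r\<^sup>2 + r * ?s + ?s\<^sup>2" using r0 by simp
      ultimately have "\<bar>r ^ 3 - ?s ^ 3\<bar> = \<bar>r - ?s\<bar> * (r\<^sup>2 + r * ?s + ?s\<^sup>2)"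
          and le: "r\<^sup>2 + r * ?s + ?s\<^sup>2 \<le> 19 / 4 * r\<^sup>2" "0 \<le> r\<^sup>2 + r * ?s + ?s\<^sup>2"
        by (simp_all add: abs_mult)
      then show ?thesis
        using mult_mono[OF s le(1) norm_ge_zero le(2)] by simp
    qed
    finally have "norm ((r\<^sup>2 / ?s ^ 3) *\<^sub>R (x - y) - \<omega>) \<le> norm y * (19 / 4 * r\<^sup>2) / ?s ^ 3 + r\<^sup>2 / ?s ^ 3 * norm y"
      using s0 by (simp add: divide_right_mono)
    also have "\<dots> = norm y * (23 / 4 * r\<^sup>2) / ?s ^ 3" by (simp add: field_simps)
    also have "\<dots> \<le> norm y * (23 / 4 * r\<^sup>2) / (r ^ 3 / 8)"
      using cube r0 s0 by (intro divide_left_mono mult_pos_pos) auto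
    also have "\<dots> = 46 * (norm y / r)"
      using r0 by (simp add: power2_eq_square power3_eq_cube)
    also have "norm y / r \<le> (?J / r) powr \<kappa>"
    proof (cases "?J \<le> r")
      case True
      have "norm y / r \<le> ?J / r" using r0 norm_le_jb by (simp add: divide_right_mono)
      also have "\<dots> = (?J / r) powr 1" using r0 by simp
      also have "\<dots> \<le> (?J / r) powr \<kappa>"
        using True r0 \<kappa> by (intro powr_mono') auto
      finally show ?thesis .
    next
      case False
      have "norm y / r \<le> 1" using \<open>norm y < r / 2\<close> r0 by simp
      also have "1 \<le> (?J / r) powr \<kappa>" using False r0 \<kappa> by (intro ge_one_powr_ge_zero) auto
      finally show ?thesis .
    qed
    finally have "norm ((r\<^sup>2 / ?s ^ 3) *\<^sub>R (x - y) - \<omega>) \<le> 46 * ((?J / r) powr \<kappa>)" by simp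
    also have "\<dots> \<le> 46 * ((1 + r\<^sup>2 * riesz (x - y)) * (?J / r) powr \<kappa>)"
      using mult_right_mono[OF fac, of "(?J / r) powr \<kappa>"] by simp
    finally show ?thesis unfolding q[symmetric] by (simp add: mult_ac)
  next
    case False
    have "1 / 2 \<le> ?J / r" using False norm_le_jb[of y] r0 by (simp add: field_simps)
    then have "(1 / 2) powr \<kappa> \<le> (?J / r) powr \<kappa>" using \<kappa> by (intro powr_mono2) auto
    moreover have "(1 / 2 :: real) powr 1 \<le> (1 / 2) powr \<kappa>" using \<kappa> by (intro powr_mono') auto
    ultimately have half: "1 / 2 \<le> (?J / r) powr \<kappa>" by simp
    have "norm ((r\<^sup>2 / ?s ^ 3) *\<^sub>R (x - y) - \<omega>) \<le> r\<^sup>2 / ?s ^ 3 * ?s + 1"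
      using norm_triangle_ineq4[of "(r\<^sup>2 / ?s ^ 3) *\<^sub>R (x - y)" \<omega>] \<omega> by simp
    also have "r\<^sup>2 / ?s ^ 3 * ?s = r\<^sup>2 * riesz (x - y)"
      by (simp add: riesz_def power2_eq_square power3_eq_cube)
    also have "r\<^sup>2 * riesz (x - y) + 1 = 2 * (1 + r\<^sup>2 * riesz (x - y)) * (1 / 2)" by simp
    also have "\<dots> \<le> 46 * (1 + r\<^sup>2 * riesz (x - y)) * (?J / r) powr \<kappa>"
      using half by (intro mult_mono) auto
    finally show ?thesis unfolding q[symmetric] by (simp add: mult_ac)
  qed
qed

text \<open>
  Half of the excess of \<open>t\<close> over \<open>3\<close> pays for the factor \<open>\<langle>y\<rangle>\<^sup>\<kappa>\<close> in the preceding bound, the other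
  half keeps the integral finite. The term with \<open>r\<^sup>2 |x - y|\<^sup>-\<^sup>2\<close> is bounded since the Riesz
  potential is \<open>O(\<langle>x\<rangle>\<^sup>-\<^sup>2)\<close>.
\<close>

theorem spin_potential_asymptotics:
  fixes F :: "real^3 \<Rightarrow> complex^2"
  assumes [measurable]: "F \<in> borel_measurable borel"
    and F: "AE y in lborel. norm (F y) \<le> K * japanese_bracket y powr - t" and t: "t > 3" and K: "K \<ge> 0"
  shows "uniform_limit (sphere 0 1) (\<lambda>r \<omega>. r\<^sup>2 *\<^sub>R spin_potential F (r *\<^sub>R \<omega>)) (\<lambda>\<omega>. LINT y|lborel. icliff \<omega> (F y)) at_top"
proof -
  let ?J = japanese_bracket
  define \<kappa> where "\<kappa> = min ((t - 3) / 2) 1"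
  have \<kappa>: "0 < \<kappa>" "\<kappa> \<le> 1" "3 + 2 * \<kappa> \<le> t" using t by (auto simp: \<kappa>_def min_def field_simps)
  obtain C where C: "C > 0" "\<And>x. integrable lborel (\<lambda>y. riesz (x - y) * ?J y powr - (3 + \<kappa>))"
      "\<And>x. (LINT y|lborel. riesz (x - y) * ?J y powr - (3 + \<kappa>)) \<le> C * ?J x powr - 2"
    using riesz_potential_integral[of 2 "3 + \<kappa>"] \<kappa> by auto
  define I where "I = (LINT y|lborel. ?J y powr - (3 + \<kappa>))"
  have int_J: "integrable lborel (\<lambda>y. ?J y powr - (3 + \<kappa>))"
    using \<kappa> by (intro integrable_jb_powr) simp
  have rate: "norm (r\<^sup>2 *\<^sub>R spin_potential F (r *\<^sub>R \<omega>) - (LINT y|lborel. icliff \<omega> (F y))) \<le> 46 * K * (I + C) * r powr - \<kappa>"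
    if r: "r \<ge> 1" and \<omega>: "norm \<omega> = 1" for r \<omega>
  proof -
    define x where "x = r *\<^sub>R \<omega>"
    let ?w = "\<lambda>y. (r\<^sup>2 / norm (x - y) ^ 3) *\<^sub>R (x - y) - \<omega>"
    have dk: "dirac_kernel 0 z \<psi> = (1 / norm z ^ 3) *\<^sub>R icliff z \<psi>" for z \<psi>
      by (cases "z = 0") (simp_all add: dirac_kernel_def powr_powr powr_minus_divide powr_numeral icliff.zero_left flip: powr_numeral)
    have icliff_F: "integrable lborel (\<lambda>y. icliff \<omega> (F y))"
      by (rule integrable_bounded_linear[OF icliff.bounded_linear_right AE_bound_integrable[OF assms(1) F t]])
    have "r\<^sup>2 *\<^sub>R spin_potential F x - (LINT y|lborel. icliff \<omega> (F y)) = (LINT y|lborel. r\<^sup>2 *\<^sub>R dirac_kernel 0 (x - y) (F y) - icliff \<omega> (F y))"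
      unfolding spin_potential_def using icliff_F dirac_kernel_integrable[OF assms(1) F t, of x] by simp
    also have "\<dots> = (LINT y|lborel. icliff (?w y) (F y))"
      by (simp add: dk icliff.diff_left icliff.scaleR_left)
    finally have eq: "r\<^sup>2 *\<^sub>R spin_potential F x - (LINT y|lborel. icliff \<omega> (F y)) = (LINT y|lborel. icliff (?w y) (F y))" .
    let ?m = "\<lambda>y. (46 * K * r powr - \<kappa>) * (?J y powr - (3 + \<kappa>) + r\<^sup>2 * (riesz (x - y) * ?J y powr - (3 + \<kappa>)))"
    have int_m: "integrable lborel ?m"
      by (intro integrable_mult_right Bochner_Integration.integrable_add int_J C(2))
    have le: "AE y in lborel. norm (icliff (?w y) (F y)) \<le> ?m y"
      using F
    proof eventually_elim
      case (elim y)
      have "norm (F y) \<le> K * ?J y powr - (3 + 2 * \<kappa>)"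
        using K \<kappa> jb_ge_1 by (intro order.trans[OF elim] mult_left_mono powr_mono) auto
      then have "norm (icliff (?w y) (F y)) \<le> (46 * r powr - \<kappa> * (1 + r\<^sup>2 * riesz (x - y)) * ?J y powr \<kappa>) * (K * ?J y powr - (3 + 2 * \<kappa>))"
        unfolding norm_icliff x_def using r by (intro mult_mono kernel_direction_bound \<kappa> r \<omega>) auto
      also have "\<dots> = (46 * K * r powr - \<kappa>) * (1 + r\<^sup>2 * riesz (x - y)) * (?J y powr \<kappa> * ?J y powr - (3 + 2 * \<kappa>))"
        by (simp add: mult_ac)
      also have "?J y powr \<kappa> * ?J y powr - (3 + 2 * \<kappa>) = ?J y powr - (3 + \<kappa>)"
        unfolding powr_add[symmetric] by (rule arg_cong[where f = "(powr) (?J y)"]) simp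
      finally show ?case by (simp add: algebra_simps)
    qed
    have "norm (LINT y|lborel. icliff (?w y) (F y)) \<le> (LINT y|lborel. ?m y)"
    proof (rule order.trans[OF integral_norm_bound integral_mono_AE])
      have "integrable lborel (\<lambda>y. icliff (?w y) (F y))"
      proof (rule Bochner_Integration.integrable_bound[OF int_m])
        show "AE y in lborel. norm (icliff (?w y) (F y)) \<le> norm (?m y)"
          using le by eventually_elim (erule order.trans, simp only: real_norm_def abs_ge_self)
      qed measurable
      then show "integrable lborel (\<lambda>y. norm (icliff (?w y) (F y)))"
        by (rule integrable_norm)
    qed (use int_m le in auto)
    also have "\<dots> = (46 * K * r powr - \<kappa>) * (I + r\<^sup>2 * (LINT y|lborel. riesz (x - y) * ?J y powr - (3 + \<kappa>)))"
      using int_J C(2)[of x] by (simp add: I_def)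
    also have "\<dots> \<le> (46 * K * r powr - \<kappa>) * (I + r\<^sup>2 * (C * ?J x powr - 2))"
      using K C by (intro mult_left_mono add_left_mono) auto
    also have "\<dots> \<le> (46 * K * r powr - \<kappa>) * (I + C)"
    proof (intro mult_left_mono add_left_mono)
      have "r \<le> ?J x" using norm_le_jb[of x] r \<omega> by (simp add: x_def)
      then have "?J x powr - 2 \<le> r powr - 2" using r by (intro powr_mono2') auto
      then have "r\<^sup>2 * (C * ?J x powr - 2) \<le> r\<^sup>2 * (C * r powr - 2)"
        using C by (intro mult_left_mono) auto
      also have "\<dots> = C" using r by (simp add: powr_minus_divide powr_numeral)
      finally show "r\<^sup>2 * (C * ?J x powr - 2) \<le> C" .
    qed (use K in auto)
    finally show ?thesis unfolding eq[unfolded x_def] x_def by (simp only: mult_ac)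
  qed
  show ?thesis
  proof (rule uniform_limitI)
    fix e :: real assume e: "e > 0"
    have "((\<lambda>r. 46 * K * (I + C) * r powr - \<kappa>) \<longlongrightarrow> 46 * K * (I + C) * 0) at_top"
      using \<kappa> by (intro tendsto_intros tendsto_neg_powr filterlim_ident) auto
    then have "eventually (\<lambda>r. 46 * K * (I + C) * r powr - \<kappa> < e) at_top"
      using e by (intro order_tendstoD(2)) auto
    with eventually_ge_at_top[of 1]
    show "eventually (\<lambda>r. \<forall>\<omega>\<in>sphere 0 1. dist (r\<^sup>2 *\<^sub>R spin_potential F (r *\<^sub>R \<omega>)) (LINT y|lborel. icliff \<omega> (F y)) < e) at_top"
      by eventually_elim (auto simp: dist_norm intro!: order.strict_trans1[OF rate])
  qed
qed

section \<open>From Sobolev functions to the weak equation\<close>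

lemma test_fun_derivative:
  assumes "test_fun h"
  shows "test_fun (\<lambda>x. frechet_derivative h (at x) v)"
proof -
  let ?S = "closure {x. h x \<noteq> 0}"
  have Ck: "\<And>k. Ck k h" and S: "compact ?S" using assms by (auto simp: test_fun_def)
  have "frechet_derivative h (at x) v = 0" if x: "x \<notin> ?S" for x
  proof -
    have "(h has_derivative (\<lambda>_. 0)) (at x)"
    proof (rule has_derivative_transform_within_open[where s = "- ?S"])
      show "((\<lambda>_. 0) has_derivative (\<lambda>_. 0)) (at x)" by simp
      fix y assume "y \<in> - ?S"
      then show "0 = h y" using closure_subset[of "{x. h x \<noteq> 0}"] by auto
    qed (use x in auto)
    then show ?thesis by (metis frechet_derivative_at)
  qed
  then have "{x. frechet_derivative h (at x) v \<noteq> 0} \<subseteq> ?S" by auto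
  then have "closure {x. frechet_derivative h (at x) v \<noteq> 0} \<subseteq> ?S"
    by (simp add: closure_minimal)
  then have "compact (closure {x. frechet_derivative h (at x) v \<noteq> 0})"
    using S closed_closure by (metis compact_Int_closed inf.absorb_iff2)
  moreover have "Ck k (\<lambda>x. frechet_derivative h (at x) v)" for k
    using Ck[of "Suc k"] by simp
  ultimately show ?thesis by (simp add: test_fun_def)
qed

lemma test_fun_measurable: "test_fun h \<Longrightarrow> h \<in> borel_measurable borel"
  unfolding test_fun_def using borel_measurable_continuous_onI Ck.simps(1) by blast

lemma test_fun_sq_integrable:
  assumes "test_fun h"
  shows "integrable lborel (\<lambda>x. (h x)\<^sup>2)"
proof -
  let ?S = "closure {x. h x \<noteq> 0}"
  have "Ck 0 h" and S: "compact ?S"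
    using assms unfolding test_fun_def by blast+
  then have h: "continuous_on UNIV h" by simp
  have "compact ((\<lambda>x. (h x)\<^sup>2) ` ?S)"
    using S continuous_on_subset[OF h] by (intro compact_continuous_image continuous_intros) auto
  then have "bounded ((\<lambda>x. (h x)\<^sup>2) ` ?S)" by (rule compact_imp_bounded)
  then obtain M where M: "\<And>x. x \<in> ?S \<Longrightarrow> norm ((h x)\<^sup>2) \<le> M"
    unfolding bounded_iff by auto
  have [measurable]: "h \<in> borel_measurable borel" by (rule test_fun_measurable[OF assms])
  have fin: "emeasure lborel ?S < \<infinity>" using S by (intro emeasure_compact_finite)
  have "integrable lborel (\<lambda>x. M * indicator ?S x)"
    using fin by (intro integrable_mult_right integrable_real_indicator) auto
  then show ?thesis
  proof (rule Bochner_Integration.integrable_bound)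
    show "AE x in lborel. norm ((h x)\<^sup>2) \<le> norm (M * indicator ?S x)"
    proof (rule AE_I2)
      fix x
      show "norm ((h x)\<^sup>2) \<le> norm (M * indicator ?S x)"
      proof (cases "x \<in> ?S")
        case True
        then show ?thesis using M[OF True] by simp
      next
        case False
        then have "h x = 0" using closure_subset[of "{x. h x \<noteq> 0}"] by auto
        then show ?thesis by simp
      qed
    qed
  qed measurable
qed

definition sq_integrable :: "(real^3 \<Rightarrow> 'b::euclidean_space) \<Rightarrow> bool" where
  "sq_integrable f \<longleftrightarrow> f \<in> borel_measurable lebesgue \<and> integrable lebesgue (\<lambda>x. (norm (f x))\<^sup>2)"

lemma sq_integrable_bound:
  assumes "sq_integrable f" "g \<in> borel_measurable lebesgue" "\<And>x. norm (g x) \<le> norm (f x)"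
  shows "sq_integrable g"
proof -
  have [measurable]: "g \<in> borel_measurable lebesgue" by fact
  have "integrable lebesgue (\<lambda>x. (norm (f x))\<^sup>2)" using assms(1) by (simp add: sq_integrable_def)
  then have "integrable lebesgue (\<lambda>x. (norm (g x))\<^sup>2)"
  proof (rule Bochner_Integration.integrable_bound)
    show "AE x in lebesgue. norm ((norm (g x))\<^sup>2) \<le> norm ((norm (f x))\<^sup>2)"
      by (rule AE_I2) (simp add: power_mono assms(3))
  qed measurable
  then show ?thesis by (simp add: sq_integrable_def)
qed

lemma sq_integrable_add:
  assumes "sq_integrable f" "sq_integrable g"
  shows "sq_integrable (\<lambda>x. f x + g x)"
proof -
  have [measurable]: "f \<in> borel_measurable lebesgue" "g \<in> borel_measurable lebesgue"
    using assms by (auto simp: sq_integrable_def)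
  have int: "integrable lebesgue (\<lambda>x. 2 * ((norm (f x))\<^sup>2 + (norm (g x))\<^sup>2))"
    using assms by (intro integrable_mult_right Bochner_Integration.integrable_add) (auto simp: sq_integrable_def)
  have "(norm (f x + g x))\<^sup>2 \<le> 2 * ((norm (f x))\<^sup>2 + (norm (g x))\<^sup>2)" for x
  proof -
    have "(norm (f x + g x))\<^sup>2 \<le> (norm (f x) + norm (g x))\<^sup>2"
      by (intro power_mono norm_triangle_ineq) auto
    also have "\<dots> \<le> 2 * ((norm (f x))\<^sup>2 + (norm (g x))\<^sup>2)"
      using sum_squares_bound[of "norm (f x)" "norm (g x)"] by (simp add: power2_sum)
    finally show ?thesis .
  qed
  then have "integrable lebesgue (\<lambda>x. (norm (f x + g x))\<^sup>2)"
    by (intro Bochner_Integration.integrable_bound[OF int] AE_I2) (auto intro: order.trans)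
  then show ?thesis by (simp add: sq_integrable_def)
qed

lemma sq_integrable_zero: "sq_integrable (\<lambda>x. 0)"
  by (simp add: sq_integrable_def)

lemma sq_integrable_sum: "(\<And>i. i \<in> I \<Longrightarrow> sq_integrable (f i)) \<Longrightarrow> sq_integrable (\<lambda>x. \<Sum>i\<in>I. f i x)"
  by (induction I rule: infinite_finite_induct) (auto intro: sq_integrable_add sq_integrable_zero)

lemma sq_integrable_vec:
  fixes f :: "real^3 \<Rightarrow> complex^2"
  assumes "\<And>k. (\<lambda>x. f x $ k) \<in> L2"
  shows "sq_integrable f"
proof -
  have "sq_integrable (\<lambda>x. axis k (f x $ k) :: complex^2)" for k
  proof -
    have n: "norm (axis k c :: complex^2) = norm c" for c
      using exhaust_2[of k] by (auto simp: norm_vec_def L2_set_def sum_2 axis_def)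
    have "bounded_linear (\<lambda>c. axis k c :: complex^2)"
    proof (rule bounded_linear_intro[where K = 1])
      show "axis k (a + b) = axis k a + (axis k b :: complex^2)" for a b
        by (simp add: vec_eq_iff axis_def)
      show "axis k (r *\<^sub>R a) = r *\<^sub>R (axis k a :: complex^2)" for r a
        by (simp add: vec_eq_iff axis_def)
    qed (simp add: n)
    note bl = this
    have "(\<lambda>x. f x $ k) \<in> borel_measurable lebesgue"
      using assms[of k] by (simp add: L2_def)
    then have "(\<lambda>x. axis k (f x $ k) :: complex^2) \<in> borel_measurable lebesgue"
      by (rule borel_measurable_continuous_on[OF linear_continuous_on[OF bl]])
    then show ?thesis
      using assms[of k] by (simp add: sq_integrable_def n L2_def)
  qed
  then have "sq_integrable (\<lambda>x. \<Sum>k\<in>UNIV. axis k (f x $ k))"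
    by (intro sq_integrable_sum)
  moreover have "(\<Sum>k\<in>UNIV. axis k (f x $ k)) = f x" for x
    by (simp add: vec_eq_iff forall_2 sum_2 axis_def)
  ultimately show ?thesis by simp
qed

lemma test_fun_mult_integrable:
  fixes f :: "real^3 \<Rightarrow> 'b::euclidean_space"
  assumes h: "test_fun h" and f: "sq_integrable f"
  shows "integrable lebesgue (\<lambda>x. h x *\<^sub>R f x)"
proof (rule Bochner_Integration.integrable_bound)
  have hm: "h \<in> borel_measurable borel" by (rule test_fun_measurable[OF h])
  have hm': "h \<in> borel_measurable lebesgue" using hm by (intro measurable_completion) simp
  have "integrable lebesgue (\<lambda>x. (h x)\<^sup>2)"
    using test_fun_sq_integrable[OF h] hm by (subst integrable_completion) auto
  then show "integrable lebesgue (\<lambda>x. (h x)\<^sup>2 + (norm (f x))\<^sup>2)"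
    using f by (intro Bochner_Integration.integrable_add) (auto simp: sq_integrable_def)
  show "(\<lambda>x. h x *\<^sub>R f x) \<in> borel_measurable lebesgue"
    using hm' f by (intro borel_measurable_scaleR) (auto simp: sq_integrable_def)
  show "AE x in lebesgue. norm (h x *\<^sub>R f x) \<le> norm ((h x)\<^sup>2 + (norm (f x))\<^sup>2)"
  proof (rule AE_I2)
    fix x
    have "\<bar>h x\<bar> * norm (f x) \<le> \<bar>h x\<bar>\<^sup>2 + (norm (f x))\<^sup>2"
      by (rule mult_le_sum_squares) simp_all
    then show "norm (h x *\<^sub>R f x) \<le> norm ((h x)\<^sup>2 + (norm (f x))\<^sup>2)" by simp
  qed
qed

lemma weak_partial_L2:
  assumes "u \<in> H1"
  shows "weak_partial j u \<in> L2" "has_weak_partial j u (weak_partial j u)"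
proof -
  have "\<exists>v. v \<in> L2 \<and> has_weak_partial j u v" using assms by (auto simp: H1_def)
  from someI_ex[OF this] show "weak_partial j u \<in> L2" "has_weak_partial j u (weak_partial j u)"
    unfolding weak_partial_def by auto
qed

definition weak_gradient :: "3 \<Rightarrow> (real^3 \<Rightarrow> complex^'n) \<Rightarrow> real^3 \<Rightarrow> complex^'n" where
  "weak_gradient j u x = (\<chi> k. weak_partial j (\<lambda>y. u y $ k) x)"

text \<open>
  The operator \<open>\<sigma>\<cdot>D\<close>, evaluated on the chosen weak derivatives.
\<close>

definition free_dirac :: "(real^3 \<Rightarrow> complex^2) \<Rightarrow> real^3 \<Rightarrow> complex^2" where
  "free_dirac u x = - (\<i> *s (\<Sum>j\<in>UNIV. cliff (axis j 1) (weak_gradient j u x)))"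

lemma pauli_mult: "pauli $ j *v \<psi> = cliff (axis j 1) \<psi>"
proof -
  have "sigma_dot (axis j 1) = pauli $ j"
    using exhaust_3[of j] by (auto simp: sigma_dot_def vec_eq_iff cscale_mat_def axis_def sum_3)
  then show ?thesis by (simp add: cliff_def)
qed

lemma weyl_dirac_eq: "weyl_dirac A u x = free_dirac u x - cliff (A x) (u x)"
proof -
  have mm: "mag_momentum A j u x = - (\<i> *s weak_gradient j u x) - (A x $ j) *\<^sub>R u x" for j
    by (simp add: mag_momentum_def weak_gradient_def vec_eq_iff scaleR_conv_of_real[where 'a = complex])
  have "weyl_dirac A u x = (\<Sum>j\<in>UNIV. - (\<i> *s cliff (axis j 1) (weak_gradient j u x)) - (A x $ j) *\<^sub>R cliff (axis j 1) (u x))"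
    unfolding weyl_dirac_def pauli_mult mm
    by (simp add: cliff.diff_right cliff.minus_right cliff_imult icliff_def cliff.scaleR_right)
  also have "\<dots> = free_dirac u x - cliff (A x) (u x)"
    unfolding sum_subtractf cliff_axis_sum free_dirac_def sum_negf
    by (simp add: linear_sum[OF bounded_linear.linear[OF bounded_linear_imult]] sum_negf)
  finally show ?thesis .
qed

text \<open>
  The weak derivatives are defined componentwise; the vector-valued identity follows because all
  the integrands are integrable.
\<close>

lemma weak_gradient_identity:
  fixes u :: "real^3 \<Rightarrow> complex^2"
  assumes u: "u \<in> H1_vec" and h: "test_fun h"
  shows "(LINT x|lebesgue. frechet_derivative h (at x) (axis j 1) *\<^sub>R u x) = - (LINT x|lebesgue. h x *\<^sub>R weak_gradient j u x)"
    and "sq_integrable u" and "sq_integrable (weak_gradient j u)"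
proof -
  have H1: "(\<lambda>x. u x $ k) \<in> H1" for k using u by (simp add: H1_vec_def)
  show su: "sq_integrable u" using H1 by (intro sq_integrable_vec) (auto simp: H1_def)
  show sg: "sq_integrable (weak_gradient j u)"
    using weak_partial_L2(1)[OF H1] by (intro sq_integrable_vec) (simp add: weak_gradient_def)
  have comp: "(LINT x|lebesgue. f x) $ k = (LINT x|lebesgue. f x $ k)" if "integrable lebesgue f" for f :: "real^3 \<Rightarrow> complex^2" and k
    using integral_bounded_linear[OF bounded_linear_vec_nth that, of k] by simp
  show "(LINT x|lebesgue. frechet_derivative h (at x) (axis j 1) *\<^sub>R u x) = - (LINT x|lebesgue. h x *\<^sub>R weak_gradient j u x)"
    unfolding vec_eq_iff
  proof
    fix k
    show "(LINT x|lebesgue. frechet_derivative h (at x) (axis j 1) *\<^sub>R u x) $ k = (- (LINT x|lebesgue. h x *\<^sub>R weak_gradient j u x)) $ k"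
    proof -
      have "(LINT x|lebesgue. h x *\<^sub>R weak_gradient j u x) $ k = (LINT x|lebesgue. h x *\<^sub>R weak_partial j (\<lambda>y. u y $ k) x)"
        unfolding comp[OF test_fun_mult_integrable[OF h sg]] by (simp add: weak_gradient_def)
      moreover have "(LINT x|lebesgue. frechet_derivative h (at x) (axis j 1) *\<^sub>R u x) $ k
          = (LINT x|lebesgue. frechet_derivative h (at x) (axis j 1) *\<^sub>R u x $ k)"
        unfolding comp[OF test_fun_mult_integrable[OF test_fun_derivative[OF h] su]] by simp
      ultimately show ?thesis
        using weak_partial_L2(2)[OF H1[of k], of j] h by (simp add: has_weak_partial_def)
    qed
  qed
qed

lemma lebesgue_ex_borel:
  fixes f :: "'a::euclidean_space \<Rightarrow> 'b::euclidean_space"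
  assumes "f \<in> borel_measurable lebesgue"
  shows "\<exists>g\<in>borel_measurable borel. AE x in lebesgue. g x = f x"
proof -
  have "\<exists>g\<in>borel_measurable lborel. AE x in lborel. f x \<bullet> b = g x" for b
    using assms by (intro completion_ex_borel_measurable_real) auto
  then obtain g where g: "\<And>b. g b \<in> borel_measurable lborel" "\<And>b. AE x in lborel. f x \<bullet> b = g b x"
    by metis
  have "AE x in lborel. \<forall>b\<in>Basis. f x \<bullet> b = g b x"
    by (subst AE_ball_countable) (auto simp: g countable_finite)
  then have "AE x in lborel. (\<Sum>b\<in>Basis. g b x *\<^sub>R b) = f x"
    by eventually_elim (metis (no_types, lifting) euclidean_representation sum.cong)
  then have "AE x in lebesgue. (\<Sum>b\<in>Basis. g b x *\<^sub>R b) = f x" by (rule AE_completion)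
  moreover have "(\<lambda>x. \<Sum>b\<in>Basis. g b x *\<^sub>R b) \<in> borel_measurable borel"
    using g(1) by simp
  ultimately show ?thesis by (rule bexI[of "\<lambda>g. AE x in lebesgue. g x = f x"])
qed

lemma sq_integrable_borel:
  assumes f: "sq_integrable f" and [measurable]: "g \<in> borel_measurable borel" and eq: "AE x in lebesgue. g x = f x"
  shows "integrable lborel (\<lambda>x. (norm (g x))\<^sup>2)"
proof -
  have "integrable lebesgue (\<lambda>x. (norm (g x))\<^sup>2) \<longleftrightarrow> integrable lebesgue (\<lambda>x. (norm (f x))\<^sup>2)"
  proof (rule integrable_cong_AE)
    show "AE x in lebesgue. (norm (g x))\<^sup>2 = (norm (f x))\<^sup>2" using eq by eventually_elim simp
    show "(\<lambda>x. (norm (g x))\<^sup>2) \<in> borel_measurable lebesgue"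
      by (rule measurable_completion) simp
    show "(\<lambda>x. (norm (f x))\<^sup>2) \<in> borel_measurable lebesgue"
      using f borel_measurable_integrable unfolding sq_integrable_def by blast
  qed
  then have "integrable lebesgue (\<lambda>x. (norm (g x))\<^sup>2)" using f by (simp add: sq_integrable_def)
  then show ?thesis by (subst (asm) integrable_completion) auto
qed

text \<open>
  A Sobolev function and \<open>\<sigma>\<cdot>D\<close> applied to it have Borel representatives, and these satisfy the
  weak equation.
\<close>

lemma H1_weak_dirac:
  fixes u :: "real^3 \<Rightarrow> complex^2"
  assumes u: "u \<in> H1_vec"
  shows "\<exists>v F. v \<in> borel_measurable borel \<and> F \<in> borel_measurable borel
      \<and> (AE x in lborel. v x = u x) \<and> (AE x in lborel. F x = free_dirac u x)
      \<and> integrable lborel (\<lambda>x. (norm (v x))\<^sup>2) \<and> integrable lborel (\<lambda>x. (norm (F x))\<^sup>2) \<and> weak_dirac_eq v F"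
proof -
  have su: "sq_integrable u" and sg: "\<And>j. sq_integrable (weak_gradient j u)"
    using weak_gradient_identity(2,3)[OF u kernel_test_test_fun[of 1 1]] by auto
  have cliff_meas: "(\<lambda>x. cliff (axis j 1) (weak_gradient j u x)) \<in> borel_measurable lebesgue" for j
    using sg by (intro cliff_measurable) (auto simp: sq_integrable_def)
  have sc: "sq_integrable (\<lambda>x. cliff (axis j 1) (weak_gradient j u x))" for j
    by (rule sq_integrable_bound[OF sg[of j] cliff_meas]) (simp add: norm_cliff norm_axis_1)
  have ss: "sq_integrable (\<lambda>x. \<Sum>j\<in>UNIV. cliff (axis j 1) (weak_gradient j u x))"
    by (intro sq_integrable_sum sc)
  have fm: "free_dirac u \<in> borel_measurable lebesgue"
    unfolding free_dirac_def[abs_def] using ss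
    by (intro borel_measurable_uminus imult_measurable) (simp add: sq_integrable_def)
  have sF: "sq_integrable (free_dirac u)"
    by (rule sq_integrable_bound[OF ss fm]) (simp add: free_dirac_def norm_imult)
  obtain v where v: "v \<in> borel_measurable borel" "AE x in lebesgue. v x = u x"
    using lebesgue_ex_borel[of u] su unfolding sq_integrable_def by auto
  obtain F where F: "F \<in> borel_measurable borel" "AE x in lebesgue. F x = free_dirac u x"
    using lebesgue_ex_borel[OF fm] by auto
  have "weak_dirac_eq v F"
    unfolding weak_dirac_eq_def
  proof (intro allI impI)
    fix h assume h: "test_fun h"
    let ?d = "\<lambda>j x. frechet_derivative h (at x) (axis j 1)"
    have [measurable]: "h \<in> borel_measurable borel" "(\<lambda>x. ?d j x) \<in> borel_measurable borel" for j
      using test_fun_measurable[OF h] test_fun_measurable[OF test_fun_derivative[OF h]] by auto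
    have [measurable]: "test_gradient h \<in> borel_measurable borel"
    proof -
      have "test_gradient h = (\<lambda>x. \<Sum>j\<in>UNIV. ?d j x *\<^sub>R axis j 1)"
        by (simp add: fun_eq_iff test_gradient_def vec_eq_iff axis_def sum_component if_distrib[of "(*) _"] cong: if_cong)
      then show ?thesis by simp
    qed
    note [measurable] = v(1) F(1)
    have meas_u: "u \<in> borel_measurable lebesgue" using su by (simp add: sq_integrable_def)
    have leb: "f \<in> borel_measurable borel \<Longrightarrow> f \<in> borel_measurable lebesgue" for f :: "real^3 \<Rightarrow> 'c::topological_space"
      by (rule measurable_completion) simp
    have "(LINT y|lborel. cliff (test_gradient h y) (v y)) = (LINT y|lebesgue. cliff (test_gradient h y) (v y))"
      by (rule integral_completion[symmetric]) simp
    also have "\<dots> = (LINT y|lebesgue. cliff (test_gradient h y) (u y))"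
    proof (rule integral_cong_AE)
      show "(\<lambda>y. cliff (test_gradient h y) (v y)) \<in> borel_measurable lebesgue"
        by (rule leb) measurable
      show "(\<lambda>y. cliff (test_gradient h y) (u y)) \<in> borel_measurable lebesgue"
        by (rule cliff_measurable[OF leb meas_u]) measurable
      show "AE y in lebesgue. cliff (test_gradient h y) (v y) = cliff (test_gradient h y) (u y)"
        using v(2) by eventually_elim simp
    qed
    also have "\<dots> = (LINT y|lebesgue. (\<Sum>j\<in>UNIV. cliff (axis j 1) (?d j y *\<^sub>R u y)))"
    proof -
      have "cliff (test_gradient h y) (u y) = (\<Sum>j\<in>UNIV. cliff (axis j 1) (?d j y *\<^sub>R u y))" for y
        by (subst cliff_axis_sum[symmetric]) (simp add: test_gradient_def cliff.scaleR_right)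
      then show ?thesis by simp
    qed
    also have "\<dots> = (\<Sum>j\<in>UNIV. LINT y|lebesgue. cliff (axis j 1) (?d j y *\<^sub>R u y))"
      by (intro Bochner_Integration.integral_sum integrable_bounded_linear[OF cliff.bounded_linear_right]
          test_fun_mult_integrable test_fun_derivative h su)
    also have "\<dots> = (\<Sum>j\<in>UNIV. cliff (axis j 1) (LINT y|lebesgue. ?d j y *\<^sub>R u y))"
      by (intro sum.cong refl integral_bounded_linear[OF cliff.bounded_linear_right]
          test_fun_mult_integrable test_fun_derivative h su)
    also have "\<dots> = - (\<Sum>j\<in>UNIV. cliff (axis j 1) (LINT y|lebesgue. h y *\<^sub>R weak_gradient j u y))"
      unfolding weak_gradient_identity(1)[OF u h] by (simp add: cliff.minus_right sum_negf)
    also have "(\<Sum>j\<in>UNIV. cliff (axis j 1) (LINT y|lebesgue. h y *\<^sub>R weak_gradient j u y))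
        = (\<Sum>j\<in>UNIV. LINT y|lebesgue. cliff (axis j 1) (h y *\<^sub>R weak_gradient j u y))"
      by (intro sum.cong refl integral_bounded_linear[OF cliff.bounded_linear_right, symmetric]
          test_fun_mult_integrable h sg)
    also have "\<dots> = (LINT y|lebesgue. (\<Sum>j\<in>UNIV. cliff (axis j 1) (h y *\<^sub>R weak_gradient j u y)))"
      by (intro Bochner_Integration.integral_sum[symmetric] integrable_bounded_linear[OF cliff.bounded_linear_right]
          test_fun_mult_integrable h sg)
    also have "\<dots> = (LINT y|lebesgue. h y *\<^sub>R (\<i> *s free_dirac u y))"
    proof -
      have "\<i> *s free_dirac u y = (\<Sum>j\<in>UNIV. cliff (axis j 1) (weak_gradient j u y))" for y
        by (simp add: free_dirac_def vec_eq_iff)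
      then show ?thesis by (simp add: cliff.scaleR_right scaleR_sum_right)
    qed
    also have "\<dots> = (LINT y|lebesgue. h y *\<^sub>R (\<i> *s F y))"
    proof (rule integral_cong_AE)
      show "(\<lambda>y. h y *\<^sub>R (\<i> *s free_dirac u y)) \<in> borel_measurable lebesgue"
        by (rule borel_measurable_scaleR[OF leb imult_measurable[OF fm]]) measurable
      show "(\<lambda>y. h y *\<^sub>R (\<i> *s F y)) \<in> borel_measurable lebesgue"
        by (rule leb) measurable
      show "AE y in lebesgue. h y *\<^sub>R (\<i> *s free_dirac u y) = h y *\<^sub>R (\<i> *s F y)"
        using F(2) by eventually_elim simp
    qed
    also have "\<dots> = (LINT y|lborel. h y *\<^sub>R (\<i> *s F y))"
      by (rule integral_completion) simp
    finally show "(LINT y|lborel. cliff (test_gradient h y) (v y)) = - (LINT y|lborel. h y *\<^sub>R (\<i> *s F y))" .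
  qed
  then show ?thesis
    using v F sq_integrable_borel[OF su v] sq_integrable_borel[OF sF F] unfolding AE_completion_iff by blast
qed

section \<open>Modes of the magnetic Dirac operator\<close>

text \<open>
  The continuous representative is the potential of \<open>F = \<sigma>\<cdot>A \<phi>\<close> divided by \<open>4\<pi>\<close>.
\<close>

lemma zero_mode_asymptotics:
  fixes \<phi> :: "real^3 \<Rightarrow> complex^2"
  assumes \<phi>: "\<phi> \<in> H1_vec" and zero: "AE x in lebesgue. weyl_dirac A \<phi> x = 0"
    and Am: "A \<in> borel_measurable lebesgue"
    and A: "\<And>x. norm (A x) \<le> c * japanese_bracket x powr - \<rho>" and c: "c > 0" and rho: "\<rho> > 1"
  shows "\<exists>g. continuous_on UNIV g \<and> (AE x in lebesgue. g x = \<phi> x)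
      \<and> (\<forall>\<omega>. integrable lebesgue (profile_integrand A \<phi> \<omega>))
      \<and> uniform_limit (sphere 0 1) (\<lambda>(r::real) \<omega>. r\<^sup>2 *\<^sub>R g (r *\<^sub>R \<omega>)) (profile A \<phi>) at_top"
proof -
  let ?J = japanese_bracket
  obtain v F where v: "v \<in> borel_measurable borel" and F: "F \<in> borel_measurable borel"
    and v_eq: "AE x in lborel. v x = \<phi> x" and F_free: "AE x in lborel. F x = free_dirac \<phi> x"
    and L2: "integrable lborel (\<lambda>x. (norm (v x))\<^sup>2)" "integrable lborel (\<lambda>x. (norm (F x))\<^sup>2)"
    and weak: "weak_dirac_eq v F"
    using H1_weak_dirac[OF \<phi>] by blast
  note [measurable] = v F
  have F_eq: "AE x in lborel. F x = cliff (A x) (\<phi> x)"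
    using F_free zero[unfolded AE_completion_iff]
    by eventually_elim (simp add: weyl_dirac_eq)
  have F_le: "AE x in lborel. norm (F x) \<le> c * ?J x powr - \<rho> * norm (v x)"
    using F_eq v_eq by eventually_elim (simp add: norm_cliff A mult_right_mono)
  obtain K where K: "K \<ge> 0" and F_bound: "AE y in lborel. norm (F y) \<le> K * ?J y powr - (\<rho> + 2)"
    using zero_mode_source_decay[OF v F L2 weak c rho F_le] by blast
  have t: "\<rho> + 2 > 3" using rho by simp
  define g where "g x = (1 / (4 * pi)) *\<^sub>R spin_potential F x" for x
  have profile_eq: "AE y in lebesgue. cliff \<omega> (F y) = profile_integrand A \<phi> \<omega> y" for \<omega>
    unfolding AE_completion_iff using F_eq
    by eventually_elim (simp add: profile_integrand_def cliff_cliff_profile)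
  have int_F: "integrable lborel (\<lambda>y. cliff \<omega> (F y))" for \<omega>
    by (rule integrable_bounded_linear[OF cliff.bounded_linear_right AE_bound_integrable[OF F F_bound t]])
  have \<phi>m: "\<phi> \<in> borel_measurable lebesgue"
    using weak_gradient_identity(2)[OF \<phi> kernel_test_test_fun[of 1 1]] by (simp add: sq_integrable_def)
  have meas: "profile_integrand A \<phi> \<omega> \<in> borel_measurable lebesgue" for \<omega>
  proof -
    have "profile_integrand A \<phi> \<omega> = (\<lambda>y. cliff \<omega> (cliff (A y) (\<phi> y)))"
      by (simp add: fun_eq_iff profile_integrand_def cliff_cliff_profile)
    then show ?thesis using cliff_measurable[OF measurable_const cliff_measurable[OF Am \<phi>m], of \<omega>] by simp
  qed
  have int_profile: "integrable lebesgue (profile_integrand A \<phi> \<omega>)" for \<omega>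
  proof (rule integrable_cong_AE_imp[OF _ meas profile_eq])
    show "integrable lebesgue (\<lambda>y. cliff \<omega> (F y))"
      using int_F by (subst integrable_completion) auto
  qed
  have "profile A \<phi> \<omega> = (1 / (4 * pi)) *\<^sub>R (LINT y|lborel. icliff \<omega> (F y))" for \<omega>
  proof -
    have "(LINT y|lebesgue. profile_integrand A \<phi> \<omega> y) = (LINT y|lebesgue. cliff \<omega> (F y))"
    proof (rule integral_cong_AE)
      show "AE y in lebesgue. profile_integrand A \<phi> \<omega> y = cliff \<omega> (F y)"
        using profile_eq[of \<omega>] by eventually_elim simp
      show "(\<lambda>y. cliff \<omega> (F y)) \<in> borel_measurable lebesgue"
        by (rule measurable_completion) simp
    qed (rule meas)
    also have "\<dots> = (LINT y|lborel. cliff \<omega> (F y))"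
      by (rule integral_completion) simp
    finally have "profile A \<phi> \<omega> = (\<i> / (4 * complex_of_real pi)) *s (LINT y|lborel. cliff \<omega> (F y))"
      unfolding profile_def by simp
    also have "\<dots> = (1 / (4 * pi)) *\<^sub>R (\<i> *s (LINT y|lborel. cliff \<omega> (F y)))"
      by (simp add: vec_eq_iff scaleR_conv_of_real[where 'a = complex])
    also have "\<i> *s (LINT y|lborel. cliff \<omega> (F y)) = (LINT y|lborel. icliff \<omega> (F y))"
      unfolding icliff_def by (rule integral_bounded_linear[OF bounded_linear_imult int_F, symmetric])
    finally show ?thesis .
  qed
  then have profile: "profile A \<phi> = (\<lambda>\<omega>. (1 / (4 * pi)) *\<^sub>R (LINT y|lborel. icliff \<omega> (F y)))"
    by (simp add: fun_eq_iff)
  have "uniform_limit (sphere 0 1) (\<lambda>(r::real) \<omega>. (1 / (4 * pi)) *\<^sub>R (r\<^sup>2 *\<^sub>R spin_potential F (r *\<^sub>R \<omega>))) (profile A \<phi>) at_top"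
    unfolding profile
    by (rule bounded_linear.uniform_limit[OF bounded_linear_scaleR_right spin_potential_asymptotics[OF F F_bound t K]])
  then have "uniform_limit (sphere 0 1) (\<lambda>(r::real) \<omega>. r\<^sup>2 *\<^sub>R g (r *\<^sub>R \<omega>)) (profile A \<phi>) at_top"
    by (simp add: g_def mult.commute)
  moreover have "continuous_on UNIV g"
    unfolding g_def by (intro continuous_intros spin_potential_continuous[OF F F_bound t K])
  moreover have "AE x in lebesgue. g x = \<phi> x"
    unfolding AE_completion_iff using spin_potential_representation[OF v F L2 weak] v_eq
    by eventually_elim (simp add: g_def)
  ultimately show ?thesis using int_profile by blast
qed

lemma weyl_partner_vanishes:
  fixes a b :: "real^3 \<Rightarrow> complex^2"
  assumes H: "a \<in> H1_vec" "b \<in> H1_vec" and eqs: "AE x in lebesgue. weyl_dirac A b x = 0"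
      "AE x in lebesgue. weyl_dirac A a x = k *\<^sub>R b x" and k: "k \<noteq> 0"
    and A: "\<And>x. norm (A x) \<le> c * japanese_bracket x powr - \<rho>" and c: "c > 0" and rho: "\<rho> > 1"
  shows "AE x in lebesgue. b x = 0"
proof -
  obtain u f where u: "u \<in> borel_measurable borel" and f: "f \<in> borel_measurable borel"
    and u_eq: "AE x in lborel. u x = a x" and f_eq: "AE x in lborel. f x = free_dirac a x"
    and L2u: "integrable lborel (\<lambda>x. (norm (u x))\<^sup>2)" "integrable lborel (\<lambda>x. (norm (f x))\<^sup>2)"
    and weak_u: "weak_dirac_eq u f"
    using H1_weak_dirac[OF H(1)] by blast
  obtain v g where v: "v \<in> borel_measurable borel" and g: "g \<in> borel_measurable borel"
    and v_eq: "AE x in lborel. v x = b x" and g_eq: "AE x in lborel. g x = free_dirac b x"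
    and L2v: "integrable lborel (\<lambda>x. (norm (v x))\<^sup>2)" "integrable lborel (\<lambda>x. (norm (g x))\<^sup>2)"
    and weak_v: "weak_dirac_eq v g"
    using H1_weak_dirac[OF H(2)] by blast
  have "AE x in lborel. v x = 0"
  proof (rule partner_vanishes[OF u f v g L2u L2v weak_u weak_v _ _ _ c rho k])
    show "AE x in lborel. f x = cliff (A x) (u x) + k *\<^sub>R v x"
      using f_eq u_eq v_eq eqs(2)[unfolded AE_completion_iff]
      by eventually_elim (simp add: weyl_dirac_eq algebra_simps)
    show "AE x in lborel. g x = cliff (A x) (v x)"
      using g_eq v_eq eqs(1)[unfolded AE_completion_iff]
      by eventually_elim (simp add: weyl_dirac_eq)
  qed (simp add: A)
  then show ?thesis
    unfolding AE_completion_iff using v_eq by eventually_elim simp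
qed

definition upper :: "(real^3 \<Rightarrow> complex^4) \<Rightarrow> real^3 \<Rightarrow> complex^2" where
  "upper f x = vector [f x $ 1, f x $ 2]"

definition lower :: "(real^3 \<Rightarrow> complex^4) \<Rightarrow> real^3 \<Rightarrow> complex^2" where
  "lower f x = vector [f x $ 3, f x $ 4]"

lemma upper_lower_nth [simp]:
  "upper f x $ 1 = f x $ 1" "upper f x $ 2 = f x $ 2" "lower f x $ 1 = f x $ 3" "lower f x $ 2 = f x $ 4"
  by (simp_all add: upper_def lower_def vector_2)

lemma vector_4_nth:
  "(vector [w, x, y, z] :: 'a::zero^4) $ 1 = w" "(vector [w, x, y, z] :: 'a^4) $ 2 = x"
  "(vector [w, x, y, z] :: 'a^4) $ 3 = y" "(vector [w, x, y, z] :: 'a^4) $ 4 = z"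
  by (simp_all add: vector_def)

lemma spinor_pair_nth:
  "spinor_pair a b $ 1 = a $ 1" "spinor_pair a b $ 2 = a $ 2" "spinor_pair a b $ 3 = b $ 1" "spinor_pair a b $ 4 = b $ 2"
  by (simp_all add: spinor_pair_def vector_4_nth)

lemma spinor_pair_eq_iff: "spinor_pair a b = spinor_pair a' b' \<longleftrightarrow> a = a' \<and> b = b'"
  by (auto simp: vec_eq_iff forall_4 forall_2 spinor_pair_nth)

lemma spinor_pair_upper_lower: "spinor_pair (upper f x) (lower f x) = f x"
  by (simp add: vec_eq_iff forall_4 spinor_pair_nth)

lemma bounded_linear_spinor_pair:
  "bounded_linear (\<lambda>a. spinor_pair a 0)" "bounded_linear (\<lambda>b. spinor_pair 0 b)"
proof -
  have "linear (\<lambda>a. spinor_pair a 0)" "linear (\<lambda>b. spinor_pair 0 b)"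
    by (rule linearI; simp add: vec_eq_iff forall_4 spinor_pair_nth)+
  then show "bounded_linear (\<lambda>a. spinor_pair a 0)" "bounded_linear (\<lambda>b. spinor_pair 0 b)"
    by (simp_all add: linear_conv_bounded_linear)
qed

text \<open>
  The Dirac matrices \<open>\<alpha>\<^sub>j\<close> exchange the two halves of a spinor and \<open>\<beta>\<close> changes the sign of the
  second.
\<close>

lemma dirac_spinor_pair:
  "dirac m A f x = spinor_pair (weyl_dirac A (lower f) x + m *\<^sub>R upper f x) (weyl_dirac A (upper f) x - m *\<^sub>R lower f x)"
proof -
  have "dirac m A f x $ i = spinor_pair (weyl_dirac A (lower f) x + m *\<^sub>R upper f x) (weyl_dirac A (upper f) x - m *\<^sub>R lower f x) $ i" for i
    using exhaust_4[of i]
    by (elim disjE)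
       (simp_all add: spinor_pair_nth dirac_def weyl_dirac_def dirac_alpha_def dirac_beta_def block_def
         matrix_vector_mult_def sum_2 sum_3 sum_4 vector_4_nth mag_momentum_def mat_def scaleR_conv_of_real[where 'a = complex])
  then show ?thesis by (simp add: vec_eq_iff)
qed

lemma upper_lower_H1:
  assumes "f \<in> H1_vec"
  shows "upper f \<in> H1_vec" "lower f \<in> H1_vec"
  using assms by (auto simp: H1_vec_def forall_2 forall_4)

lemma norm_le_of_components:
  assumes "\<And>j. \<bar>v $ j\<bar> \<le> b"
  shows "norm (v :: real^3) \<le> 3 * b"
proof -
  have "norm v \<le> (\<Sum>j\<in>UNIV. \<bar>v $ j\<bar>)" by (rule norm_le_l1_cart)
  also have "\<dots> \<le> (\<Sum>j\<in>(UNIV :: 3 set). b)" by (intro sum_mono assms)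
  finally show ?thesis by simp
qed

theorem theorem3p1:
  fixes m C \<rho> :: real
    and A :: "real^3 \<Rightarrow> real^3"
    and f :: "real^3 \<Rightarrow> complex^4"
  assumes "m > 0"
    and "A \<in> borel_measurable lebesgue"
    and "C > 0" and "\<rho> > 1"
    and "\<And>x j. \<bar>A x $ j\<bar> \<le> C * japanese_bracket x powr (- \<rho>)"
  shows "(eigenfunction (dirac m A) (complex_of_real m) f \<longrightarrow>
           (\<exists>g \<phi>. continuous_rep f g \<and> zero_mode A \<phi> \<and>
              (\<forall>\<omega> \<in> sphere 0 1. integrable lebesgue (profile_integrand A \<phi> \<omega>)) \<and>
              (\<forall>\<omega> \<in> sphere 0 1.
                 ((\<lambda>r::real. r\<^sup>2 *\<^sub>R g (r *\<^sub>R \<omega>)) \<longlongrightarrow> spinor_pair (profile A \<phi> \<omega>) 0) at_top) \<and>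
              uniform_limit (sphere 0 1) (\<lambda>(r::real) \<omega>. r\<^sup>2 *\<^sub>R g (r *\<^sub>R \<omega>))
                (\<lambda>\<omega>. spinor_pair (profile A \<phi> \<omega>) 0) at_top))
       \<and> (eigenfunction (dirac m A) (- complex_of_real m) f \<longrightarrow>
           (\<exists>g \<phi>. continuous_rep f g \<and> zero_mode A \<phi> \<and>
              (\<forall>\<omega> \<in> sphere 0 1. integrable lebesgue (profile_integrand A \<phi> \<omega>)) \<and>
              (\<forall>\<omega> \<in> sphere 0 1.
                 ((\<lambda>r::real. r\<^sup>2 *\<^sub>R g (r *\<^sub>R \<omega>)) \<longlongrightarrow> spinor_pair 0 (profile A \<phi> \<omega>)) at_top) \<and>
              uniform_limit (sphere 0 1) (\<lambda>(r::real) \<omega>. r\<^sup>2 *\<^sub>R g (r *\<^sub>R \<omega>))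
                (\<lambda>\<omega>. spinor_pair 0 (profile A \<phi> \<omega>)) at_top))"
proof -
  have A: "norm (A x) \<le> (3 * C) * japanese_bracket x powr - \<rho>" for x
    using norm_le_of_components[OF assms(5), of x] by simp
  have C: "3 * C > 0" using assms by simp
  let ?a = "upper f" and ?b = "lower f"
  have zero_modeI: "zero_mode A \<phi>" if "\<phi> \<in> H1_vec" "\<not> (AE x in lebesgue. \<phi> x = 0)" "AE x in lebesgue. weyl_dirac A \<phi> x = 0" for \<phi>
    using that unfolding eigenfunction_def by simp
  have conclusion: "\<exists>g \<phi>. continuous_rep f g \<and> zero_mode A \<phi> \<and>
      (\<forall>\<omega> \<in> sphere 0 1. integrable lebesgue (profile_integrand A \<phi> \<omega>)) \<and>
      (\<forall>\<omega> \<in> sphere 0 1. ((\<lambda>r::real. r\<^sup>2 *\<^sub>R g (r *\<^sub>R \<omega>)) \<longlongrightarrow> P (profile A \<phi> \<omega>)) at_top) \<and>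
      uniform_limit (sphere 0 1) (\<lambda>(r::real) \<omega>. r\<^sup>2 *\<^sub>R g (r *\<^sub>R \<omega>)) (\<lambda>\<omega>. P (profile A \<phi> \<omega>)) at_top"
    if P: "bounded_linear P" and \<phi>: "\<phi> \<in> H1_vec" "AE x in lebesgue. weyl_dirac A \<phi> x = 0"
      and f: "AE x in lebesgue. P (\<phi> x) = f x" "\<not> (AE x in lebesgue. f x = 0)"
    for P :: "complex^2 \<Rightarrow> complex^4" and \<phi>
  proof -
    interpret P: bounded_linear P by fact
    obtain g where g: "continuous_on UNIV g" "AE x in lebesgue. g x = \<phi> x"
      "\<And>\<omega>. integrable lebesgue (profile_integrand A \<phi> \<omega>)"
      "uniform_limit (sphere 0 1) (\<lambda>(r::real) \<omega>. r\<^sup>2 *\<^sub>R g (r *\<^sub>R \<omega>)) (profile A \<phi>) at_top"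
      using zero_mode_asymptotics[OF \<phi> assms(2) A C assms(4)] by blast
    have "uniform_limit (sphere 0 1) (\<lambda>(r::real) \<omega>. P (r\<^sup>2 *\<^sub>R g (r *\<^sub>R \<omega>))) (\<lambda>\<omega>. P (profile A \<phi> \<omega>)) at_top"
      by (rule P.uniform_limit[OF g(4)])
    then have ul: "uniform_limit (sphere 0 1) (\<lambda>(r::real) \<omega>. r\<^sup>2 *\<^sub>R P (g (r *\<^sub>R \<omega>))) (\<lambda>\<omega>. P (profile A \<phi> \<omega>)) at_top"
      by (simp add: P.scaleR)
    have "\<not> (AE x in lebesgue. \<phi> x = 0)"
    proof
      assume "AE x in lebesgue. \<phi> x = 0"
      with f(1) have "AE x in lebesgue. f x = 0"
        by eventually_elim (metis P.zero)
      with f(2) show False ..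
    qed
    then have "zero_mode A \<phi>" by (rule zero_modeI[OF \<phi>(1) _ \<phi>(2)])
    moreover have "continuous_rep f (\<lambda>x. P (g x))"
      unfolding continuous_rep_def
    proof
      show "continuous_on UNIV (\<lambda>x. P (g x))" by (rule P.continuous_on[OF g(1)])
      show "AE x in lebesgue. P (g x) = f x" using f(1) g(2) by eventually_elim simp
    qed
    ultimately show ?thesis
      using g(3) ul tendsto_uniform_limitI[OF ul] by blast
  qed
  have eqs: "AE x in lebesgue. weyl_dirac A ?b x + m *\<^sub>R ?a x = e *\<^sub>R ?a x \<and> weyl_dirac A ?a x - m *\<^sub>R ?b x = e *\<^sub>R ?b x"
    and f: "f \<in> H1_vec" "\<not> (AE x in lebesgue. f x = 0)"
    if ef: "eigenfunction (dirac m A) (complex_of_real e) f" for e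
  proof -
    show "f \<in> H1_vec" "\<not> (AE x in lebesgue. f x = 0)" using ef by (auto simp: eigenfunction_def)
    have "complex_of_real e *s f x = spinor_pair (e *\<^sub>R ?a x) (e *\<^sub>R ?b x)" for x
      by (simp add: vec_eq_iff forall_4 spinor_pair_nth scaleR_conv_of_real[where 'a = complex])
    then show "AE x in lebesgue. weyl_dirac A ?b x + m *\<^sub>R ?a x = e *\<^sub>R ?a x \<and> weyl_dirac A ?a x - m *\<^sub>R ?b x = e *\<^sub>R ?b x"
      using ef by (simp add: eigenfunction_def dirac_spinor_pair spinor_pair_eq_iff)
  qed
  show ?thesis
  proof (intro conjI impI, goal_cases)
    case ef: 1
    note H = upper_lower_H1[OF f(1)[OF ef]]
    have b: "AE x in lebesgue. weyl_dirac A ?b x = 0" using eqs[OF ef] by eventually_elim simp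
    have a: "AE x in lebesgue. weyl_dirac A ?a x = (2 * m) *\<^sub>R ?b x"
      using eqs[OF ef] by eventually_elim (simp add: algebra_simps scaleR_2[symmetric])
    have b0: "AE x in lebesgue. ?b x = 0"
      using assms(1) by (intro weyl_partner_vanishes[OF H b a _ A C assms(4)]) simp
    show ?case
    proof (rule conclusion[OF bounded_linear_spinor_pair(1) H(1) _ _ f(2)[OF ef]])
      show "AE x in lebesgue. weyl_dirac A ?a x = 0" using a b0 by eventually_elim simp
      show "AE x in lebesgue. spinor_pair (?a x) 0 = f x"
        using b0 by eventually_elim (metis spinor_pair_upper_lower)
    qed
  next
    case 2
    then have ef: "eigenfunction (dirac m A) (complex_of_real (- m)) f" by simp
    note H = upper_lower_H1[OF f(1)[OF ef]]
    have a: "AE x in lebesgue. weyl_dirac A ?a x = 0" using eqs[OF ef] by eventually_elim simp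
    have b: "AE x in lebesgue. weyl_dirac A ?b x = (- (2 * m)) *\<^sub>R ?a x"
      using eqs[OF ef]
    proof eventually_elim
      case (elim x)
      then have "weyl_dirac A ?b x = (- m) *\<^sub>R ?a x - m *\<^sub>R ?a x"
        by (simp only: eq_diff_eq)
      also have "\<dots> = (- m - m) *\<^sub>R ?a x"
        by (simp only: scaleR_left_diff_distrib)
      finally show ?case by simp
    qed
    have a0: "AE x in lebesgue. ?a x = 0"
      using assms(1) by (intro weyl_partner_vanishes[OF H(2,1) a b _ A C assms(4)]) simp
    show ?case
    proof (rule conclusion[OF bounded_linear_spinor_pair(2) H(2) _ _ f(2)[OF ef]])
      show "AE x in lebesgue. weyl_dirac A ?b x = 0" using b a0 by eventually_elim simp
      show "AE x in lebesgue. spinor_pair 0 (?b x) = f x"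
        using a0 by eventually_elim (metis spinor_pair_upper_lower)
    qed
  qed
qed

end
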